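(* Let $F$ be a self-affine carpet (as defined in the context). Then either \[ \dim_{\mathrm L}F<\dim_{\mathrm B}F \] or \[ \dim_{\mathrm L}F=\dim_{\mathrm H}F=\dim_{\mathrm B}F=\dim_{\mathrm A}F. \]
   Context: Self-affine carpets. Two classes of finite iterated function systems (IFS) on $[0,1]^2$ are considered. Extended Lalley–Gatzouras class: divide $[0,1]^2$ into columns by a finite positive number of vertical lines; divide each column independently into rectangles by horizontal slices; select a subset of the resulting rectangles, subject only to the requirement that each selected rectangle has base length greater than or equal to its height. Barański class: divide $[0,1]^2$ into a grid of rectangles by a finite number of full vertical lines and full horizontal lines (at least one in each direction); select any subset of the resulting rectangles. In both cases, for each selected rectangle include in the IFS the orientation-preserving map $S_i(x,y)=(c_ix,d_iy)+(a_i,b_i)$ taking $[0,1]^2$ onto that rectangle; thus $c_i,d_i\in(0,1)$ are its base length and height. The index set is $\mathcal I$, finite with $|\mathcal I|\geq2$. The attractor is the unique non-empty compact $F$ with $F=\bigcup_{i\in\mathcal I}S_i(F)$. $F$ is called a self-affine carpet if it is the attractor of an IFS in one of these two classes with at least one map that is not a similarity (i.e. $c_i\neq d_i$ for some $i$). $\dim_{\mathrm H}$ and $\dim_{\mathrm B}$ are Hausdorff and box dimension. With $N_r(E)$ the smallest number of open sets of diameter at most $r$ needed to cover $E$ and $B(x,R)$ the closed ball, \[ \dim_{\mathrm A}F=\inf\Big\{\alpha:\ \exists\, C,\rho>0 \text{ such that for all } 0<r<R\leq\rho,\ \sup_{x\in F}N_r(B(x,R)\cap F)\leq C (R/r)^{\alpha}\Big\},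 \] \[ \dim_{\mathrm L}F=\sup\Big\{\alpha:\ \exists\, C,\rho>0 \text{ such that for all } 0<r<R\leq\rho,\ \inf_{x\in F}N_r(B(x,R)\cap F)\geq C (R/r)^{\alpha}\Big\}. \] *)

theory Defs
  imports "HOL-Analysis.Analysis"
begin

section \<open>Dimensions\<close>

text \<open>
  The dimensions are real numbers. The infima, suprema and minima below are over non-empty
  sets with the appropriate bound whenever the argument is a non-empty bounded subset of a
  Euclidean space, which is the only case of interest here.

  In the library, the diameter of an unbounded set is a meaningless real number, so
  boundedness of the covering sets has to be demanded explicitly.
\<close>

definition covering_number :: "real \<Rightarrow> 'a::euclidean_space set \<Rightarrow> nat" where
  "covering_number r E = (LEAST n. \<exists>\<U>. finite \<U> \<and> card \<U> = n \<and> E \<subseteq> \<Union>\<U> \<and>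
      (\<forall>U\<in>\<U>. open U \<and> bounded U \<and> diameter U \<le> r))"

definition has_box_dim :: "'a::euclidean_space set \<Rightarrow> real \<Rightarrow> bool" where
  "has_box_dim E s \<longleftrightarrow>
     ((\<lambda>r. ln (real (covering_number r E)) / - ln r) \<longlongrightarrow> s) (at_right 0)"

definition box_dim :: "'a::euclidean_space set \<Rightarrow> real" where
  "box_dim E = Lim (at_right 0) (\<lambda>r. ln (real (covering_number r E)) / - ln r)"

definition assouad_dim :: "'a::euclidean_space set \<Rightarrow> real" where
  "assouad_dim E = Inf {\<alpha>. \<exists>C \<rho>. C > 0 \<and> \<rho> > 0 \<and>
     (\<forall>r R. 0 < r \<and> r < R \<and> R \<le> \<rho> \<longrightarrow>
        (\<forall>x\<in>E. real (covering_number r (cball x R \<inter> E)) \<le> C * (R / r) powr \<alpha>))}"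

definition lower_dim :: "'a::euclidean_space set \<Rightarrow> real" where
  "lower_dim E = Sup {\<alpha>. \<exists>C \<rho>. C > 0 \<and> \<rho> > 0 \<and>
     (\<forall>r R. 0 < r \<and> r < R \<and> R \<le> \<rho> \<longrightarrow>
        (\<forall>x\<in>E. real (covering_number r (cball x R \<inter> E)) \<ge> C * (R / r) powr \<alpha>))}"

text \<open>
  The case \<open>s = 0\<close> is separate because the library has \<open>0 powr 0 = 0\<close>, whereas
  every non-empty set, including a singleton, must have 0-dimensional weight 1.
\<close>

definition hausdorff_gauge :: "real \<Rightarrow> 'a::euclidean_space set \<Rightarrow> ennreal" where
  "hausdorff_gauge s U =
     (if U = {} then 0 else if s = 0 then 1 else ennreal (diameter U powr s))"

definition hausdorff_premeasure :: "real \<Rightarrow> real \<Rightarrow> 'a::euclidean_space set \<Rightarrow> ennreal" where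
  "hausdorff_premeasure s \<delta> E =
     Inf {(\<Sum>i. hausdorff_gauge s (U i)) | U :: nat \<Rightarrow> 'a set.
            E \<subseteq> (\<Union>i. U i) \<and> (\<forall>i. bounded (U i) \<and> diameter (U i) \<le> \<delta>)}"

definition hausdorff_measure :: "real \<Rightarrow> 'a::euclidean_space set \<Rightarrow> ennreal" where
  "hausdorff_measure s E = (SUP \<delta>\<in>{0<..}. hausdorff_premeasure s \<delta> E)"

definition hausdorff_dim :: "'a::euclidean_space set \<Rightarrow> real" where
  "hausdorff_dim E = Inf {s. 0 \<le> s \<and> hausdorff_measure s E = 0}"


section \<open>Self-affine carpets\<close>

text \<open>A rectangle \<open>(a, b, c, d)\<close> has lower left corner \<open>(a, b)\<close>, base \<open>c\<close> and height \<open>d\<close>.\<close>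

type_synonym rect = "real \<times> real \<times> real \<times> real"

fun rect_map :: "rect \<Rightarrow> real \<times> real \<Rightarrow> real \<times> real" where
  "rect_map (a, b, c, d) (x, y) = (c * x + a, d * y + b)"

text \<open>
  The unit interval cut at finitely many interior points; both endpoints are in the list, so
  \<open>k\<close> cuts give a list of length \<open>k + 2\<close>.
\<close>

definition subdivision :: "real list \<Rightarrow> bool" where
  "subdivision xs \<longleftrightarrow> sorted_wrt (<) xs \<and> xs \<noteq> [] \<and> hd xs = 0 \<and> last xs = 1"

definition rects_of :: "real list \<Rightarrow> (nat \<Rightarrow> real list) \<Rightarrow> rect set" where
  "rects_of xs ys = {(xs ! j, ys j ! k, xs ! Suc j - xs ! j, ys j ! Suc k - ys j ! k) | j k.
      Suc j < length xs \<and> Suc k < length (ys j)}"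

definition extended_lalley_gatzouras :: "rect set \<Rightarrow> bool" where
  "extended_lalley_gatzouras I \<longleftrightarrow> (\<exists>xs ys.
      subdivision xs \<and> length xs \<ge> 3 \<and>
      (\<forall>j. Suc j < length xs \<longrightarrow> subdivision (ys j)) \<and>
      I \<subseteq> rects_of xs ys \<and> (\<forall>(a, b, c, d)\<in>I. c \<ge> d))"

definition baranski :: "rect set \<Rightarrow> bool" where
  "baranski I \<longleftrightarrow> (\<exists>xs ys.
      subdivision xs \<and> length xs \<ge> 3 \<and> subdivision ys \<and> length ys \<ge> 3 \<and>
      I \<subseteq> rects_of xs (\<lambda>_. ys))"

definition is_attractor :: "('a::topological_space \<Rightarrow> 'a) set \<Rightarrow> 'a set \<Rightarrow> bool" where
  "is_attractor \<S> F \<longleftrightarrow> F \<noteq> {} \<and> compact F \<and> F = (\<Union>S\<in>\<S>. S ` F)"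

definition self_affine_carpet :: "(real \<times> real) set \<Rightarrow> bool" where
  "self_affine_carpet F \<longleftrightarrow> (\<exists>I.
      (extended_lalley_gatzouras I \<or> baranski I) \<and> card I \<ge> 2 \<and>
      (\<exists>(a, b, c, d)\<in>I. c \<noteq> d) \<and> is_attractor (rect_map ` I) F)"

end

theory Submission
  imports Defs "HOL-Real_Asymp.Real_Asymp"
begin

text \<open>
  Let \<open>s\<close> be the similarity dimension of the projection of \<open>F\<close> to the first axis, and let
  \<open>t\<close> solve \<open>\<Sum>\<^sub>i c\<^sub>i\<^sup>s d\<^sub>i\<^sup>t = 1\<close>; exchanging the axes gives \<open>s'\<close> and \<open>t'\<close>. Counting the
  \<open>h \<times> v\<close> boxes needed to cover \<open>F\<close> anisotropically makes the self-affinity an exact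
  recursion in \<open>(h, v)\<close>, whose solution shows that the number of \<open>r \<times> r\<close> boxes is comparable
  to \<open>r\<^sup>-\<^sup>D\<close>, where \<open>D = s + t\<close> if no rectangle is higher than wide and
  \<open>D = max (s + t) (s' + t')\<close> for a grid with rectangles of both kinds.

  If some column \<open>j\<close> has \<open>\<Sum>\<^sub>i d\<^sub>i\<^bsup>D - s\<^esup> < 1\<close>, then approximate squares that start with many
  copies of a wide rectangle and continue inside the column \<open>j\<close> are too thin, so the lower
  dimension is less than \<open>D\<close>; likewise for rows. Otherwise the definition of \<open>t\<close> forces all
  these sums to be \<open>1\<close>. Then all approximate squares look alike: every ball of radius \<open>R\<close> around
  a point of \<open>F\<close> needs about \<open>(R / r)\<^sup>D\<close> boxes of side \<open>r\<close>, and all dimensions are \<open>D\<close>.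
\<close>

section \<open>Covering numbers and dimensions\<close>

text \<open>Columns are tested at the exponent \<open>D - s\<close> for the following reason. A
  strip made of many levels of one column needs, up to a constant, at most
  \<open>h powr (-s) * v powr (-e)\<close> boxes, for every \<open>e \<ge> 0\<close> at which the
  sum of the \<open>ht i powr e\<close> over this column is at most 1. If the sum is already below 1
  at \<open>D - s\<close>, continuity admits some \<open>e < D - s\<close>, and this gap is what
  makes the inequality for the lower dimension strict.

  Neighbouring pieces of \<open>F\<close> may touch, so a small ball may see several of them. The
  centre of a thin square is therefore pushed away from all four edges by a fixed word
  \<open>u\<close>. Such a word can fail to exist only if all rectangles touch one common edge; in
  that case the equations for the exponents themselves rule out a column sum below 1.

  In a grid the recursion may stop with boxes that are too high or too wide. From above this is met
  by adding the solutions for both orientations; from below one solution is enough, because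
  \<open>t \<le> s'\<close>.\<close>

definition open_cover :: "real \<Rightarrow> 'a::euclidean_space set \<Rightarrow> 'a set set \<Rightarrow> bool" where
  "open_cover r E \<U> \<longleftrightarrow> finite \<U> \<and> E \<subseteq> \<Union>\<U> \<and> (\<forall>U\<in>\<U>. open U \<and> bounded U \<and> diameter U \<le> r)"

lemma covering_number_altdef:
  "covering_number r E = (LEAST n. \<exists>\<U>. open_cover r E \<U> \<and> card \<U> = n)"
  unfolding covering_number_def open_cover_def by (rule arg_cong[where f = Least]) auto

lemma covering_number_le_card:
  assumes "open_cover r E \<U>"
  shows "covering_number r E \<le> card \<U>"
  unfolding covering_number_altdef by (rule Least_le) (use assms in auto)

lemma open_cover_balls:
  assumes "finite G" "r > 0" "E \<subseteq> (\<Union>g\<in>G. ball g (r / 2))"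
  shows "open_cover r E ((\<lambda>g. ball g (r / 2)) ` G)"
  unfolding open_cover_def using assms by (auto simp: diameter_ball)

lemma open_cover_exists:
  fixes E :: "'a::euclidean_space set"
  assumes "bounded E" "r > 0"
  shows "\<exists>\<U>. open_cover r E \<U>"
proof -
  have "compact (closure E)"
    using assms by (simp add: compact_closure)
  then obtain G where "finite G" "closure E \<subseteq> (\<Union>x\<in>G. ball x (r / 2))"
    unfolding compact_eq_totally_bounded using assms(2) half_gt_zero by blast
  then show ?thesis
    using open_cover_balls[of G r E] assms closure_subset[of E] by blast
qed

lemma covering_number_attained:
  fixes E :: "'a::euclidean_space set"
  assumes "bounded E" "r > 0"
  obtains \<U> where "open_cover r E \<U>" "card \<U> = covering_number r E"
proof -
  have "\<exists>n. \<exists>\<U>. open_cover r E \<U> \<and> card \<U> = n"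
    using open_cover_exists[OF assms] by blast
  from LeastI_ex[OF this] show ?thesis
    using that unfolding covering_number_altdef by blast
qed

lemma covering_number_mono:
  fixes E :: "'a::euclidean_space set"
  assumes "E' \<subseteq> E" "bounded E" "0 < r'" "r' \<le> r"
  shows "covering_number r E' \<le> covering_number r' E"
proof -
  obtain \<U> where "open_cover r' E \<U>" "card \<U> = covering_number r' E"
    using covering_number_attained assms by blast
  moreover from this have "open_cover r E' \<U>"
    using assms unfolding open_cover_def by fastforce
  ultimately show ?thesis
    using covering_number_le_card by metis
qed

lemma covering_number_pos:
  fixes E :: "'a::euclidean_space set"
  assumes "bounded E" "E \<noteq> {}" "0 < r"
  shows "1 \<le> covering_number r E"
proof -
  obtain \<U> where "open_cover r E \<U>" "card \<U> = covering_number r E"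
    using covering_number_attained assms by blast
  moreover from this have "card \<U> \<noteq> 0"
    using assms unfolding open_cover_def by auto
  ultimately show ?thesis by linarith
qed

lemma has_box_dimI:
  assumes "0 < c" "0 < C" "0 < \<rho>"
    and bounds: "\<And>r. 0 < r \<Longrightarrow> r \<le> \<rho> \<Longrightarrow> c * r powr (-D) \<le> real (covering_number r E) \<and>
      real (covering_number r E) \<le> C * r powr (-D)"
  shows "has_box_dim E D"
  unfolding has_box_dim_def
proof (rule tendsto_sandwich)
  have ev: "\<forall>\<^sub>F r in at_right 0. 0 < r \<and> r < min \<rho> (1::real)"
    using assms by (auto simp: eventually_at_right_field intro!: exI[of _ "min \<rho> 1"])
  have main: "(ln c - D * ln r) / - ln r \<le> ln (real (covering_number r E)) / - ln r \<and>
     ln (real (covering_number r E)) / - ln r \<le> (ln C - D * ln r) / - ln r"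
    if "0 < r \<and> r < min \<rho> 1" for r
  proof -
    have r: "0 < r" "r < 1" "r \<le> \<rho>" using that by auto
    have p: "r powr (-D) > 0" using r by auto
    have "c * r powr (-D) \<le> covering_number r E" "covering_number r E \<le> C * r powr (-D)"
      using bounds r by auto
    moreover from this have "0 < real (covering_number r E)"
      using p assms(1) by (meson less_le_trans mult_pos_pos)
    ultimately have "ln (c * r powr (-D)) \<le> ln (covering_number r E)"
      "ln (covering_number r E) \<le> ln (C * r powr (-D))"
      using p assms by (auto simp: ln_le_cancel_iff)
    then have "ln c - D * ln r \<le> ln (covering_number r E)" "ln (covering_number r E) \<le> ln C - D * ln r"
      using r assms by (auto simp: ln_mult ln_powr)
    moreover have "0 < - ln r" using r by simp
    ultimately show ?thesis by (intro conjI divide_right_mono) auto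
  qed
  show "\<forall>\<^sub>F r in at_right 0. (ln c - D * ln r) / - ln r \<le> ln (real (covering_number r E)) / - ln r"
    "\<forall>\<^sub>F r in at_right 0. ln (real (covering_number r E)) / - ln r \<le> (ln C - D * ln r) / - ln r"
    using ev by (eventually_elim, use main in blast)+
  show "((\<lambda>r. (ln c - D * ln r) / - ln r) \<longlongrightarrow> D) (at_right 0)"
    "((\<lambda>r. (ln C - D * ln r) / - ln r) \<longlongrightarrow> D) (at_right 0)"
    by real_asymp+
qed

text \<open>\<open>box_dim\<close> is a \<open>Lim\<close>, which carries information only once
  convergence is known; hence the detour through \<open>has_box_dim\<close>.\<close>

lemma has_box_dim_unique:
  assumes "has_box_dim E D"
  shows "box_dim E = D"
  using assms unfolding has_box_dim_def box_dim_def by (intro tendsto_Lim) auto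

text \<open>Compares exponents along a mere sequence of ratios \<open>R / r\<close>. This suffices
  because the definitions of the dimensions quantify over all scales, and the thin squares supply no
  more than a sequence.\<close>

lemma powr_exponent_le:
  fixes a b c C :: real
  assumes "0 < c" and "filterlim X at_top sequentially"
    and le: "\<forall>\<^sub>F n in sequentially. c * X n powr a \<le> C * X n powr b"
  shows "a \<le> b"
proof (rule ccontr)
  assume "\<not> a \<le> b"
  then have "filterlim (\<lambda>x::real. x powr (a - b)) at_top at_top"
    by real_asymp
  then have "filterlim (\<lambda>n. X n powr (a - b)) at_top sequentially"
    using assms(2) by (rule filterlim_compose)
  then have "\<forall>\<^sub>F n in sequentially. C / c + 1 \<le> X n powr (a - b)"
    unfolding filterlim_at_top by blast
  moreover have "\<forall>\<^sub>F n in sequentially. 1 \<le> X n"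
    using assms(2) unfolding filterlim_at_top by blast
  ultimately have "\<forall>\<^sub>F n in sequentially. False"
    using le
  proof eventually_elim
    case (elim n)
    have "X n powr a = X n powr (a - b) * X n powr b"
      by (simp flip: powr_add)
    then have "c * X n powr (a - b) * X n powr b \<le> C * X n powr b"
      using elim by (simp add: mult.assoc)
    moreover have "X n powr b > 0" using elim by auto
    ultimately have "c * X n powr (a - b) \<le> C" by simp
    then have "X n powr (a - b) \<le> C / c" using assms(1) by (simp add: field_simps)
    then show False using elim by linarith
  qed
  then show False by simp
qed

section \<open>Assouad and lower dimension of homogeneous sets\<close>

definition homogeneous :: "'a::euclidean_space set \<Rightarrow> real \<Rightarrow> bool" where
  "homogeneous E D \<longleftrightarrow> (\<exists>c C. 0 < c \<and> 0 < C \<and> (\<forall>r R x. 0 < r \<and> r < R \<and> R \<le> 1 \<and> x \<in> E \<longrightarrow>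
     c * (R / r) powr D \<le> real (covering_number r (cball x R \<inter> E)) \<and>
     real (covering_number r (cball x R \<inter> E)) \<le> C * (R / r) powr D))"

text \<open>\<open>D\<close> itself is admissible in both definitions, so it only has to be compared
  with the other admissible exponents, at one point and one radius.\<close>

lemma homogeneous_dims:
  fixes E :: "'a::euclidean_space set"
  assumes "homogeneous E D" "E \<noteq> {}"
  shows "assouad_dim E = D" "lower_dim E = D"
proof -
  obtain c C where c: "0 < c" "0 < C"
    and lower: "\<And>r R x. 0 < r \<Longrightarrow> r < R \<Longrightarrow> R \<le> 1 \<Longrightarrow> x \<in> E \<Longrightarrow>
      c * (R / r) powr D \<le> real (covering_number r (cball x R \<inter> E))"
    and upper: "\<And>r R x. 0 < r \<Longrightarrow> r < R \<Longrightarrow> R \<le> 1 \<Longrightarrow> x \<in> E \<Longrightarrow>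
      real (covering_number r (cball x R \<inter> E)) \<le> C * (R / r) powr D"
    using assms(1) unfolding homogeneous_def by blast
  obtain x where x: "x \<in> E" using assms by blast
  have X: "filterlim (\<lambda>n. real n + 2) at_top sequentially" by real_asymp
  show "assouad_dim E = D" unfolding assouad_dim_def
  proof (rule cInf_eq_minimum)
    show "D \<in> {\<alpha>. \<exists>C \<rho>. C > 0 \<and> \<rho> > 0 \<and> (\<forall>r R. 0 < r \<and> r < R \<and> R \<le> \<rho> \<longrightarrow>
        (\<forall>x\<in>E. real (covering_number r (cball x R \<inter> E)) \<le> C * (R / r) powr \<alpha>))}"
      by (intro CollectI exI[of _ C] exI[of _ 1]) (use c upper in auto)
  next
    fix \<alpha>
    assume "\<alpha> \<in> {\<alpha>. \<exists>C \<rho>. C > 0 \<and> \<rho> > 0 \<and> (\<forall>r R. 0 < r \<and> r < R \<and> R \<le> \<rho> \<longrightarrow>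
        (\<forall>x\<in>E. real (covering_number r (cball x R \<inter> E)) \<le> C * (R / r) powr \<alpha>))}"
    then obtain C' \<rho> where C': "C' > 0" "\<rho> > 0"
      "\<And>r R x. 0 < r \<Longrightarrow> r < R \<Longrightarrow> R \<le> \<rho> \<Longrightarrow> x \<in> E \<Longrightarrow>
        real (covering_number r (cball x R \<inter> E)) \<le> C' * (R / r) powr \<alpha>" by blast
    define R where "R = min \<rho> 1"
    have R: "0 < R" "R \<le> \<rho>" "R \<le> 1" using C' by (auto simp: R_def)
    have "c * (real n + 2) powr D \<le> C' * (real n + 2) powr \<alpha>" for n
    proof -
      \<comment> \<open>The inner radius \<open>R / (n + 2)\<close> is smaller than \<open>R\<close>
        even for \<open>n = 0\<close> and makes the ratio exactly \<open>n + 2\<close>.\<close>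
      have "R / (real n + 2) < R" "0 < R / (real n + 2)" "R / (R / (real n + 2)) = real n + 2"
        using R(1) by (auto simp: field_simps pos_divide_less_eq add_pos_nonneg)
      then show ?thesis
        using lower[of "R / (real n + 2)" R x] C'(3)[of "R / (real n + 2)" R x] R x by (smt (verit))
    qed
    with X show "D \<le> \<alpha>" using c by (intro powr_exponent_le[of c _ D C']) auto
  qed
  show "lower_dim E = D" unfolding lower_dim_def
  proof (rule cSup_eq_maximum)
    show "D \<in> {\<alpha>. \<exists>C \<rho>. C > 0 \<and> \<rho> > 0 \<and> (\<forall>r R. 0 < r \<and> r < R \<and> R \<le> \<rho> \<longrightarrow>
        (\<forall>x\<in>E. real (covering_number r (cball x R \<inter> E)) \<ge> C * (R / r) powr \<alpha>))}"
      by (intro CollectI exI[of _ c] exI[of _ 1]) (use c lower in auto)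
  next
    fix \<alpha>
    assume "\<alpha> \<in> {\<alpha>. \<exists>C \<rho>. C > 0 \<and> \<rho> > 0 \<and> (\<forall>r R. 0 < r \<and> r < R \<and> R \<le> \<rho> \<longrightarrow>
        (\<forall>x\<in>E. real (covering_number r (cball x R \<inter> E)) \<ge> C * (R / r) powr \<alpha>))}"
    then obtain C' \<rho> where C': "C' > 0" "\<rho> > 0"
      "\<And>r R x. 0 < r \<Longrightarrow> r < R \<Longrightarrow> R \<le> \<rho> \<Longrightarrow> x \<in> E \<Longrightarrow>
        real (covering_number r (cball x R \<inter> E)) \<ge> C' * (R / r) powr \<alpha>" by blast
    define R where "R = min \<rho> 1"
    have R: "0 < R" "R \<le> \<rho>" "R \<le> 1" using C' by (auto simp: R_def)
    have "C' * (real n + 2) powr \<alpha> \<le> C * (real n + 2) powr D" for n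
    proof -
      have "R / (real n + 2) < R" "0 < R / (real n + 2)" "R / (R / (real n + 2)) = real n + 2"
        using R(1) by (auto simp: field_simps pos_divide_less_eq add_pos_nonneg)
      then show ?thesis
        using upper[of "R / (real n + 2)" R x] C'(3)[of "R / (real n + 2)" R x] R x by (smt (verit))
    qed
    with X show "\<alpha> \<le> D" using C' by (intro powr_exponent_le[of C' _ \<alpha> C]) auto
  qed
qed

text \<open>
  Larman's argument: a ball around a point of \<open>E\<close> contains at least \<open>q powr (-s)\<close> well separated
  balls smaller by the factor \<open>q\<close>, and a covering set smaller than these meets at most one of them.
\<close>

lemma cover_sum_ge:
  fixes E :: "'a::metric_space set"
  assumes q: "0 < q" "q < 1" and "0 < s" "0 < \<rho>"
    and split: "\<And>x R. x \<in> E \<Longrightarrow> 0 < R \<Longrightarrow> R \<le> \<rho> \<Longrightarrow>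
      \<exists>G. finite G \<and> G \<subseteq> E \<and> (\<forall>y\<in>G. cball y (q * R) \<subseteq> cball x R) \<and>
          (\<forall>y\<in>G. \<forall>z\<in>G. y \<noteq> z \<longrightarrow> dist y z > 3 * q * R) \<and> q powr (-s) \<le> real (card G)"
    and T: "finite T" "E \<subseteq> (\<Union>i\<in>T. U i)" "\<And>i. i \<in> T \<Longrightarrow> q ^ N * \<rho> \<le> d i"
      "\<And>i a b. i \<in> T \<Longrightarrow> a \<in> U i \<Longrightarrow> b \<in> U i \<Longrightarrow> dist a b \<le> d i"
    and "x \<in> E" "n \<le> N"
  shows "(q ^ (n + 1) * \<rho>) powr s \<le> (\<Sum>i | i \<in> T \<and> U i \<inter> cball x (q ^ n * \<rho>) \<noteq> {}. d i powr s)"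
  using \<open>n \<le> N\<close> \<open>x \<in> E\<close>
proof (induction "N - n" arbitrary: n x)
  \<comment> \<open>At the last level every set of the cover is large enough on its own, so any set
    containing \<open>x\<close> carries the whole estimate.\<close>
  case 0
  then have nN: "n = N" by simp
  obtain i where i: "i \<in> T" "x \<in> U i" using 0 T by blast
  have "x \<in> U i \<inter> cball x (q ^ n * \<rho>)" using i q assms(4) by auto
  then have "d i powr s \<le> (\<Sum>i | i \<in> T \<and> U i \<inter> cball x (q ^ n * \<rho>) \<noteq> {}. d i powr s)"
    using i T(1) by (intro member_le_sum) auto
  moreover have "q ^ (n + 1) * \<rho> \<le> d i"
    using T(3)[OF i(1)] nN q assms(4) by (smt (verit) mult_less_cancel_right1 mult_right_mono power_add power_one_right zero_less_power mult.commute mult_le_cancel_right2)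
  then have "(q ^ (n + 1) * \<rho>) powr s \<le> d i powr s"
    using q assms by (intro powr_mono2) auto
  ultimately show ?case by linarith
next
  case (Suc k)
  then have nN: "Suc n \<le> N" "k = N - Suc n" by auto
  let ?S = "{i. i \<in> T \<and> U i \<inter> cball x (q ^ n * \<rho>) \<noteq> {}}"
  show ?case
  proof (cases "\<exists>i\<in>?S. q ^ (n + 1) * \<rho> \<le> d i")
    case True
    then obtain i where i: "i \<in> ?S" "q ^ (n + 1) * \<rho> \<le> d i" by blast
    then have "d i powr s \<le> (\<Sum>i\<in>?S. d i powr s)"
      using T(1) by (intro member_le_sum) auto
    moreover have "(q ^ (n + 1) * \<rho>) powr s \<le> d i powr s"
      using q assms i by (intro powr_mono2) auto
    ultimately show ?thesis by linarith
  next
    case False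
    have R: "0 < q ^ n * \<rho>" "q ^ n * \<rho> \<le> \<rho>"
      using q assms(4) by (auto simp: power_le_one)
    from split[OF Suc.prems(2) R] obtain G where G0:
      "finite G" "G \<subseteq> E" "\<forall>y\<in>G. cball y (q * (q ^ n * \<rho>)) \<subseteq> cball x (q ^ n * \<rho>)"
      "\<forall>y\<in>G. \<forall>z\<in>G. y \<noteq> z \<longrightarrow> dist y z > 3 * q * (q ^ n * \<rho>)" "q powr (-s) \<le> real (card G)"
      by (elim exE conjE)
    note G = G0(1,2) bspec[OF G0(3)] bspec[OF bspec[OF G0(4)], rule_format] G0(5)
    define B where "B y = {i. i \<in> T \<and> U i \<inter> cball y (q ^ Suc n * \<rho>) \<noteq> {}}" for y
    have BS: "B y \<subseteq> ?S" if "y \<in> G" for y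
      using G(3)[OF that] unfolding B_def by (auto simp: mult.assoc)
    have disj: "B y \<inter> B z = {}" if "y \<in> G" "z \<in> G" "y \<noteq> z" for y z
    proof (rule ccontr)
      assume "B y \<inter> B z \<noteq> {}"
      then obtain i where "i \<in> B y" "i \<in> B z" by blast
      then obtain a b where i: "i \<in> B y" "i \<in> T" "a \<in> U i" "b \<in> U i"
        "dist y a \<le> q ^ Suc n * \<rho>" "dist z b \<le> q ^ Suc n * \<rho>"
        unfolding B_def by auto
      have "i \<in> ?S" using BS[OF that(1)] i(1) by blast
      then have "d i < q ^ (n + 1) * \<rho>" using False by (meson not_le)
      then have "dist a b < q ^ (n + 1) * \<rho>"
        using T(4)[OF i(2-4)] by linarith
      \<comment> \<open>Two radii and one diameter, each at most
        \<open>q ^ (n + 1) * \<rho>\<close>: this is the factor 3 demanded of the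
        separation.\<close>
      then have "dist y z < 3 * (q ^ (n + 1) * \<rho>)"
        using i(5,6) dist_triangle[of y z a] dist_triangle2[of a z b] by (simp add: dist_commute)
      then show False using G(4)[OF that] by (simp add: algebra_simps)
    qed
    \<comment> \<open>Passing to the next level shrinks the bound by \<open>q powr s\<close>, and
      the number of sub-balls makes up for exactly this loss.\<close>
    have "(q ^ (n + 1) * \<rho>) powr s = q powr (-s) * (q ^ (Suc n + 1) * \<rho>) powr s"
      using q assms(4) by (simp add: powr_mult powr_minus field_simps)
    also have "\<dots> \<le> real (card G) * (q ^ (Suc n + 1) * \<rho>) powr s"
      using G by (intro mult_right_mono) auto
    also have "\<dots> = (\<Sum>y\<in>G. (q ^ (Suc n + 1) * \<rho>) powr s)" by simp
    also have "\<dots> \<le> (\<Sum>y\<in>G. \<Sum>i\<in>B y. d i powr s)"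
      using Suc.hyps(1)[OF nN(2) nN(1)] G(2) unfolding B_def by (intro sum_mono) auto
    also have "\<dots> = (\<Sum>i\<in>(\<Union>y\<in>G. B y). d i powr s)"
      using G(1) T(1) disj by (intro sum.UNION_disjoint[symmetric]) (auto simp: B_def)
    also have "\<dots> \<le> (\<Sum>i\<in>?S. d i powr s)"
      using BS T(1) by (intro sum_mono2) auto
    finally show ?thesis .
  qed
qed

text \<open>A set of an open cover of mesh \<open>e\<close> contains at most one point of an
  \<open>e\<close>-separated set, so there is an \<open>e\<close>-separated set of greatest
  cardinality. It cannot be extended, hence the balls of radius \<open>2 * e = 4 * e / 2\<close>
  about its points cover \<open>A\<close>.\<close>

lemma separated_net:
  fixes A :: "'a::euclidean_space set"
  assumes "bounded A" "0 < e"
  obtains G where "finite G" "G \<subseteq> A" "\<And>y z. y \<in> G \<Longrightarrow> z \<in> G \<Longrightarrow> y \<noteq> z \<Longrightarrow> dist y z > e"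
    "covering_number (4 * e) A \<le> card G"
proof -
  obtain \<U> where \<U>: "open_cover e A \<U>"
    using open_cover_exists assms by blast
  let ?P = "\<lambda>G. G \<subseteq> A \<and> (\<forall>y\<in>G. \<forall>z\<in>G. y \<noteq> z \<longrightarrow> dist y z > e)"
  have bd: "finite G \<and> card G \<le> card \<U>" if G: "?P G" for G
  proof -
    have "\<exists>u. \<forall>g\<in>G. u g \<in> \<U> \<and> g \<in> u g"
      using \<U> G unfolding open_cover_def by (intro bchoice) blast
    then obtain u where u: "\<And>g. g \<in> G \<Longrightarrow> u g \<in> \<U> \<and> g \<in> u g" by blast
    have "inj_on u G"
    proof (rule inj_onI, rule ccontr)
      fix y z assume yz: "y \<in> G" "z \<in> G" "u y = u z" "y \<noteq> z"
      then have "dist y z \<le> diameter (u y)"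
        using u[of y] u[of z] \<U> unfolding open_cover_def by (intro diameter_bounded_bound) auto
      also have "\<dots> \<le> e" using u[of y] yz \<U> unfolding open_cover_def by auto
      finally show False using G yz by fastforce
    qed
    then show ?thesis
      using u \<U> card_inj_on_le[of u G \<U>] inj_on_finite[of u G \<U>] unfolding open_cover_def by blast
  qed
  have "\<exists>G. ?P G \<and> (\<forall>G'. ?P G' \<longrightarrow> card G' \<le> card G)"
    by (rule ex_has_greatest_nat[of ?P "{}" card "Suc (card \<U>)"]) (use bd in \<open>auto simp: less_Suc_eq_le\<close>)
  then obtain G where G: "?P G" "\<And>G'. ?P G' \<Longrightarrow> card G' \<le> card G" by blast
  have "A \<subseteq> (\<Union>g\<in>G. ball g (4 * e / 2))"
  proof
    fix a assume a: "a \<in> A"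
    show "a \<in> (\<Union>g\<in>G. ball g (4 * e / 2))"
    proof (rule ccontr)
      assume "a \<notin> (\<Union>g\<in>G. ball g (4 * e / 2))"
      then have far: "\<And>g. g \<in> G \<Longrightarrow> dist g a > e" using assms by force
      then have "?P (insert a G)" using G(1) a by (auto simp: dist_commute)
      then have "card (insert a G) \<le> card G" by (rule G(2))
      moreover have "a \<notin> G" using far assms by force
      ultimately show False using bd[OF G(1)] by simp
    qed
  qed
  then have "covering_number (4 * e) A \<le> card ((\<lambda>g. ball g (4 * e / 2)) ` G)"
    using bd[OF G(1)] assms by (intro covering_number_le_card open_cover_balls) auto
  also have "\<dots> \<le> card G" using bd[OF G(1)] by (intro card_image_le) auto
  finally show ?thesis using that[of G] G(1) bd[OF G(1)] by blast
qed

section \<open>Hausdorff dimension of homogeneous sets\<close>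

lemma hausdorff_measure_eq_0I:
  fixes E :: "'a::euclidean_space set"
  assumes "0 < s" "\<And>\<delta> \<epsilon>. 0 < \<delta> \<Longrightarrow> 0 < \<epsilon> \<Longrightarrow> \<exists>r. 0 < r \<and> r \<le> \<delta> \<and> real (covering_number r E) * r powr s \<le> \<epsilon>"
    and "bounded E"
  shows "hausdorff_measure s E = 0"
proof -
  have le: "hausdorff_premeasure s \<delta> E \<le> 0 + ennreal \<epsilon>" if pos: "0 < \<delta>" "0 < \<epsilon>" for \<delta> \<epsilon>
  proof -
    obtain r where r: "0 < r" "r \<le> \<delta>" "real (covering_number r E) * r powr s \<le> \<epsilon>"
      using assms(2)[OF pos] by blast
    obtain \<U> where \<U>: "open_cover r E \<U>" "card \<U> = covering_number r E"
      using covering_number_attained[OF assms(3) r(1)] .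
    obtain h where h: "bij_betw h {..<card \<U>} \<U>"
      using \<U>(1) unfolding open_cover_def by (metis ex_bij_betw_nat_finite atLeast0LessThan)
    \<comment> \<open>The premeasure asks for a sequence; the finite cover is padded with empty
      sets, whose gauge is 0.\<close>
    define U where "U i = (if i < card \<U> then h i else {})" for i
    have U: "U i \<in> \<U>" if "i < card \<U>" for i
      using h that unfolding U_def bij_betw_def by auto
    have g: "hausdorff_gauge s (U i) \<le> ennreal (r powr s)" if "i < card \<U>" for i
      using U[OF that] \<U>(1) assms(1) unfolding hausdorff_gauge_def open_cover_def
      by (auto intro!: ennreal_leI powr_mono2 diameter_ge_0)
    have "hausdorff_premeasure s \<delta> E \<le> (\<Sum>i. hausdorff_gauge s (U i))"
      unfolding hausdorff_premeasure_def
    proof (rule Inf_lower, rule CollectI, intro exI conjI allI)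
      show "E \<subseteq> (\<Union>i. U i)"
      proof
        fix x assume "x \<in> E"
        then obtain V where "V \<in> \<U>" "x \<in> V" using \<U>(1) unfolding open_cover_def by blast
        moreover from this obtain i where "i < card \<U>" "h i = V"
          using h unfolding bij_betw_def by (metis imageE lessThan_iff)
        ultimately show "x \<in> (\<Union>i. U i)" unfolding U_def by auto
      qed
    next
      fix i
      show "bounded (U i)" "diameter (U i) \<le> \<delta>"
        using U[of i] \<U>(1) r that unfolding open_cover_def U_def by fastforce+
    qed simp
    also have "\<dots> = (\<Sum>i<card \<U>. hausdorff_gauge s (U i))"
      by (intro suminf_finite) (auto simp: U_def hausdorff_gauge_def)
    also have "\<dots> \<le> (\<Sum>i<card \<U>. ennreal (r powr s))"
      using g by (intro sum_mono) auto
    also have "\<dots> = ennreal (real (covering_number r E) * r powr s)"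
      using \<U>(2) by (simp add: ennreal_mult' ennreal_of_nat_eq_real_of_nat)
    also have "\<dots> \<le> ennreal \<epsilon>" using r(3) by (rule ennreal_leI)
    finally show ?thesis by simp
  qed
  have "hausdorff_premeasure s \<delta> E \<le> 0" if "0 < \<delta>" for \<delta>
    by (rule ennreal_le_epsilon) (rule le[OF that])
  then show ?thesis
    unfolding hausdorff_measure_def by (intro antisym SUP_least) auto
qed

text \<open>A bound for finite covers is enough: a countable cover of small total weight is enlarged
  to open sets at small cost, and compactness selects finitely many of them.\<close>

lemma hausdorff_measure_pos:
  fixes E :: "'a::euclidean_space set"
  assumes "compact E" "E \<noteq> {}" "0 < s" "0 < \<eta>"
    and lower: "\<And>T (U :: nat \<Rightarrow> 'a set) d. finite T \<Longrightarrow> E \<subseteq> (\<Union>i\<in>T. U i) \<Longrightarrow> (\<And>i. i \<in> T \<Longrightarrow> 0 < d i) \<Longrightarrow>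
      (\<And>i a b. i \<in> T \<Longrightarrow> a \<in> U i \<Longrightarrow> b \<in> U i \<Longrightarrow> dist a b \<le> d i) \<Longrightarrow> \<eta> \<le> (\<Sum>i\<in>T. d i powr s)"
  shows "hausdorff_measure s E \<noteq> 0"
proof
  assume "hausdorff_measure s E = 0"
  then have "hausdorff_premeasure s 1 E \<le> 0"
    unfolding hausdorff_measure_def by (metis SUP_upper greaterThan_iff zero_less_one)
  then have "hausdorff_premeasure s 1 E < ennreal (\<eta> / 4)"
    using assms(4) by (simp add: le_less_trans)
  then obtain V where V: "E \<subseteq> (\<Union>i. V i)" "\<And>i. bounded (V i)"
    "(\<Sum>i. hausdorff_gauge s (V i)) < ennreal (\<eta> / 4)"
    unfolding hausdorff_premeasure_def Inf_less_iff by blast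
  \<comment> \<open>Continuity of the power at the diameter. The errors form a geometric series, so
    the enlargement costs at most \<open>\<eta> / 4\<close> altogether; with the weight below
    \<open>\<eta> / 4\<close> the total stays under \<open>\<eta>\<close>.\<close>
  have "\<exists>\<delta>>0. (diameter (V i) + 2 * \<delta>) powr s \<le> diameter (V i) powr s + \<eta> / 4 * (1 / 2) ^ Suc i" for i
  proof -
    have "((\<lambda>\<delta>. (diameter (V i) + 2 * \<delta>) powr s) \<longlongrightarrow> (diameter (V i) + 2 * 0) powr s) (at_right 0)"
      using assms(3) diameter_ge_0[OF V(2)[of i]]
      by (intro tendsto_powr2 tendsto_intros)
         (auto simp: eventually_at_right_field intro!: exI[of _ 1])
    then have "\<forall>\<^sub>F \<delta> in at_right 0. (diameter (V i) + 2 * \<delta>) powr s <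
        diameter (V i) powr s + \<eta> / 4 * (1 / 2) ^ Suc i"
      using assms(4) by (intro order_tendstoD(2)) auto
    then obtain b where "b > 0" "\<forall>\<delta>>0. \<delta> < b \<longrightarrow> (diameter (V i) + 2 * \<delta>) powr s <
        diameter (V i) powr s + \<eta> / 4 * (1 / 2) ^ Suc i"
      unfolding eventually_at_right_field by auto
    then show ?thesis by (intro exI[of _ "b / 2"] conjI less_imp_le) (auto dest: spec[of _ "b / 2"])
  qed
  then obtain \<delta> where \<delta>: "\<And>i. \<delta> i > 0"
    "\<And>i. (diameter (V i) + 2 * \<delta> i) powr s \<le> diameter (V i) powr s + \<eta> / 4 * (1 / 2) ^ Suc i"
    by metis
  define W where "W i = (\<Union>v\<in>V i. ball v (\<delta> i))" for i
  have "E \<subseteq> (\<Union>i\<in>UNIV. W i)"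
  proof
    fix x assume "x \<in> E"
    then obtain i where "x \<in> V i" using V(1) by blast
    then have "x \<in> W i" using \<delta>(1)[of i] unfolding W_def by (auto intro!: bexI[of _ x])
    then show "x \<in> (\<Union>i\<in>UNIV. W i)" by blast
  qed
  then obtain T where T: "finite T" "E \<subseteq> (\<Union>i\<in>T. W i)"
    by (rule compactE_image[OF assms(1), of UNIV W, rotated]) (auto simp: W_def)
  define T' where "T' = {i \<in> T. V i \<noteq> {}}"
  have T': "finite T'" "E \<subseteq> (\<Union>i\<in>T'. W i)"
  proof -
    show "finite T'" using T(1) unfolding T'_def by simp
    have V: "V i \<noteq> {}" if "x \<in> W i" for x i using that unfolding W_def by auto
    show "E \<subseteq> (\<Union>i\<in>T'. W i)"
    proof
      fix x assume "x \<in> E"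
      then obtain i where "i \<in> T" "x \<in> W i" using T(2) by blast
      then show "x \<in> (\<Union>i\<in>T'. W i)" using V unfolding T'_def by blast
    qed
  qed
  have "\<eta> \<le> (\<Sum>i\<in>T'. (diameter (V i) + 2 * \<delta> i) powr s)"
  proof (rule lower[OF T'])
    show "0 < diameter (V i) + 2 * \<delta> i" for i
      using diameter_ge_0[OF V(2)[of i]] \<delta>(1)[of i] by linarith
  next
    fix i a b assume "a \<in> W i" "b \<in> W i"
    then obtain v w where vw: "v \<in> V i" "w \<in> V i" "dist v a < \<delta> i" "dist w b < \<delta> i"
      unfolding W_def by auto
    then have "dist v w \<le> diameter (V i)"
      using V(2) by (intro diameter_bounded_bound)
    then show "dist a b \<le> diameter (V i) + 2 * \<delta> i"
      using vw dist_triangle[of a b v] dist_triangle[of v b w] by (simp add: dist_commute)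
  qed
  also have "\<dots> \<le> (\<Sum>i\<in>T'. diameter (V i) powr s) + (\<Sum>i\<in>T'. \<eta> / 4 * (1 / 2) ^ Suc i)"
    unfolding sum.distrib[symmetric] by (intro sum_mono \<delta>(2))
  also have "(\<Sum>i\<in>T'. \<eta> / 4 * (1 / 2) ^ Suc i) \<le> (\<Sum>i. \<eta> / 4 * (1 / 2) ^ Suc i)"
    using T'(1) assms(4) by (intro sum_le_suminf) (auto intro: summable_mult summable_geometric)
  also have "\<dots> = \<eta> / 4"
    using sums_unique[OF sums_mult[OF power_half_series, of "\<eta> / 4"]] by simp
  also have "(\<Sum>i\<in>T'. diameter (V i) powr s) \<le> \<eta> / 4"
  proof -
    have "ennreal (\<Sum>i\<in>T'. diameter (V i) powr s) = (\<Sum>i\<in>T'. hausdorff_gauge s (V i))"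
      using assms(3) unfolding T'_def hausdorff_gauge_def by (subst sum_ennreal[symmetric]) auto
    also have "\<dots> \<le> (\<Sum>i. hausdorff_gauge s (V i))"
      using T'(1) by (intro sum_le_suminf) auto
    also have "\<dots> \<le> ennreal (\<eta> / 4)" using V(3) by simp
    finally show ?thesis using assms(4) by (simp add: ennreal_le_iff)
  qed
  finally show False using assms(4) by simp
qed

text \<open>Supplies the branching for Larman's argument: since \<open>s < D\<close>, the number of
  separated sub-balls, of order \<open>(1 / q) powr D\<close>, beats \<open>q powr (-s)\<close> for
  small \<open>q\<close>.\<close>

lemma homogeneous_split:
  fixes E :: "'a::euclidean_space set"
  assumes "homogeneous E D" "s < D"
  obtains q where "0 < q" "q < 1" "\<And>x R. x \<in> E \<Longrightarrow> 0 < R \<Longrightarrow> R \<le> 1 \<Longrightarrow>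
      \<exists>G. finite G \<and> G \<subseteq> E \<and> (\<forall>y\<in>G. cball y (q * R) \<subseteq> cball x R) \<and>
          (\<forall>y\<in>G. \<forall>z\<in>G. y \<noteq> z \<longrightarrow> dist y z > 3 * q * R) \<and> q powr (-s) \<le> real (card G)"
proof -
  obtain c where c: "0 < c"
    and lower: "\<And>r R x. 0 < r \<Longrightarrow> r < R \<Longrightarrow> R \<le> 1 \<Longrightarrow> x \<in> E \<Longrightarrow>
      c * (R / r) powr D \<le> real (covering_number r (cball x R \<inter> E))"
    using assms(1) unfolding homogeneous_def by blast
  \<comment> \<open>The net is taken in the half ball, is \<open>3 * q * R\<close>-separated and has
    at least as many points as a cover of mesh \<open>12 * q * R\<close>; the ratio of radii is
    \<open>(R / 2) / (12 * q * R) = 1 / (24 * q)\<close>.\<close>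
  have "\<forall>\<^sub>F q in at_right 0. q powr (-s) < c * (1 / (24 * q)) powr D"
    using c assms(2) by real_asymp
  moreover have "\<forall>\<^sub>F q in at_right (0::real). 0 < q \<and> q < 1 / 24"
    by (auto simp: eventually_at_right_field intro!: exI[of _ "1 / 24"])
  ultimately have "\<forall>\<^sub>F q in at_right 0. 0 < q \<and> q < 1 / 24 \<and> q powr (-s) < c * (1 / (24 * q)) powr D"
    by eventually_elim auto
  then obtain q where q: "0 < q" "q < 1 / 24" "q powr (-s) < c * (1 / (24 * q)) powr D"
    using eventually_happens[of _ "at_right (0::real)"] by auto
  show ?thesis
  proof (rule that[OF q(1)])
    show "q < 1" using q by simp
    fix x R assume x: "x \<in> E" "0 < R" "R \<le> (1::real)"
    let ?A = "cball x (R / 2) \<inter> E"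
    obtain G where G: "finite G" "G \<subseteq> ?A" "\<And>y z. y \<in> G \<Longrightarrow> z \<in> G \<Longrightarrow> y \<noteq> z \<Longrightarrow> dist y z > 3 * q * R"
      "covering_number (4 * (3 * q * R)) ?A \<le> card G"
      using separated_net[of ?A "3 * q * R"] x q by (auto simp: bounded_Int)
    have "q powr (-s) \<le> c * ((R / 2) / (12 * q * R)) powr D"
      using q x by (simp add: field_simps)
    also have "\<dots> \<le> real (covering_number (12 * q * R) ?A)"
      using q x by (intro lower) (auto simp: field_simps)
    also have "\<dots> \<le> real (card G)" using G(4) by (simp add: mult.assoc)
    finally have "q powr (-s) \<le> real (card G)" .
    moreover have "cball y (q * R) \<subseteq> cball x R" if "y \<in> G" for y
    proof -
      have "dist x y \<le> R / 2" using G(2) that by auto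
      moreover have "q * R \<le> R / 2" using q x by (simp add: field_simps)
      ultimately show ?thesis by (simp add: cball_subset_cball_iff dist_commute)
    qed
    ultimately show "\<exists>G. finite G \<and> G \<subseteq> E \<and> (\<forall>y\<in>G. cball y (q * R) \<subseteq> cball x R) \<and>
          (\<forall>y\<in>G. \<forall>z\<in>G. y \<noteq> z \<longrightarrow> dist y z > 3 * q * R) \<and> q powr (-s) \<le> real (card G)"
      using G by (intro exI[of _ G]) auto
  qed
qed

lemma hausdorff_dim_eqI:
  fixes E :: "'a::euclidean_space set"
  assumes "homogeneous E D" "compact E" "E \<noteq> {}" "0 \<le> D"
    and C: "\<And>r. 0 < r \<Longrightarrow> r \<le> 1 \<Longrightarrow> real (covering_number r E) \<le> C * r powr (-D)"
  shows "hausdorff_dim E = D"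
proof -
  have zero: "hausdorff_measure s E = 0" if "D < s" for s
  proof (rule hausdorff_measure_eq_0I)
    fix \<delta> \<epsilon> :: real assume "0 < \<delta>" "0 < \<epsilon>"
    have "((\<lambda>r. C * r powr (-D) * r powr s) \<longlongrightarrow> 0) (at_right 0)"
      using that by real_asymp
    then have "\<forall>\<^sub>F r in at_right 0. C * r powr (-D) * r powr s < \<epsilon>"
      using \<open>0 < \<epsilon>\<close> by (rule order_tendstoD)
    moreover have "\<forall>\<^sub>F r in at_right (0::real). 0 < r \<and> r < min \<delta> 1"
      using \<open>0 < \<delta>\<close> by (auto simp: eventually_at_right_field intro!: exI[of _ "min \<delta> 1"])
    ultimately have "\<forall>\<^sub>F r in at_right 0. 0 < r \<and> r < min \<delta> 1 \<and> C * r powr (-D) * r powr s < \<epsilon>"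
      by eventually_elim auto
    then obtain r where r: "0 < r" "r < min \<delta> 1" "C * r powr (-D) * r powr s < \<epsilon>"
      using eventually_happens[of _ "at_right (0::real)"] by auto
    moreover have "real (covering_number r E) * r powr s \<le> C * r powr (-D) * r powr s"
      using C r by (intro mult_right_mono) auto
    ultimately show "\<exists>r. 0 < r \<and> r \<le> \<delta> \<and> real (covering_number r E) * r powr s \<le> \<epsilon>"
      by (intro exI[of _ r] conjI) linarith+
  qed (use that assms(2,4) compact_imp_bounded in auto)
  have pos: "hausdorff_measure s E \<noteq> 0" if s: "0 < s" "s < D" for s
  proof -
    obtain q where q: "0 < q" "q < 1" "\<And>x R. x \<in> E \<Longrightarrow> 0 < R \<Longrightarrow> R \<le> 1 \<Longrightarrow>
      \<exists>G. finite G \<and> G \<subseteq> E \<and> (\<forall>y\<in>G. cball y (q * R) \<subseteq> cball x R) \<and>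
          (\<forall>y\<in>G. \<forall>z\<in>G. y \<noteq> z \<longrightarrow> dist y z > 3 * q * R) \<and> q powr (-s) \<le> real (card G)"
      using homogeneous_split[OF assms(1) s(2)] by blast
    obtain x where x: "x \<in> E" using assms by blast
    show ?thesis
    proof (rule hausdorff_measure_pos[OF assms(2,3) s(1)])
      show "0 < q powr s" using q by simp
      fix T :: "nat set" and U :: "nat \<Rightarrow> 'a set" and d :: "nat \<Rightarrow> real"
      assume T: "finite T" "E \<subseteq> (\<Union>i\<in>T. U i)" "\<And>i. i \<in> T \<Longrightarrow> 0 < d i"
        "\<And>i a b. i \<in> T \<Longrightarrow> a \<in> U i \<Longrightarrow> b \<in> U i \<Longrightarrow> dist a b \<le> d i"
      \<comment> \<open>The smallest \<open>d i\<close> of the finite cover fixes the level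
        \<open>N\<close> at which the descent through the scales ends.\<close>
      have "T \<noteq> {}" using T(2) x by auto
      then have m: "0 < Min (d ` T)" using T by auto
      then obtain N where N: "q ^ N < Min (d ` T)" using q real_arch_pow_inv by blast
      then have "q ^ N * 1 \<le> d i" if "i \<in> T" for i
        using order_trans[OF less_imp_le[OF N] Min_le[OF finite_imageI[OF T(1)] imageI[OF that]]] by simp
      then have "(q ^ (0 + 1) * 1) powr s \<le> (\<Sum>i | i \<in> T \<and> U i \<inter> cball x (q ^ 0 * 1) \<noteq> {}. d i powr s)"
        by (intro cover_sum_ge[OF q(1,2) s(1) _ q(3) T(1,2) _ T(4) x, of _ N]) auto
      also have "\<dots> \<le> (\<Sum>i\<in>T. d i powr s)"
        using T(1) by (intro sum_mono2) auto
      finally show "q powr s \<le> (\<Sum>i\<in>T. d i powr s)" by simp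
    qed
  qed
  have "D \<le> s" if "0 \<le> s" "hausdorff_measure s E = 0" for s
  proof (rule ccontr)
    assume "\<not> D \<le> s"
    show False
    proof (cases "s = 0")
      case False
      then show False using pos[of s] that \<open>\<not> D \<le> s\<close> by auto
    next
      case True
      \<comment> \<open>The exponent 0 is outside the range of \<open>pos\<close>: here every cover
        has a non-empty member, of gauge 1.\<close>
      have "1 \<le> hausdorff_premeasure 0 1 E"
        unfolding hausdorff_premeasure_def
      proof (rule Inf_greatest, safe)
        fix U :: "nat \<Rightarrow> 'a set" assume "E \<subseteq> (\<Union>i. U i)"
        then obtain i where "U i \<noteq> {}" using assms(3) by blast
        then have "1 = hausdorff_gauge 0 (U i)" by (simp add: hausdorff_gauge_def)
        also have "\<dots> \<le> (\<Sum>i. hausdorff_gauge 0 (U i))"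
          using sum_le_suminf[of "\<lambda>i. hausdorff_gauge 0 (U i)" "{i}"] by simp
        finally show "1 \<le> (\<Sum>i. hausdorff_gauge 0 (U i))" .
      qed
      also have "\<dots> \<le> hausdorff_measure 0 E"
        unfolding hausdorff_measure_def by (intro SUP_upper) auto
      finally show False using that True by simp
    qed
  qed
  then show ?thesis
    unfolding hausdorff_dim_def
  proof (intro antisym)
    show "Inf {s. 0 \<le> s \<and> hausdorff_measure s E = 0} \<le> D"
    proof (rule field_le_epsilon)
      fix e :: real assume "0 < e"
      then have "D + e \<in> {s. 0 \<le> s \<and> hausdorff_measure s E = 0}"
        using zero[of "D + e"] assms(4) by auto
      then show "Inf {s. 0 \<le> s \<and> hausdorff_measure s E = 0} \<le> D + e"
        by (intro cInf_lower) (auto intro: bdd_belowI[of _ 0])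
    qed
    show "D \<le> Inf {s. 0 \<le> s \<and> hausdorff_measure s E = 0}"
    proof (rule cInf_greatest)
      show "{s. 0 \<le> s \<and> hausdorff_measure s E = 0} \<noteq> {}"
        using zero[of "D + 1"] assms(4) by (auto intro!: exI[of _ "D + 1"])
    qed (use \<open>\<And>s. 0 \<le> s \<Longrightarrow> hausdorff_measure s E = 0 \<Longrightarrow> D \<le> s\<close> in auto)
  qed
qed

section \<open>Anisotropic coverings and tilings of the unit square\<close>

abbreviation (input) wd :: "rect \<Rightarrow> real" where "wd i \<equiv> fst (snd (snd i))"
abbreviation (input) ht :: "rect \<Rightarrow> real" where "ht i \<equiv> snd (snd (snd i))"
abbreviation (input) px :: "rect \<Rightarrow> real" where "px i \<equiv> fst i"
abbreviation (input) py :: "rect \<Rightarrow> real" where "py i \<equiv> fst (snd i)"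

lemma rect_map_conv: "rect_map i p = (wd i * fst p + px i, ht i * snd p + py i)"
  by (cases i; cases p) auto

lemma fst_rect_map [simp]: "fst (rect_map i p) = wd i * fst p + px i"
  and snd_rect_map [simp]: "snd (rect_map i p) = ht i * snd p + py i"
  by (simp_all add: rect_map_conv)

definition near :: "real \<Rightarrow> real \<Rightarrow> real \<times> real \<Rightarrow> (real \<times> real) set" where
  "near h v g = {a. \<bar>fst a - fst g\<bar> \<le> h \<and> \<bar>snd a - snd g\<bar> \<le> v}"

text \<open>An upper bound \<open>K\<close> instead of a least number, and a real one: the bounds
  are sums of powers that pass through the recursion without rounding.\<close>

definition cov :: "(real \<times> real) set \<Rightarrow> real \<Rightarrow> real \<Rightarrow> real \<Rightarrow> bool" where
  "cov A h v K \<longleftrightarrow> (\<exists>G. finite G \<and> real (card G) \<le> K \<and> A \<subseteq> (\<Union>g\<in>G. near h v g))"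

lemma near_mono: "h \<le> h' \<Longrightarrow> v \<le> v' \<Longrightarrow> near h v g \<subseteq> near h' v' g"
  by (auto simp: near_def)

lemma near_rect_map:
  assumes "0 < wd i" "0 < ht i"
  shows "rect_map i ` near (h / wd i) (v / ht i) g \<subseteq> near h v (rect_map i g)"
proof -
  have "wd i * x + px i - (wd i * y + px i) = wd i * (x - y)"
    "ht i * x + py i - (ht i * y + py i) = ht i * (x - y)" for x y by algebra+
  then show ?thesis
    using assms by (auto simp: near_def abs_mult pos_le_divide_eq mult.commute)
qed

lemma cov_mono:
  assumes "cov A h v K" "A' \<subseteq> A" "h \<le> h'" "v \<le> v'" "K \<le> K'"
  shows "cov A' h' v' K'"
proof -
  obtain G where G: "finite G" "real (card G) \<le> K" "A \<subseteq> (\<Union>g\<in>G. near h v g)"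
    using assms(1) unfolding cov_def by blast
  have "A' \<subseteq> (\<Union>g\<in>G. near h' v' g)"
    using G(3) assms(2) near_mono[OF assms(3,4)] by blast
  then show ?thesis
    unfolding cov_def using G assms(5) by (intro exI[of _ G]) auto
qed

lemma real_card_UN_le:
  assumes "finite L" "\<And>i. i \<in> L \<Longrightarrow> real (card (G i)) \<le> K i"
  shows "real (card (\<Union>i\<in>L. G i)) \<le> (\<Sum>i\<in>L. K i)"
proof -
  have "real (card (\<Union>i\<in>L. G i)) \<le> real (\<Sum>i\<in>L. card (G i))"
    using card_UN_le[OF assms(1)] by (rule of_nat_mono)
  also have "\<dots> = (\<Sum>i\<in>L. real (card (G i)))" by simp
  also have "\<dots> \<le> (\<Sum>i\<in>L. K i)" using assms(2) by (rule sum_mono)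
  finally show ?thesis .
qed

text \<open>The covering half of the recursion: \<open>rect_map i\<close> carries a box with
  half-sides \<open>h / wd i\<close> and \<open>v / ht i\<close> into one with half-sides
  \<open>h\<close> and \<open>v\<close>.\<close>

lemma cov_UN:
  assumes "finite L" "\<And>i. i \<in> L \<Longrightarrow> 0 < wd i \<and> 0 < ht i"
    and cov: "\<And>i. i \<in> L \<Longrightarrow> cov (A i) (h / wd i) (v / ht i) (K i)"
  shows "cov (\<Union>i\<in>L. rect_map i ` A i) h v (\<Sum>i\<in>L. K i)"
proof -
  obtain G where G: "\<And>i. i \<in> L \<Longrightarrow> finite (G i)" "\<And>i. i \<in> L \<Longrightarrow> real (card (G i)) \<le> K i"
    "\<And>i. i \<in> L \<Longrightarrow> A i \<subseteq> (\<Union>g\<in>G i. near (h / wd i) (v / ht i) g)"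
    using cov unfolding cov_def by metis
  let ?G = "\<Union>i\<in>L. rect_map i ` G i"
  have card: "real (card ?G) \<le> (\<Sum>i\<in>L. K i)"
    using G(1,2) by (intro real_card_UN_le assms(1)) (meson card_image_le of_nat_mono order_trans)
  have "rect_map i a \<in> (\<Union>g\<in>?G. near h v g)" if "i \<in> L" "a \<in> A i" for i a
  proof -
    obtain g where g: "g \<in> G i" "a \<in> near (h / wd i) (v / ht i) g" using G(3) \<open>i \<in> L\<close> \<open>a \<in> A i\<close> by blast
    then have "rect_map i a \<in> near h v (rect_map i g)"
      using near_rect_map[of i h v g] assms(2)[OF \<open>i \<in> L\<close>] by blast
    then show ?thesis using g \<open>i \<in> L\<close> by blast
  qed
  then show ?thesis
    unfolding cov_def using G(1) assms(1) card by (intro exI[of _ ?G]) auto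
qed

lemma cov_Union:
  assumes "finite L" "\<And>i. i \<in> L \<Longrightarrow> cov (A i) h v K"
  shows "cov (\<Union>i\<in>L. A i) h v (real (card L) * K)"
proof -
  obtain G where G: "\<And>i. i \<in> L \<Longrightarrow> finite (G i)" "\<And>i. i \<in> L \<Longrightarrow> real (card (G i)) \<le> K"
    "\<And>i. i \<in> L \<Longrightarrow> A i \<subseteq> (\<Union>g\<in>G i. near h v g)"
    using assms(2) unfolding cov_def by metis
  have "real (card (\<Union>i\<in>L. G i)) \<le> (\<Sum>i\<in>L. K)"
    using G(2) by (intro real_card_UN_le assms(1))
  moreover have "(\<Union>i\<in>L. A i) \<subseteq> (\<Union>g\<in>(\<Union>i\<in>L. G i). near h v g)"
  proof
    fix a assume "a \<in> (\<Union>i\<in>L. A i)"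
    then obtain i where "i \<in> L" "a \<in> A i" by blast
    then show "a \<in> (\<Union>g\<in>(\<Union>i\<in>L. G i). near h v g)" using G(3)[of i] by blast
  qed
  ultimately show ?thesis
    unfolding cov_def using G(1) assms(1) by (intro exI[of _ "\<Union>i\<in>L. G i"]) auto
qed

text \<open>Once the boxes are as high as the unit square, only the projection to the first axis matters.\<close>

lemma cov_flat:
  assumes "cov A h v K" "fst ` B \<subseteq> fst ` A" "B \<subseteq> UNIV \<times> {0..1}" "1 \<le> v'"
  shows "cov B h v' K"
proof -
  obtain G where G: "finite G" "real (card G) \<le> K" "A \<subseteq> (\<Union>g\<in>G. near h v g)"
    using assms(1) unfolding cov_def by blast
  let ?G = "(\<lambda>g. (fst g, 0 :: real)) ` G"
  have "real (card ?G) \<le> K"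
    using G(2) card_image_le[OF G(1), of "\<lambda>g. (fst g, 0 :: real)"] by linarith
  moreover have "B \<subseteq> (\<Union>g\<in>?G. near h v' g)"
  proof
    fix b assume b: "b \<in> B"
    then obtain a where a: "a \<in> A" "fst a = fst b" using assms(2) by force
    then obtain g where "g \<in> G" "a \<in> near h v g" using G by blast
    then have "b \<in> near h v' (fst g, 0)"
      using a b assms(3,4) by (auto simp: near_def)
    then show "b \<in> (\<Union>g\<in>?G. near h v' g)" using \<open>g \<in> G\<close> by blast
  qed
  ultimately show ?thesis unfolding cov_def using G(1) by (intro exI[of _ ?G]) auto
qed

text \<open>The half-diagonal \<open>sqrt 2 * r / 4\<close> is smaller than \<open>r / 2\<close>.
  This is the origin of the factor 4 between boxes and covering sets.\<close>

lemma near_subset_ball: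
  assumes "0 < r"
  shows "near (r / 4) (r / 4) g \<subseteq> ball g (r / 2)"
proof
  fix a assume "a \<in> near (r / 4) (r / 4) g"
  then have "\<bar>fst g - fst a\<bar> \<le> r / 4" "\<bar>snd g - snd a\<bar> \<le> r / 4"
    by (auto simp: near_def abs_minus_commute)
  then have "(fst g - fst a)\<^sup>2 + (snd g - snd a)\<^sup>2 \<le> (r / 4)\<^sup>2 + (r / 4)\<^sup>2"
    by (intro add_mono) (auto simp: abs_le_square_iff[symmetric])
  also have "\<dots> < (r / 2)\<^sup>2" using assms by (simp add: power2_eq_square field_simps)
  finally have "sqrt ((fst g - fst a)\<^sup>2 + (snd g - snd a)\<^sup>2) < r / 2"
    using assms by (intro real_less_lsqrt) auto
  then show "a \<in> ball g (r / 2)"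
    by (auto simp: dist_prod_def dist_real_def)
qed

lemma covering_number_le_cov:
  assumes "cov A (r / 4) (r / 4) K" "0 < r"
  shows "real (covering_number r A) \<le> K"
proof -
  obtain G where G: "finite G" "real (card G) \<le> K" "A \<subseteq> (\<Union>g\<in>G. near (r / 4) (r / 4) g)"
    using assms(1) unfolding cov_def by blast
  have "A \<subseteq> (\<Union>g\<in>G. ball g (r / 2))"
    using G(3) near_subset_ball[OF assms(2)] by blast
  then have "covering_number r A \<le> card ((\<lambda>g. ball g (r / 2)) ` G)"
    using G assms by (intro covering_number_le_card open_cover_balls)
  also have "\<dots> \<le> card G" using G by (intro card_image_le)
  finally show ?thesis using G by linarith
qed

text \<open>
  A tile \<open>(B, g)\<close> consists of a set \<open>B\<close> and the lower left corner \<open>g\<close> of an \<open>m h \<times> m v\<close> box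
  to which \<open>B\<close> is close. The boxes do not overlap, whereas the sets \<open>B\<close> themselves may touch:
  separation of the boxes, unlike separation of points of \<open>F\<close>, is preserved exactly by the
  recursion, even if \<open>F\<close> is contained in the boundary of the unit square.
\<close>

definition tiles ::
  "real \<Rightarrow> real \<Rightarrow> real \<Rightarrow> ((real \<times> real) set \<times> (real \<times> real)) set \<Rightarrow> bool" where
  "tiles m h v Q \<longleftrightarrow> finite Q \<and>
     (\<forall>(B, g)\<in>Q. B \<noteq> {} \<and> B \<subseteq> near (h / m) (v / m) g \<and>
        0 \<le> fst g \<and> fst g + m * h \<le> 1 \<and> 0 \<le> snd g \<and> snd g + m * v \<le> 1) \<and>
     (\<forall>p\<in>Q. \<forall>q\<in>Q. p \<noteq> q \<longrightarrow>
        m * h \<le> \<bar>fst (snd p) - fst (snd q)\<bar> \<or> m * v \<le> \<bar>snd (snd p) - snd (snd q)\<bar>)"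

definition pack :: "real \<Rightarrow> (real \<times> real) set \<Rightarrow> real \<Rightarrow> real \<Rightarrow> real \<Rightarrow> bool" where
  "pack m A h v K \<longleftrightarrow> (\<exists>Q. tiles m h v Q \<and> (\<forall>(B, g)\<in>Q. B \<subseteq> A) \<and> K \<le> real (card Q))"

lemma tilesD:
  assumes "tiles m h v Q" "(B, g) \<in> Q"
  shows "B \<noteq> {}" "B \<subseteq> near (h / m) (v / m) g"
    "0 \<le> fst g" "fst g + m * h \<le> 1" "0 \<le> snd g" "snd g + m * v \<le> 1"
  using assms unfolding tiles_def by fastforce+

lemma tiles_separated:
  assumes "tiles m h v Q" "(B, g) \<in> Q" "(B', g') \<in> Q" "(B, g) \<noteq> (B', g')"
  shows "m * h \<le> \<bar>fst g - fst g'\<bar> \<or> m * v \<le> \<bar>snd g - snd g'\<bar>"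
  using assms unfolding tiles_def by fastforce

lemma tiles_subset: "tiles m h v Q \<Longrightarrow> Q' \<subseteq> Q \<Longrightarrow> tiles m h v Q'"
  unfolding tiles_def by (meson finite_subset subsetD)

text \<open>Where the recursion stops, both sides lie between \<open>m\<close> and
  \<open>1 / m\<close>. The factors \<open>m\<close> in \<open>tiles\<close> are made for this: the
  \<open>m h \<times> m v\<close> box at the origin fits into the unit square, and the enlarged box
  contains the square.\<close>

lemma tiles_singleton:
  assumes "B \<noteq> {}" "B \<subseteq> {0..1} \<times> {0..1}" "0 < m" "m \<le> h" "m \<le> v" "m * h \<le> 1" "m * v \<le> 1"
  shows "tiles m h v {(B, (0, 0))}"
proof -
  have "1 \<le> h / m" "1 \<le> v / m" using assms by (auto simp: field_simps)
  then have "B \<subseteq> near (h / m) (v / m) (0, 0)"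
    using assms(2) by (force simp: near_def)
  then show ?thesis using assms unfolding tiles_def by auto
qed

definition unit_rect :: "rect \<Rightarrow> bool" where
  "unit_rect i \<longleftrightarrow> 0 < wd i \<and> 0 < ht i \<and> 0 \<le> px i \<and> px i + wd i \<le> 1 \<and> 0 \<le> py i \<and> py i + ht i \<le> 1"

definition apart :: "rect \<Rightarrow> rect \<Rightarrow> bool" where
  "apart i j \<longleftrightarrow> px i + wd i \<le> px j \<or> px j + wd j \<le> px i \<or> py i + ht i \<le> py j \<or> py j + ht j \<le> py i"

lemma affine_corner:
  fixes w p x s :: real
  assumes "0 < w" "0 \<le> p" "p + w \<le> 1" "0 \<le> x" "x + s / w \<le> 1"
  shows "0 \<le> w * x + p" "w * x + p + s \<le> 1" "p \<le> w * x + p" "w * x + p + s \<le> p + w"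
proof -
  have "w * x + s \<le> w" using assms by (simp add: field_simps)
  then show "w * x + p + s \<le> 1" "w * x + p + s \<le> p + w" using assms by auto
  show "0 \<le> w * x + p" "p \<le> w * x + p" using assms by auto
qed

text \<open>Only the corners must be moved by \<open>rect_map i\<close>; the sets may become any
  \<open>f i B\<close> near the new corner. For columns \<open>f\<close> collects the images under
  several maps, and for projections it replaces a set by the points with the same first
  coordinates.\<close>

lemma tiles_UN:
  assumes m: "0 < m" "0 < h" "0 < v" and "finite L"
    and unit: "\<And>i. i \<in> L \<Longrightarrow> unit_rect i"
    and apart: "\<And>i j. i \<in> L \<Longrightarrow> j \<in> L \<Longrightarrow> i \<noteq> j \<Longrightarrow> apart i j"
    and Q: "\<And>i. i \<in> L \<Longrightarrow> tiles m (h / wd i) (v / ht i) (Q i)"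
    and f: "\<And>i B g. i \<in> L \<Longrightarrow> (B, g) \<in> Q i \<Longrightarrow>
       f i B \<noteq> {} \<and> f i B \<subseteq> near (h / m) (v / m) (rect_map i g)"
  defines "R \<equiv> (\<Union>i\<in>L. (\<lambda>(B, g). (f i B, rect_map i g)) ` Q i)"
  shows "tiles m h v R" "card R = (\<Sum>i\<in>L. card (Q i))"
proof -
  let ?h = "\<lambda>i (B, g). (f i B, rect_map i g)"
  have fin: "finite (Q i)" if "i \<in> L" for i using Q[OF that] unfolding tiles_def by blast
  have corner: "0 \<le> fst (rect_map i g) \<and> fst (rect_map i g) + m * h \<le> 1 \<and>
      0 \<le> snd (rect_map i g) \<and> snd (rect_map i g) + m * v \<le> 1 \<and>
      px i \<le> fst (rect_map i g) \<and> fst (rect_map i g) + m * h \<le> px i + wd i \<and>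
      py i \<le> snd (rect_map i g) \<and> snd (rect_map i g) + m * v \<le> py i + ht i"
    if "i \<in> L" "(B, g) \<in> Q i" for i B g
    using tilesD[OF Q[OF that(1)] that(2)] unit[OF that(1)]
      affine_corner[of "wd i" "px i" "fst g" "m * h"] affine_corner[of "ht i" "py i" "snd g" "m * v"]
    by (auto simp: unit_rect_def)
  \<comment> \<open>Within one rectangle the separation scales exactly. For different rectangles the
    corner boxes lie inside their own rectangles, which do not overlap.\<close>
  have sep: "m * h \<le> \<bar>fst (rect_map i g) - fst (rect_map i' g')\<bar> \<or>
      m * v \<le> \<bar>snd (rect_map i g) - snd (rect_map i' g')\<bar>"
    if i: "i \<in> L" "(B, g) \<in> Q i" "i' \<in> L" "(B', g') \<in> Q i'" "(i, B, g) \<noteq> (i', B', g')" for i B g i' B' g'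
  proof (cases "i = i'")
    case True
    have w: "0 < wd i" "0 < ht i" using unit[OF i(1)] by (auto simp: unit_rect_def)
    have "m * (h / wd i) \<le> \<bar>fst g - fst g'\<bar> \<or> m * (v / ht i) \<le> \<bar>snd g - snd g'\<bar>"
      using tiles_separated[OF Q[OF i(1)], of B g B' g'] i True by auto
    moreover have "\<bar>fst (rect_map i g) - fst (rect_map i' g')\<bar> = wd i * \<bar>fst g - fst g'\<bar>"
      "\<bar>snd (rect_map i g) - snd (rect_map i' g')\<bar> = ht i * \<bar>snd g - snd g'\<bar>"
      using w True by (auto simp: abs_mult[symmetric] right_diff_distrib abs_mult_pos')
    ultimately show ?thesis using w by (simp add: field_simps)
  next
    case False
    then show ?thesis
      using apart[OF i(1,3)] corner[OF i(1,2)] corner[OF i(3,4)] unfolding apart_def by linarith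
  qed
  have pos: "0 < m * h" "0 < m * v" using m by auto
  have ne: "rect_map i g \<noteq> rect_map i' g'"
    if "i \<in> L" "(B, g) \<in> Q i" "i' \<in> L" "(B', g') \<in> Q i'" "(i, B, g) \<noteq> (i', B', g')" for i B g i' B' g'
    using sep[OF that] pos by (auto simp del: fst_rect_map snd_rect_map)
  show "tiles m h v R"
    unfolding tiles_def
  proof (intro conjI ballI)
    show "finite R" using fin assms(4) unfolding R_def by auto
  next
    fix p assume "p \<in> R"
    then obtain i B g where "i \<in> L" "(B, g) \<in> Q i" "p = (f i B, rect_map i g)" unfolding R_def by auto
    then show "case p of (B, g) \<Rightarrow> B \<noteq> {} \<and> B \<subseteq> near (h / m) (v / m) g \<and>
        0 \<le> fst g \<and> fst g + m * h \<le> 1 \<and> 0 \<le> snd g \<and> snd g + m * v \<le> 1"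
      using f corner by (auto simp del: fst_rect_map snd_rect_map)
  next
    fix p q assume "p \<in> R" "q \<in> R"
    then obtain i B g i' B' g' where i: "i \<in> L" "(B, g) \<in> Q i" "p = (f i B, rect_map i g)"
      "i' \<in> L" "(B', g') \<in> Q i'" "q = (f i' B', rect_map i' g')" unfolding R_def by auto
    show "p \<noteq> q \<longrightarrow> m * h \<le> \<bar>fst (snd p) - fst (snd q)\<bar> \<or> m * v \<le> \<bar>snd (snd p) - snd (snd q)\<bar>"
      using sep[OF i(1,2,4,5)] i(3,6) by (auto simp del: fst_rect_map snd_rect_map)
  qed
  have inj: "inj_on (?h i) (Q i)" if "i \<in> L" for i
  proof (rule inj_onI)
    fix p q assume pq: "p \<in> Q i" "q \<in> Q i" "?h i p = ?h i q"
    then show "p = q"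
      using ne[OF that, of "fst p" "snd p" i "fst q" "snd q"] that by (auto simp: case_prod_beta simp del: fst_rect_map snd_rect_map)
  qed
  have "card R = (\<Sum>i\<in>L. card (?h i ` Q i))"
    unfolding R_def
  proof (rule card_UN_disjoint)
    show "\<forall>i\<in>L. \<forall>j\<in>L. i \<noteq> j \<longrightarrow> ?h i ` Q i \<inter> ?h j ` Q j = {}"
    proof (intro ballI impI)
      fix i j assume ij: "i \<in> L" "j \<in> L" "i \<noteq> j"
      show "?h i ` Q i \<inter> ?h j ` Q j = {}"
        using ne[OF ij(1) _ ij(2)] ij(3) by (auto simp del: fst_rect_map snd_rect_map) metis
    qed
  qed (use assms(4) fin in auto)
  also have "\<dots> = (\<Sum>i\<in>L. card (Q i))"
    using inj by (intro sum.cong) (auto simp: card_image)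
  finally show "card R = (\<Sum>i\<in>L. card (Q i))" .
qed

lemma pack_UN:
  assumes m: "0 < m" "0 < h" "0 < v" and "finite L"
    and unit: "\<And>i. i \<in> L \<Longrightarrow> unit_rect i"
    and apart: "\<And>i j. i \<in> L \<Longrightarrow> j \<in> L \<Longrightarrow> i \<noteq> j \<Longrightarrow> apart i j"
    and pack: "\<And>i. i \<in> L \<Longrightarrow> pack m (A i) (h / wd i) (v / ht i) (K i)"
  shows "pack m (\<Union>i\<in>L. rect_map i ` A i) h v (\<Sum>i\<in>L. K i)"
proof -
  obtain Q where Q: "\<And>i. i \<in> L \<Longrightarrow> tiles m (h / wd i) (v / ht i) (Q i)"
     "\<And>i. i \<in> L \<Longrightarrow> \<forall>(B, g)\<in>Q i. B \<subseteq> A i" "\<And>i. i \<in> L \<Longrightarrow> K i \<le> card (Q i)"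
    using pack unfolding pack_def by metis
  have f: "rect_map i ` B \<noteq> {} \<and> rect_map i ` B \<subseteq> near (h / m) (v / m) (rect_map i g)"
    if "i \<in> L" "(B, g) \<in> Q i" for i B g
    using tilesD(1,2)[OF Q(1)[OF that(1)] that(2)] near_rect_map[of i "h / m" "v / m" g] unit[OF that(1)]
    by (force simp: unit_rect_def field_simps)
  let ?R = "\<Union>i\<in>L. (\<lambda>(B, g). (rect_map i ` B, rect_map i g)) ` Q i"
  have T: "tiles m h v ?R" "card ?R = (\<Sum>i\<in>L. card (Q i))"
    by (rule tiles_UN[where f = "\<lambda>i B. rect_map i ` B"]; use m assms(4) unit apart Q(1) f in blast)+
  have "(\<Sum>i\<in>L. K i) \<le> (\<Sum>i\<in>L. card (Q i))"
    using sum_mono[of L K "\<lambda>i. real (card (Q i))"] Q(3) by simp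
  moreover have "\<forall>(B, g)\<in>?R. B \<subseteq> (\<Union>i\<in>L. rect_map i ` A i)"
    using Q(2) by fast
  ultimately show ?thesis
    unfolding pack_def using T by (intro exI[of _ ?R]) simp
qed

section \<open>Lower bounds for covering numbers from tiles\<close>

lemma pack_mono: "pack m A h v K \<Longrightarrow> A \<subseteq> A' \<Longrightarrow> K' \<le> K \<Longrightarrow> pack m A' h v K'"
  unfolding pack_def by (elim exE conjE, intro exI conjI, assumption) (blast, linarith)

lemma pack_singleton:
  assumes "A \<noteq> {}" "A \<subseteq> {0..1} \<times> {0..1}" "0 < m" "m \<le> h" "m \<le> v" "m * h \<le> 1" "m * v \<le> 1" "K \<le> 1"
  shows "pack m A h v K"
  unfolding pack_def using tiles_singleton[OF assms(1-7)] assms(8) by (intro exI) auto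

lemma pack_flat:
  assumes "pack m A h v K" "fst ` A \<subseteq> fst ` B" "B \<subseteq> UNIV \<times> {0..1}" "m \<le> v" "0 < m" "0 < h"
  shows "pack m B h v K"
proof -
  obtain Q where Q: "tiles m h v Q" "\<forall>(B, g)\<in>Q. B \<subseteq> A" "K \<le> real (card Q)"
    using assms(1) unfolding pack_def by blast
  define f where "f X = {b \<in> B. fst b \<in> fst ` X}" for X :: "(real \<times> real) set"
  \<comment> \<open>The identity as a rectangle map, so that \<open>tiles_UN\<close> exchanges the
    sets and leaves the corners in place.\<close>
  define U :: rect where "U = (0, 0, 1, 1)"
  have v: "0 < v" "1 \<le> v / m" using assms(4,5) by (auto simp: field_simps)
  have U: "rect_map U g = g" for g by (cases g) (auto simp: U_def)
  let ?Q = "(\<lambda>(X, g). (f X, g)) ` Q"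
  have T: "f X \<noteq> {} \<and> f X \<subseteq> near (h / m) (v / m) g" if "(X, g) \<in> Q" for X g
  proof
    have X: "X \<subseteq> A" "X \<noteq> {}" "X \<subseteq> near (h / m) (v / m) g" using that Q(2) tilesD[OF Q(1) that] by auto
    then obtain x where "x \<in> X" "fst x \<in> fst ` B" using assms(2) by blast
    then show "f X \<noteq> {}" unfolding f_def by force
    have "0 \<le> snd g" "snd g \<le> 1"
      using tilesD[OF Q(1) that] assms(5) v by (auto intro: order_trans[of _ "snd g + m * v"])
    then have "\<bar>snd b - snd g\<bar> \<le> v / m" if "b \<in> B" for b
      using that assms(3) v by fastforce
    moreover have "\<bar>fst b - fst g\<bar> \<le> h / m" if "fst b \<in> fst ` X" for b
      using that X(3) by (auto simp: near_def)
    ultimately show "f X \<subseteq> near (h / m) (v / m) g"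
      unfolding near_def f_def by blast
  qed
  note R = tiles_UN[of m h v "{U}" "\<lambda>_. Q" "\<lambda>_. f"]
  have "tiles m h v ?Q \<and> card ?Q = card Q"
    using R assms(5,6) v Q(1) T by (auto simp: unit_rect_def U_def U[unfolded U_def] cong: image_cong)
  then show ?thesis
    unfolding pack_def using Q(3) by (intro exI[of _ ?Q]) (auto simp: f_def)
qed

text \<open>Pigeonhole on a lattice of \<open>a \<times> b\<close> cells: a cell holds at most one
  of the separated points, and the floors take values in \<open>{-k..k}\<close>, which has
  \<open>2 * k + 1\<close> elements.\<close>

lemma separated_card_le:
  assumes "0 < a" "0 < b" "finite Q"
    and sep: "\<And>p q. p \<in> Q \<Longrightarrow> q \<in> Q \<Longrightarrow> p \<noteq> q \<Longrightarrow>
      a \<le> \<bar>fst (f p) - fst (f q)\<bar> \<or> b \<le> \<bar>snd (f p) - snd (f q)\<bar>"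
    and near: "\<And>p. p \<in> Q \<Longrightarrow> \<bar>fst (f p) - x\<bar> \<le> real k * a \<and> \<bar>snd (f p) - y\<bar> \<le> real k * b"
  shows "card Q \<le> (2 * k + 1)\<^sup>2"
proof -
  define u where "u p = (\<lfloor>(fst (f p) - x) / a\<rfloor>, \<lfloor>(snd (f p) - y) / b\<rfloor>)" for p
  have floor_near: "\<bar>s - t\<bar> < c" if "\<lfloor>(s - z) / c\<rfloor> = \<lfloor>(t - z) / c\<rfloor>" "0 < c" for s t z c :: real
  proof -
    have "\<bar>(s - z) / c - (t - z) / c\<bar> < 1" using that(1) by linarith
    also have "(s - z) / c - (t - z) / c = (s - t) / c" by (simp add: diff_divide_distrib)
    finally show ?thesis using that(2) by (simp add: abs_divide)
  qed
  have "inj_on u Q"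
  proof (rule inj_onI, rule ccontr)
    fix p q assume pq: "p \<in> Q" "q \<in> Q" "u p = u q" "p \<noteq> q"
    then have "\<bar>fst (f p) - fst (f q)\<bar> < a" "\<bar>snd (f p) - snd (f q)\<bar> < b"
      using floor_near assms(1,2) unfolding u_def by blast+
    then show False using sep[OF pq(1,2,4)] by linarith
  qed
  have floor_range: "\<lfloor>(s - z) / c\<rfloor> \<in> {- int k..int k}" if "\<bar>s - z\<bar> \<le> real k * c" "0 < c" for s z c :: real
  proof -
    have "\<bar>(s - z) / c\<bar> \<le> real k" using that by (simp add: abs_divide pos_divide_le_eq)
    then have "- real k \<le> (s - z) / c" "(s - z) / c \<le> real k" by linarith+
    then show ?thesis by (simp add: le_floor_iff floor_le_iff)
  qed
  have "u ` Q \<subseteq> {- int k..int k} \<times> {- int k..int k}"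
    using near assms(1,2) floor_range unfolding u_def by blast
  then have "card Q \<le> card ({- int k..int k} \<times> {- int k..int k})"
    using \<open>inj_on u Q\<close> by (intro card_inj_on_le) auto
  also have "\<dots> = (2 * k + 1)\<^sup>2"
  proof -
    have "card {- int k..int k} = 2 * k + 1" unfolding card_atLeastAtMost_int by linarith
    then show ?thesis by (simp only: card_cartesian_product power2_eq_square)
  qed
  finally show ?thesis .
qed

lemma abs_le_dist:
  fixes p q :: "real \<times> real"
  shows "\<bar>fst p - fst q\<bar> \<le> dist p q" "\<bar>snd p - snd q\<bar> \<le> dist p q"
  using dist_fst_le[of p q] dist_snd_le[of p q] by (simp_all add: dist_real_def)

lemma tiles_meeting_card_le:
  assumes "tiles m r r Q" "0 < m" "m \<le> 1" "0 < r" "2 / m\<^sup>2 \<le> real k"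
    and "\<And>B g. (B, g) \<in> Q \<Longrightarrow> \<exists>b\<in>B. dist p b \<le> r"
  shows "card Q \<le> (2 * k + 1)\<^sup>2"
proof -
  have near: "\<bar>fst g - fst p\<bar> \<le> real k * (m * r) \<and> \<bar>snd g - snd p\<bar> \<le> real k * (m * r)"
    if "(B, g) \<in> Q" for B g
  proof -
    obtain b where b: "b \<in> B" "dist p b \<le> r" using assms(6)[OF \<open>(B, g) \<in> Q\<close>] by blast
    then have "b \<in> near (r / m) (r / m) g" using tilesD(2)[OF assms(1) \<open>(B, g) \<in> Q\<close>] by blast
    moreover have "r \<le> r / m" using assms(2-4) by (simp add: field_simps)
    \<comment> \<open>A corner is at most \<open>r + r / m \<le> 2 * (r / m)\<close> away from
      \<open>p\<close> in each coordinate; measured in tile sides \<open>m * r\<close> this is at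
      most \<open>2 / m\<^sup>2\<close>, hence the choice of \<open>k\<close>.\<close>
    moreover have "2 * (r / m) \<le> real k * (m * r)"
      using mult_right_mono[OF assms(5), of "m * r"] assms(2,4) by (simp add: power2_eq_square field_simps)
    ultimately show ?thesis
      using b(2) abs_le_dist[of p b] unfolding near_def by (auto simp: abs_le_iff)
  qed
  have "card Q \<le> (2 * k + 1)\<^sup>2"
  proof (rule separated_card_le[where f = snd and a = "m * r" and b = "m * r" and x = "fst p" and y = "snd p"])
    show "finite Q" using assms(1) unfolding tiles_def by blast
    show "\<bar>fst (snd q) - fst p\<bar> \<le> real k * (m * r) \<and> \<bar>snd (snd q) - snd p\<bar> \<le> real k * (m * r)" if "q \<in> Q" for q
      using near[of "fst q" "snd q"] that by simp
  qed (use assms in \<open>auto simp: tiles_def\<close>)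
  then show ?thesis .
qed

text \<open>A covering set has diameter at most \<open>r\<close> and so meets boundedly many tiles.
  The tiles are counted by their corners, so it does no harm if their sets share points.\<close>

lemma covering_number_ge_pack:
  assumes "pack m A r r K" "0 < m" "m \<le> 1" "0 < r" "2 / m\<^sup>2 \<le> real k" "bounded A"
  shows "K \<le> real ((2 * k + 1)\<^sup>2) * real (covering_number r A)"
proof -
  obtain Q where Q: "tiles m r r Q" "\<And>B g. (B, g) \<in> Q \<Longrightarrow> B \<subseteq> A" "K \<le> real (card Q)"
    using assms(1) unfolding pack_def by blast
  have "finite Q" using Q(1) unfolding tiles_def by blast
  obtain \<U> where \<U>: "open_cover r A \<U>" "card \<U> = covering_number r A"
    using covering_number_attained[OF assms(6,4)] .
  define S where "S U = {q \<in> Q. fst q \<inter> U \<noteq> {}}" for U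
  have S: "card (S U) \<le> (2 * k + 1)\<^sup>2" if "U \<in> \<U>" for U
  proof (cases "S U = {}")
    case False
    then obtain p where p: "p \<in> U" unfolding S_def by blast
    show ?thesis
    proof (rule tiles_meeting_card_le[OF tiles_subset[OF Q(1)] assms(2-5)])
      show "S U \<subseteq> Q" unfolding S_def by blast
      fix B g assume "(B, g) \<in> S U"
      then obtain b where "b \<in> B" "b \<in> U" unfolding S_def by auto
      then have "dist p b \<le> diameter U"
        using p \<U>(1) that by (intro diameter_bounded_bound) (auto simp: open_cover_def)
      also have "\<dots> \<le> r" using \<U>(1) that by (auto simp: open_cover_def)
      finally show "\<exists>b\<in>B. dist p b \<le> r" using \<open>b \<in> B\<close> by blast
    qed
  qed simp
  have "Q = (\<Union>U\<in>\<U>. S U)"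
  proof
    show "Q \<subseteq> (\<Union>U\<in>\<U>. S U)"
    proof
      fix q assume q: "q \<in> Q"
      then obtain b where "b \<in> fst q" "b \<in> A"
        using Q(2)[of "fst q" "snd q"] tilesD(1)[OF Q(1), of "fst q" "snd q"] by auto
      then show "q \<in> (\<Union>U\<in>\<U>. S U)" using q \<U>(1) unfolding S_def open_cover_def by blast
    qed
  qed (auto simp: S_def)
  moreover have "finite \<U>" using \<U>(1) unfolding open_cover_def by blast
  ultimately have "real (card Q) \<le> (\<Sum>U\<in>\<U>. real ((2 * k + 1)\<^sup>2))"
    using real_card_UN_le[of \<U> S "\<lambda>_. real ((2 * k + 1)\<^sup>2)", OF _ of_nat_mono[OF S]] by simp
  also have "\<dots> = real ((2 * k + 1)\<^sup>2) * real (covering_number r A)" using \<U>(2) by simp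
  finally show ?thesis using Q(3) by linarith
qed

declare rect_map.simps [simp del]

section \<open>Systems of rectangles arranged in columns\<close>

text \<open>Induction from large to small scales in steps of the factor \<open>M\<close>. It starts
  by itself at \<open>h = E\<close>, where no \<open>h'\<close> between \<open>h / M\<close> and
  \<open>E\<close> exists.\<close>

lemma scale_induct:
  fixes M E h :: real
  assumes "0 < M" "M < 1"
    and step: "\<And>h. 0 < h \<Longrightarrow> h \<le> E \<Longrightarrow> (\<And>h'. h / M \<le> h' \<Longrightarrow> h' \<le> E \<Longrightarrow> P h') \<Longrightarrow> P h"
    and "0 < h" "h \<le> E"
  shows "P h"
proof -
  have E: "0 < E" using assms by linarith
  have *: "P h" if "E * M ^ n \<le> h" "h \<le> E" for n h
    using that
  proof (induction n arbitrary: h)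
    case 0
    then have "h = E" by simp
    moreover have "E < E / M" using E assms(1,2) by (simp add: field_simps)
    ultimately have False if "h / M \<le> h'" "h' \<le> E" for h' using that by simp
    then show ?case using step[OF _ 0(2)] E \<open>h = E\<close> by blast
  next
    case (Suc n)
    then have 1: "0 < h" using E assms(1) by (intro less_le_trans[of 0 "E * M ^ Suc n" h]) auto
    have 2: "P h'" if "h / M \<le> h'" "h' \<le> E" for h'
    proof (rule Suc.IH[OF _ that(2)])
      have "E * M ^ n * M \<le> h" using Suc.prems(1) by (simp add: mult_ac)
      then have "E * M ^ n \<le> h / M" using assms(1) by (simp add: pos_le_divide_eq)
      then show "E * M ^ n \<le> h'" using that(1) by linarith
    qed
    show ?case by (rule step[OF 1 Suc.prems(2) 2])
  qed
  obtain n where "M ^ n < h / E"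
    using real_arch_pow_inv[of "h / E" M] assms(1,2,4) E by auto
  then have "E * M ^ n \<le> h" using E by (simp add: field_simps)
  then show ?thesis using * assms(5) by blast
qed

text \<open>A column is encoded as the full-height rectangle above its base.\<close>

definition col :: "rect \<Rightarrow> rect" where
  "col i = (px i, 0, wd i, 1)"

lemma col_simps [simp]: "px (col i) = px i" "py (col i) = 0" "wd (col i) = wd i" "ht (col i) = 1"
  by (simp_all add: col_def)

lemma fst_rect_map_col [simp]: "fst (rect_map (col i) p) = fst (rect_map i p)"
  by simp

text \<open>All that the recursion uses of a carpet: two rectangles have the same column or columns
  without common interior. Both classes have this property, and a grid keeps it when the axes are
  exchanged. The lower bound \<open>m\<close> of the sides is also the slack constant of the
  tiles.\<close>

locale column_system =
  fixes I :: "rect set" and F :: "(real \<times> real) set" and m M :: real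
  assumes finite_I: "finite I" and I_ne: "I \<noteq> {}"
    and m_pos: "0 < m" and M_less_1: "M < 1"
    and size: "\<And>i. i \<in> I \<Longrightarrow> m \<le> wd i \<and> wd i \<le> M \<and> m \<le> ht i \<and> ht i \<le> M"
    and unit: "\<And>i. i \<in> I \<Longrightarrow> unit_rect i"
    and F_ne: "F \<noteq> {}" and F_unit: "F \<subseteq> {0..1} \<times> {0..1}" and F_eq: "F = (\<Union>i\<in>I. rect_map i ` F)"
    and columns: "\<And>i j. i \<in> I \<Longrightarrow> j \<in> I \<Longrightarrow>
      px i = px j \<and> wd i = wd j \<or> px i + wd i \<le> px j \<or> px j + wd j \<le> px i"
    and column_apart: "\<And>i j. i \<in> I \<Longrightarrow> j \<in> I \<Longrightarrow> i \<noteq> j \<Longrightarrow> px i = px j \<Longrightarrow>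
      py i + ht i \<le> py j \<or> py j + ht j \<le> py i"
begin

lemma m_M: "m \<le> M" "m < 1" "0 < M"
  using size m_pos M_less_1 I_ne by force+

lemma pos [simp]: "i \<in> I \<Longrightarrow> 0 < wd i" "i \<in> I \<Longrightarrow> 0 < ht i"
  using size m_pos by fastforce+

lemma less_1: "i \<in> I \<Longrightarrow> wd i < 1" "i \<in> I \<Longrightarrow> ht i < 1"
  using size M_less_1 by fastforce+

abbreviation J :: "rect set" where "J \<equiv> col ` I"

definition column :: "rect \<Rightarrow> rect set" where
  "column j = {i \<in> I. col i = j}"

lemma finite_column [simp]: "finite (column j)"
  using finite_I by (simp add: column_def)

lemma columnD: "i \<in> column j \<Longrightarrow> i \<in> I" "i \<in> column j \<Longrightarrow> wd i = wd j" "i \<in> column j \<Longrightarrow> px i = px j"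
  by (auto simp: column_def)

lemma column_ne: "j \<in> J \<Longrightarrow> column j \<noteq> {}"
  by (auto simp: column_def)

lemma sum_columns: "(\<Sum>i\<in>I. f i) = (\<Sum>j\<in>J. \<Sum>i\<in>column j. f i)"
  unfolding column_def using finite_I by (intro sum.image_gen)

lemma unit_J: "j \<in> J \<Longrightarrow> unit_rect j"
  using unit unfolding unit_rect_def by fastforce

lemma size_J: "j \<in> J \<Longrightarrow> m \<le> wd j \<and> wd j \<le> M \<and> 0 < wd j \<and> ht j = 1"
  using size pos by (elim imageE) auto

lemma apart_J: "i \<in> J \<Longrightarrow> j \<in> J \<Longrightarrow> i \<noteq> j \<Longrightarrow> apart i j"
  using columns unfolding apart_def col_def by fastforce

lemma apart_I: "i \<in> I \<Longrightarrow> j \<in> I \<Longrightarrow> i \<noteq> j \<Longrightarrow> apart i j"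
  using columns[of i j] column_apart[of i j] unfolding apart_def by auto

lemma rect_map_F: "i \<in> I \<Longrightarrow> rect_map i ` F \<subseteq> F"
  using F_eq by blast

text \<open>The part of \<open>F\<close> whose addresses run through the columns of the word
  \<open>\<tau>\<close>, that is, \<open>F\<close> over a narrow vertical strip. An approximate
  square is the image of such a set under a word of maps.\<close>

primrec Fcol :: "rect list \<Rightarrow> (real \<times> real) set" where
  "Fcol [] = F"
| "Fcol (j # \<tau>) = (\<Union>i\<in>column j. rect_map i ` Fcol \<tau>)"

definition width :: "rect list \<Rightarrow> real" where
  "width \<tau> = prod_list (map wd \<tau>)"

lemma width_simps [simp]: "width [] = 1" "width (j # \<tau>) = wd j * width \<tau>"
  by (simp_all add: width_def)

lemma width_bounds: "\<tau> \<in> lists J \<Longrightarrow> 0 < width \<tau>" "\<tau> \<in> lists J \<Longrightarrow> width \<tau> \<le> 1"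
proof (induction \<tau> rule: list.induct)
  case (Cons j \<tau>)
  { case 1 then show ?case using Cons size_J by auto }
  { case 2 then show ?case using Cons size_J[of j] M_less_1 by (auto intro!: mult_le_one simp: less_imp_le) }
qed auto

lemma Fcol_subset: "Fcol \<tau> \<subseteq> F"
proof (induction \<tau> rule: list.induct)
  case (Cons j \<tau>)
  show ?case
  proof
    fix p assume "p \<in> Fcol (j # \<tau>)"
    then obtain i where "i \<in> column j" "p \<in> rect_map i ` Fcol \<tau>" unfolding Fcol.simps by blast
    then show "p \<in> F" using Cons rect_map_F[OF columnD(1)] by blast
  qed
qed simp

lemma Fcol_unit: "Fcol \<tau> \<subseteq> {0..1} \<times> {0..1}"
  using Fcol_subset F_unit by blast

lemma F_eq_columns: "F = (\<Union>j\<in>J. \<Union>i\<in>column j. rect_map i ` F)"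
  by (subst F_eq) (auto simp: column_def)

lemma fst_column_image:
  assumes "j \<in> J"
  shows "fst ` (\<Union>i\<in>column j. rect_map i ` A) = fst ` rect_map j ` A"
proof -
  have "fst ` rect_map i ` A = fst ` rect_map j ` A" if "i \<in> column j" for i
    using columnD(2,3)[OF that] by (simp add: image_image)
  then have "(\<Union>i\<in>column j. fst ` rect_map i ` A) = fst ` rect_map j ` A"
    using column_ne[OF assms] by auto
  then show ?thesis by (simp only: image_UN)
qed

text \<open>The projection of \<open>F\<close> is self-similar under the columns. The maps
  \<open>rect_map j\<close> leave heights unchanged, so this one-dimensional recursion can be run
  with the planar set \<open>F\<close> itself.\<close>

lemma fst_F: "fst ` F = fst ` (\<Union>j\<in>J. rect_map j ` F)"
proof -
  have "fst ` F = (\<Union>j\<in>J. fst ` (\<Union>i\<in>column j. rect_map i ` F))"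
    by (subst F_eq_columns) (simp only: image_UN)
  also have "\<dots> = (\<Union>j\<in>J. fst ` rect_map j ` F)"
    by (intro SUP_cong refl fst_column_image)
  finally show ?thesis by (simp only: image_UN)
qed

text \<open>The boxes grow until one side exceeds 1; the last division is by at least
  \<open>m\<close>, so both sides end up at most \<open>1 / m\<close>. The predicate
  \<open>A\<close> records what survives the divisions, such as \<open>h \<le> v\<close> when no
  rectangle is higher than wide. The induction runs on \<open>h\<close> and carries \<open>v\<close>
  along.\<close>

lemma affine_induct:
  assumes adm: "\<And>i h v. i \<in> I \<Longrightarrow> A h v \<Longrightarrow> A (h / wd i) (v / ht i)"
    and base: "\<And>h v. A h v \<Longrightarrow> 0 < h \<Longrightarrow> h \<le> 1 / m \<Longrightarrow> 0 < v \<Longrightarrow> v \<le> 1 / m \<Longrightarrow> 1 < h \<or> 1 < v \<Longrightarrow> P h v"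
    and step: "\<And>h v. 0 < h \<Longrightarrow> h \<le> 1 \<Longrightarrow> 0 < v \<Longrightarrow> v \<le> 1 \<Longrightarrow>
      (\<And>i. i \<in> I \<Longrightarrow> P (h / wd i) (v / ht i)) \<Longrightarrow> P h v"
    and "A h v" "0 < h" "h \<le> 1 / m" "0 < v" "v \<le> 1 / m"
  shows "P h v"
proof -
  have "\<forall>v. A h v \<and> 0 < v \<and> v \<le> 1 / m \<longrightarrow> P h v"
  proof (rule scale_induct[where M = M and E = "1 / m" and h = h])
    fix h assume h: "0 < h" "h \<le> 1 / m"
      and IH: "\<And>h'. h / M \<le> h' \<Longrightarrow> h' \<le> 1 / m \<Longrightarrow> \<forall>v. A h' v \<and> 0 < v \<and> v \<le> 1 / m \<longrightarrow> P h' v"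
    show "\<forall>v. A h v \<and> 0 < v \<and> v \<le> 1 / m \<longrightarrow> P h v"
    proof (intro allI impI)
      fix v assume v: "A h v \<and> 0 < v \<and> v \<le> 1 / m"
      show "P h v"
      proof (cases "1 < h \<or> 1 < v")
        case False
        show ?thesis
        proof (rule step)
          fix i assume i: "i \<in> I"
          have "h / M \<le> h / wd i" "h / wd i \<le> 1 / m" "v / ht i \<le> 1 / m"
            using size[OF i] pos[OF i] m_pos m_M h v False by (auto intro!: frac_le)
          then show "P (h / wd i) (v / ht i)"
            using IH adm i v pos[OF i] by auto
        qed (use h v False in auto)
      qed (use base h v in auto)
    qed
  qed (use m_M M_less_1 assms(5,6) in auto)
  then show ?thesis using assms by blast
qed

lemma column_induct:
  assumes base: "\<And>h. 1 < h \<Longrightarrow> h \<le> 1 / m \<Longrightarrow> P h"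
    and step: "\<And>h. 0 < h \<Longrightarrow> h \<le> 1 \<Longrightarrow> (\<And>j. j \<in> J \<Longrightarrow> P (h / wd j)) \<Longrightarrow> P h"
    and "0 < h" "h \<le> 1 / m"
  shows "P h"
proof -
  have "P h"
    if "0 < h" "h \<le> 1 / m" and IH: "\<And>h'. h / M \<le> h' \<Longrightarrow> h' \<le> 1 / m \<Longrightarrow> P h'" for h
  proof (cases "1 < h")
    case False
    have "P (h / wd j)" if "j \<in> J" for j
      using size_J[OF that] m_pos m_M False \<open>0 < h\<close> by (intro IH) (auto intro!: frac_le)
    then show ?thesis using step that False by auto
  qed (use base that in auto)
  then show ?thesis
    using scale_induct[where M = M and E = "1 / m" and h = h and P = P] m_M M_less_1 assms(3,4) by blast
qed

section \<open>Counting boxes for \<open>F\<close> and for its parts over strips\<close>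

lemma powr_scale:
  fixes x c s :: real
  assumes "0 < x" "0 < c"
  shows "(x / c) powr (-s) = x powr (-s) * c powr s"
  using assms by (simp add: powr_divide powr_minus field_simps)

lemma powr_lower: "0 \<le> s \<Longrightarrow> 0 < x \<Longrightarrow> x \<le> 1 / m \<Longrightarrow> m powr s \<le> x powr (-s)"
  using m_pos by (auto simp: powr_minus field_simps powr_mult[symmetric] intro!: powr_le1)

lemma cov_le: "cov A h v K \<Longrightarrow> K \<le> K' \<Longrightarrow> cov A h v K'"
  by (rule cov_mono[OF _ subset_refl order_refl order_refl])

lemma cov_one: "1 \<le> h \<Longrightarrow> 1 \<le> v \<Longrightarrow> 1 \<le> K \<Longrightarrow> A \<subseteq> {0..1} \<times> {0..1} \<Longrightarrow> cov A h v K"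
  unfolding cov_def by (intro exI[of _ "{(0, 0)}"]) (force simp: near_def)

text \<open>For \<open>v \<ge> 1\<close> the count is that of the self-similar projection. At the
  stopping scale \<open>1 < h \<le> 1 / m\<close> one box is enough, and \<open>m powr (-s)\<close>
  makes the bound at least 1 there.\<close>

lemma cov_F_flat:
  assumes "(\<Sum>j\<in>J. wd j powr s) \<le> 1" "0 \<le> s" "0 < h" "h \<le> 1 / m" "1 \<le> v"
  shows "cov F h v (m powr (-s) * h powr (-s))"
proof (rule column_induct[where P = "\<lambda>h. cov F h v (m powr (-s) * h powr (-s))", OF _ _ assms(3,4)])
  fix h assume h: "1 < h" "h \<le> 1 / m"
  then have "m powr (-s) * m powr s \<le> m powr (-s) * h powr (-s)"
    using assms(2) powr_lower by (intro mult_left_mono) auto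
  then have "1 \<le> m powr (-s) * h powr (-s)" using m_pos by (simp flip: powr_add)
  then show "cov F h v (m powr (-s) * h powr (-s))"
    using F_unit h assms(5) by (intro cov_one) auto
next
  fix h :: real assume h: "0 < h" "h \<le> 1"
    and IH: "\<And>j. j \<in> J \<Longrightarrow> cov F (h / wd j) v (m powr (-s) * (h / wd j) powr (-s))"
  have "(\<Sum>j\<in>J. m powr (-s) * (h / wd j) powr (-s)) = m powr (-s) * h powr (-s) * (\<Sum>j\<in>J. wd j powr s)"
    unfolding sum_distrib_left using h size_J by (intro sum.cong) (auto simp: powr_scale)
  also have "\<dots> \<le> m powr (-s) * h powr (-s) * 1"
    using assms(1) by (intro mult_left_mono) auto
  finally have "(\<Sum>j\<in>J. m powr (-s) * (h / wd j) powr (-s)) \<le> m powr (-s) * h powr (-s)" by simp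
  moreover have "cov (\<Union>j\<in>J. rect_map j ` F) h v (\<Sum>j\<in>J. m powr (-s) * (h / wd j) powr (-s))"
    using IH size_J by (intro cov_UN) (auto simp: finite_I)
  ultimately have "cov (\<Union>j\<in>J. rect_map j ` F) h v (m powr (-s) * h powr (-s))"
    by (rule cov_le[rotated])
  then show "cov F h v (m powr (-s) * h powr (-s))"
  proof (rule cov_flat[OF _ _ _ assms(5)])
    show "F \<subseteq> UNIV \<times> {0..1}" using F_unit by blast
  qed (simp only: fst_F)
qed

lemma pack_F_flat:
  assumes "1 \<le> (\<Sum>j\<in>J. wd j powr s)" "0 \<le> s" "0 < h" "h \<le> 1 / m" "1 \<le> v" "v \<le> 1 / m"
  shows "pack m F h v (h powr (-s))"
proof (rule column_induct[where P = "\<lambda>h. pack m F h v (h powr (-s))", OF _ _ assms(3,4)])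
  fix h assume h: "1 < h" "h \<le> 1 / m"
  then have "h powr (-s) \<le> 1"
    using assms(2) by (simp add: powr_minus field_simps ge_one_powr_ge_zero)
  then show "pack m F h v (h powr (-s))"
    using F_ne F_unit m_pos m_M h assms(5,6) by (intro pack_singleton) (auto simp: field_simps)
next
  fix h :: real assume h: "0 < h" "h \<le> 1"
    and IH: "\<And>j. j \<in> J \<Longrightarrow> pack m F (h / wd j) v ((h / wd j) powr (-s))"
  have "h powr (-s) * 1 \<le> h powr (-s) * (\<Sum>j\<in>J. wd j powr s)"
    using assms(1) by (intro mult_left_mono) auto
  also have "\<dots> = (\<Sum>j\<in>J. (h / wd j) powr (-s))"
    unfolding sum_distrib_left using h size_J by (intro sum.cong) (auto simp: powr_scale)
  finally have "h powr (-s) \<le> (\<Sum>j\<in>J. (h / wd j) powr (-s))" by simp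
  moreover have "pack m (\<Union>j\<in>J. rect_map j ` F) h v (\<Sum>j\<in>J. (h / wd j) powr (-s))"
    using IH size_J h m_pos assms(5) unit_J apart_J by (intro pack_UN) (auto simp: finite_I)
  ultimately have "pack m (\<Union>j\<in>J. rect_map j ` F) h v (h powr (-s))"
    by (rule pack_mono[OF _ subset_refl, rotated])
  then show "pack m F h v (h powr (-s))"
  proof (rule pack_flat[OF _ _ _ _ m_pos h(1)])
    show "F \<subseteq> UNIV \<times> {0..1}" using F_unit by blast
  qed (use fst_F assms(5) m_M in simp_all)
qed

text \<open>For \<open>v \<ge> 1\<close> only projections count, and that of
  \<open>Fcol \<tau>\<close> is the projection of \<open>F\<close> contracted by
  \<open>width \<tau>\<close>.\<close>

lemma cov_Fcol_flat:
  assumes "cov F h v K" "1 \<le> v" "\<tau> \<in> lists J"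
  shows "cov (Fcol \<tau>) (h * width \<tau>) v K"
  using assms(3)
proof (induction \<tau> rule: list.induct)
  case (Cons j \<tau>)
  then have j: "j \<in> J" by simp
  have "cov (Fcol \<tau>) (h * width \<tau>) v K" using Cons by simp
  then have "cov (\<Union>i\<in>{j}. rect_map i ` Fcol \<tau>) (h * width (j # \<tau>)) v (\<Sum>i\<in>{j}. K)"
    using size_J[OF j] by (intro cov_UN) auto
  then have "cov (rect_map j ` Fcol \<tau>) (h * width (j # \<tau>)) v K" by simp
  then show ?case
  proof (rule cov_flat[OF _ _ _ assms(2)])
    show "fst ` Fcol (j # \<tau>) \<subseteq> fst ` rect_map j ` Fcol \<tau>"
      unfolding Fcol.simps fst_column_image[OF j] ..
    show "Fcol (j # \<tau>) \<subseteq> UNIV \<times> {0..1}" using Fcol_unit[of "j # \<tau>"] by blast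
  qed
qed (use assms in auto)

lemma pack_Fcol_flat:
  assumes "pack m F h v K" "1 \<le> v" "\<tau> \<in> lists J" "0 < h"
  shows "pack m (Fcol \<tau>) (h * width \<tau>) v K"
  using assms(3)
proof (induction \<tau> rule: list.induct)
  case (Cons j \<tau>)
  then have j: "j \<in> J" by simp
  have w: "0 < width (j # \<tau>)" using width_bounds Cons.prems by blast
  have "pack m (Fcol \<tau>) (h * width \<tau>) v K" using Cons by simp
  then have "pack m (\<Union>i\<in>{j}. rect_map i ` Fcol \<tau>) (h * width (j # \<tau>)) v (\<Sum>i\<in>{j}. K)"
    using size_J[OF j] m_pos assms(2,4) w unit_J[OF j] by (intro pack_UN) auto
  then have "pack m (rect_map j ` Fcol \<tau>) (h * width (j # \<tau>)) v K" by simp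
  then show ?case
  proof (rule pack_flat[OF _ _ _ _ m_pos])
    show "fst ` rect_map j ` Fcol \<tau> \<subseteq> fst ` Fcol (j # \<tau>)"
      unfolding Fcol.simps fst_column_image[OF j] ..
    show "Fcol (j # \<tau>) \<subseteq> UNIV \<times> {0..1}" using Fcol_unit[of "j # \<tau>"] by blast
  qed (use assms(2,4) m_M w in auto)
qed (use assms in auto)

text \<open>Comparison principle: a function that dominates the count where the recursion stops, and
  is a supersolution of the recursion, dominates it everywhere. \<open>pack_F\<close> is the version
  for subsolutions.\<close>

lemma cov_F:
  assumes "\<And>i h v. i \<in> I \<Longrightarrow> A h v \<Longrightarrow> A (h / wd i) (v / ht i)"
    and "\<And>h v. A h v \<Longrightarrow> 0 < h \<Longrightarrow> h \<le> 1 / m \<Longrightarrow> 0 < v \<Longrightarrow> v \<le> 1 / m \<Longrightarrow> 1 < h \<or> 1 < v \<Longrightarrow>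
      cov F h v (\<Phi> h v)"
    and step: "\<And>h v. 0 < h \<Longrightarrow> 0 < v \<Longrightarrow> (\<Sum>i\<in>I. \<Phi> (h / wd i) (v / ht i)) \<le> \<Phi> h v"
    and "A h v" "0 < h" "h \<le> 1 / m" "0 < v" "v \<le> 1 / m"
  shows "cov F h v (\<Phi> h v)"
proof (rule affine_induct[where A = A and P = "\<lambda>h v. cov F h v (\<Phi> h v)"])
  fix h v :: real assume h: "0 < h" "0 < v"
    and IH: "\<And>i. i \<in> I \<Longrightarrow> cov F (h / wd i) (v / ht i) (\<Phi> (h / wd i) (v / ht i))"
  have "cov (\<Union>i\<in>I. rect_map i ` F) h v (\<Sum>i\<in>I. \<Phi> (h / wd i) (v / ht i))"
    using IH by (intro cov_UN) (auto simp: finite_I)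
  then show "cov F h v (\<Phi> h v)"
    using F_eq step[OF h] by (rule_tac cov_mono) auto
qed (use assms in blast)+

lemma pack_F:
  assumes "\<And>i h v. i \<in> I \<Longrightarrow> A h v \<Longrightarrow> A (h / wd i) (v / ht i)"
    and "\<And>h v. A h v \<Longrightarrow> 0 < h \<Longrightarrow> h \<le> 1 / m \<Longrightarrow> 0 < v \<Longrightarrow> v \<le> 1 / m \<Longrightarrow> 1 < h \<or> 1 < v \<Longrightarrow>
      pack m F h v (\<Psi> h v)"
    and step: "\<And>h v. 0 < h \<Longrightarrow> 0 < v \<Longrightarrow> \<Psi> h v \<le> (\<Sum>i\<in>I. \<Psi> (h / wd i) (v / ht i))"
    and "A h v" "0 < h" "h \<le> 1 / m" "0 < v" "v \<le> 1 / m"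
  shows "pack m F h v (\<Psi> h v)"
proof (rule affine_induct[where A = A and P = "\<lambda>h v. pack m F h v (\<Psi> h v)"])
  fix h v :: real assume h: "0 < h" "0 < v"
    and IH: "\<And>i. i \<in> I \<Longrightarrow> pack m F (h / wd i) (v / ht i) (\<Psi> (h / wd i) (v / ht i))"
  have "pack m (\<Union>i\<in>I. rect_map i ` F) h v (\<Sum>i\<in>I. \<Psi> (h / wd i) (v / ht i))"
    using IH h m_pos unit apart_I by (intro pack_UN) (auto simp: finite_I)
  then show "pack m F h v (\<Psi> h v)"
    using F_eq step[OF h] by (rule_tac pack_mono) auto
qed (use assms in blast)+

lemma apart_column: "i \<in> column j \<Longrightarrow> i' \<in> column j \<Longrightarrow> i \<noteq> i' \<Longrightarrow> apart i i'"
  using apart_I columnD by blast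

text \<open>Removing a column from the word divides the box width by \<open>wd j\<close>, exactly as
  \<open>width\<close> prescribes, so the relative width \<open>h\<close> stays fixed and only
  \<open>v\<close> grows. Hence the condition on \<open>\<Phi>\<close> is a sum over one column, in
  the variable \<open>v\<close> alone.\<close>

lemma cov_Fcol:
  assumes "J' \<subseteq> J"
    and cov: "\<And>h v. A h v \<Longrightarrow> 0 < h \<Longrightarrow> h \<le> 1 / m \<Longrightarrow> 0 < v \<Longrightarrow> v \<le> 1 / m \<Longrightarrow> cov F h v (\<Phi> h v)"
    and adm: "\<And>i h v. i \<in> I \<Longrightarrow> 0 < v \<Longrightarrow> A h v \<Longrightarrow> A h (v / ht i)"
    and step: "\<And>j h v. j \<in> J' \<Longrightarrow> 0 < h \<Longrightarrow> 0 < v \<Longrightarrow> (\<Sum>i\<in>column j. \<Phi> h (v / ht i)) \<le> \<Phi> h v"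
    and h: "0 < h" "h \<le> 1 / m"
    and "\<tau> \<in> lists J'" "A h v" "0 < v" "v \<le> 1 / m"
  shows "cov (Fcol \<tau>) (h * width \<tau>) v (\<Phi> h v)"
  using assms(7-)
proof (induction \<tau> arbitrary: v rule: list.induct)
  case Nil
  then show ?case using cov h by simp
next
  case (Cons j \<tau>)
  then have j: "j \<in> J'" by simp
  show ?case
  proof (cases "1 < v")
    case True
    then show ?thesis
      using Cons.prems assms(1) cov[of h v] h by (intro cov_Fcol_flat) (auto simp: lists_eq_set)
  next
    case False
    have "cov (Fcol \<tau>) (h * width (j # \<tau>) / wd i) (v / ht i) (\<Phi> h (v / ht i))" if "i \<in> column j" for i
    proof -
      have i: "i \<in> I" "wd i = wd j" using columnD[OF that] by auto
      have "v / ht i \<le> 1 / m"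
        using size[OF i(1)] False m_pos Cons.prems by (intro frac_le) auto
      then show ?thesis
        using Cons.IH[of "v / ht i"] Cons.prems adm[OF i(1)] pos[OF i(1)] i(2) by auto
    qed
    then have "cov (Fcol (j # \<tau>)) (h * width (j # \<tau>)) v (\<Sum>i\<in>column j. \<Phi> h (v / ht i))"
      unfolding Fcol.simps using columnD(1) by (intro cov_UN) auto
    then show ?thesis
      using step[OF j h(1) Cons.prems(3)] by (rule_tac cov_mono) auto
  qed
qed

lemma pack_Fcol:
  assumes pack: "\<And>h v. A h v \<Longrightarrow> 0 < h \<Longrightarrow> h \<le> 1 / m \<Longrightarrow> 0 < v \<Longrightarrow> v \<le> 1 / m \<Longrightarrow> pack m F h v (\<Psi> h v)"
    and adm: "\<And>i h v. i \<in> I \<Longrightarrow> 0 < v \<Longrightarrow> A h v \<Longrightarrow> A h (v / ht i)"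
    and step: "\<And>j h v. j \<in> J \<Longrightarrow> 0 < h \<Longrightarrow> 0 < v \<Longrightarrow> \<Psi> h v \<le> (\<Sum>i\<in>column j. \<Psi> h (v / ht i))"
    and h: "0 < h" "h \<le> 1 / m"
    and "\<tau> \<in> lists J" "A h v" "0 < v" "v \<le> 1 / m"
  shows "pack m (Fcol \<tau>) (h * width \<tau>) v (\<Psi> h v)"
  using assms(6-)
proof (induction \<tau> arbitrary: v rule: list.induct)
  case Nil
  then show ?case using pack h by simp
next
  case (Cons j \<tau>)
  then have j: "j \<in> J" by simp
  show ?case
  proof (cases "1 < v")
    case True
    then show ?thesis
      using Cons.prems pack[of h v] h by (intro pack_Fcol_flat) auto
  next
    case False
    have w: "0 < width (j # \<tau>)" using width_bounds Cons.prems by blast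
    have "pack m (Fcol \<tau>) (h * width (j # \<tau>) / wd i) (v / ht i) (\<Psi> h (v / ht i))" if "i \<in> column j" for i
    proof -
      have i: "i \<in> I" "wd i = wd j" using columnD[OF that] by auto
      have "v / ht i \<le> 1 / m"
        using size[OF i(1)] False m_pos Cons.prems by (intro frac_le) auto
      then show ?thesis
        using Cons.IH[of "v / ht i"] Cons.prems adm[OF i(1)] pos[OF i(1)] i(2) by auto
    qed
    then have "pack m (Fcol (j # \<tau>)) (h * width (j # \<tau>)) v (\<Sum>i\<in>column j. \<Psi> h (v / ht i))"
      unfolding Fcol.simps using columnD(1) unit apart_column w h m_pos Cons.prems
      by (intro pack_UN) auto
    then show ?thesis
      using step[OF j h(1) Cons.prems(3)] by (rule_tac pack_mono) auto
  qed
qed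

section \<open>Decompositions of \<open>F\<close> into approximate squares\<close>

definition decomposes :: "((real \<times> real) set \<Rightarrow> bool) \<Rightarrow> real \<Rightarrow> real \<Rightarrow> bool" where
  "decomposes N h v \<longleftrightarrow> (\<exists>Q. tiles m h v Q \<and> \<Union>(fst ` Q) = F \<and> (\<forall>(B, g)\<in>Q. N B))"

lemma decomposes_mono: "decomposes N h v \<Longrightarrow> (\<And>B. N B \<Longrightarrow> N' B) \<Longrightarrow> decomposes N' h v"
  unfolding decomposes_def by (elim exE conjE, intro exI conjI, assumption) auto

lemma decomposes_trivial:
  assumes "N F" "m \<le> h" "m \<le> v" "h \<le> 1 / m" "v \<le> 1 / m"
  shows "decomposes N h v"
  unfolding decomposes_def
  using tiles_singleton[OF F_ne F_unit m_pos assms(2,3)] assms m_pos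
  by (intro exI[of _ "{(F, (0, 0))}"]) (auto simp: pos_le_divide_eq mult.commute)

text \<open>For boxes at least as high as the unit square the pieces are whole strips. Columns are
  appended until the strip width is within the factor \<open>m\<close> of \<open>h\<close>.\<close>

lemma decomposes_columns:
  assumes v: "1 \<le> v" "v \<le> 1 / m" and "0 < h" "h \<le> 1"
  shows "decomposes (\<lambda>B. \<exists>\<tau>\<in>lists J. B = Fcol \<tau> \<and> h \<le> width \<tau> \<and> m * width \<tau> \<le> h) h v"
proof (rule scale_induct[where M = M and E = 1 and h = h])
  let ?N = "\<lambda>h B. \<exists>\<tau>\<in>lists J. B = Fcol \<tau> \<and> h \<le> width \<tau> \<and> m * width \<tau> \<le> h"
  fix h :: real assume h: "0 < h" "h \<le> 1"
    and IH: "\<And>h'. h / M \<le> h' \<Longrightarrow> h' \<le> 1 \<Longrightarrow> decomposes (?N h') h' v"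
  show "decomposes (?N h) h v"
  proof (cases "m \<le> h")
    case True
    then show ?thesis
      using h v m_M m_pos
      by (intro decomposes_trivial bexI[of _ "[]"]) (auto simp: pos_le_divide_eq intro: order_trans[of _ 1] mult_le_one)
  next
    case False
    have "\<exists>Q. tiles m (h / wd j) v Q \<and> \<Union>(fst ` Q) = F \<and> (\<forall>(B, g)\<in>Q. ?N (h / wd j) B)" if "j \<in> J" for j
    proof -
      have "h / M \<le> h / wd j" "h / wd j \<le> 1"
        using size_J[OF that] m_M m_pos h False by (auto intro!: frac_le simp: field_simps)
      then show ?thesis using IH unfolding decomposes_def by blast
    qed
    then have "\<exists>Q. \<forall>j\<in>J. tiles m (h / wd j) v (Q j) \<and> \<Union>(fst ` Q j) = F \<and> (\<forall>(B, g)\<in>Q j. ?N (h / wd j) B)"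
      by (intro bchoice ballI)
    then obtain Q where Q0: "\<forall>j\<in>J.
        tiles m (h / wd j) v (Q j) \<and> \<Union>(fst ` Q j) = F \<and> (\<forall>(B, g)\<in>Q j. ?N (h / wd j) B)" ..
    have Q: "tiles m (h / wd j) v (Q j)" "\<Union>(fst ` Q j) = F" "(B, g) \<in> Q j \<Longrightarrow> ?N (h / wd j) B"
      if "j \<in> J" for j B g
      using bspec[OF Q0 that] by blast+
    \<comment> \<open>The corner moves by the single map \<open>rect_map j\<close>, whereas the set
      is spread over all rectangles of the column. As \<open>v / m \<ge> 1\<close>, the heights of
      its points are unrestricted within the unit square.\<close>
    define f where "f j B = (\<Union>i\<in>column j. rect_map i ` B)" for j B
    let ?R = "\<Union>j\<in>J. (\<lambda>(B, g). (f j B, rect_map j g)) ` Q j"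
    have f: "f j B \<noteq> {} \<and> f j B \<subseteq> near (h / m) (v / m) (rect_map j g)" if j: "j \<in> J" "(B, g) \<in> Q j" for j B g
    proof
      note T = tilesD[OF Q(1)[OF j(1)] j(2)]
      show "f j B \<noteq> {}" unfolding f_def using T(1) column_ne[OF j(1)] by auto
      show "f j B \<subseteq> near (h / m) (v / m) (rect_map j g)"
      proof
        fix p assume p: "p \<in> f j B"
        then obtain i b where b: "i \<in> column j" "b \<in> B" "p = rect_map i b" unfolding f_def by blast
        have "b \<in> near (h / m / wd j) (v / m) g" using T(2) b(2) by (auto simp: field_simps)
        then have "rect_map j b \<in> near (h / m) (v / m) (rect_map j g)"
          using near_rect_map[of j "h / m" "v / m" g] size_J[OF j(1)] by auto
        then have "\<bar>fst p - fst (rect_map j g)\<bar> \<le> h / m"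
          using columnD[OF b(1)] b(3) by (simp add: near_def)
        moreover have "b \<in> F" using Q(2)[OF j(1)] j(2) b(2) by force
        then have "p \<in> F" using rect_map_F[OF columnD(1)[OF b(1)]] b(3) by blast
        then have "p \<in> {0..1} \<times> {0..1}" using F_unit by blast
        then have "snd p \<in> {0..1}" by (simp add: mem_Times_iff)
        moreover have "snd g \<in> {0..1}" "snd (rect_map j g) = snd g"
          using T(5,6) m_pos v j(1) by (auto intro: order_trans[of _ "snd g + m * v"])
        moreover have "1 \<le> v / m" using v m_M m_pos by (simp add: field_simps)
        ultimately show "p \<in> near (h / m) (v / m) (rect_map j g)"
          unfolding near_def by fastforce
      qed
    qed
    have "tiles m h v ?R"
      using Q(1) size_J h v m_pos unit_J apart_J f by (intro tiles_UN) (auto simp: finite_I)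
    moreover have "\<Union>(fst ` ?R) = F"
    proof -
      have "\<Union>(fst ` ?R) = (\<Union>j\<in>J. \<Union>i\<in>column j. rect_map i ` \<Union>(fst ` Q j))"
        unfolding f_def by fastforce
      also have "\<dots> = F" using Q(2) F_eq_columns by simp
      finally show ?thesis .
    qed
    moreover have "?N h (f j B)" if j: "j \<in> J" "(B, g) \<in> Q j" for j B g
    proof -
      obtain \<tau> where \<tau>: "\<tau> \<in> lists J" "B = Fcol \<tau>" "h / wd j \<le> width \<tau>" "m * width \<tau> \<le> h / wd j"
        using Q(3)[OF j] by blast
      then show ?thesis
        using j(1) size_J[OF j(1)] unfolding f_def by (intro bexI[of _ "j # \<tau>"]) (auto simp: field_simps)
    qed
    ultimately show ?thesis
      unfolding decomposes_def by (intro exI[of _ ?R] conjI) fast+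
  qed
qed (use m_M M_less_1 assms in auto)

lemma decomposes_F:
  assumes adm: "\<And>i h v. i \<in> I \<Longrightarrow> A h v \<Longrightarrow> A (h / wd i) (v / ht i)"
    and base: "\<And>h v. A h v \<Longrightarrow> 0 < h \<Longrightarrow> h \<le> 1 / m \<Longrightarrow> 0 < v \<Longrightarrow> v \<le> 1 / m \<Longrightarrow> 1 < h \<or> 1 < v \<Longrightarrow>
      decomposes (\<lambda>B. N B h v) h v"
    and N: "\<And>i B h v. i \<in> I \<Longrightarrow> 0 < h \<Longrightarrow> 0 < v \<Longrightarrow> N B (h / wd i) (v / ht i) \<Longrightarrow> N (rect_map i ` B) h v"
    and "A h v" "0 < h" "h \<le> 1 / m" "0 < v" "v \<le> 1 / m"
  shows "decomposes (\<lambda>B. N B h v) h v"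
proof (rule affine_induct[where A = A and P = "\<lambda>h v. decomposes (\<lambda>B. N B h v) h v"])
  fix h v :: real assume h: "0 < h" "0 < v"
    and IH: "\<And>i. i \<in> I \<Longrightarrow> decomposes (\<lambda>B. N B (h / wd i) (v / ht i)) (h / wd i) (v / ht i)"
  then have "\<exists>Q. \<forall>i\<in>I. tiles m (h / wd i) (v / ht i) (Q i) \<and> \<Union>(fst ` Q i) = F \<and>
      (\<forall>(B, g)\<in>Q i. N B (h / wd i) (v / ht i))"
    unfolding decomposes_def by (intro bchoice ballI)
  then obtain Q where Q0: "\<forall>i\<in>I. tiles m (h / wd i) (v / ht i) (Q i) \<and> \<Union>(fst ` Q i) = F \<and>
      (\<forall>(B, g)\<in>Q i. N B (h / wd i) (v / ht i))" ..
  have Q: "tiles m (h / wd i) (v / ht i) (Q i)" "\<Union>(fst ` Q i) = F"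
     "(B, g) \<in> Q i \<Longrightarrow> N B (h / wd i) (v / ht i)" if "i \<in> I" for i B g
    using bspec[OF Q0 that] by blast+
  let ?R = "\<Union>i\<in>I. (\<lambda>(B, g). (rect_map i ` B, rect_map i g)) ` Q i"
  have f: "rect_map i ` B \<noteq> {} \<and> rect_map i ` B \<subseteq> near (h / m) (v / m) (rect_map i g)"
    if "i \<in> I" "(B, g) \<in> Q i" for i B g
    using tilesD(1,2)[OF Q(1)[OF that(1)] that(2)] near_rect_map[of i "h / m" "v / m" g] pos[OF that(1)]
    by (force simp: field_simps)
  have "tiles m h v ?R"
    by (rule tiles_UN(1)[where f = "\<lambda>i B. rect_map i ` B"]) (use h m_pos finite_I unit apart_I Q(1) f in blast)+
  moreover have "\<Union>(fst ` ?R) = F"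
  proof -
    have "\<Union>(fst ` ?R) = (\<Union>i\<in>I. rect_map i ` \<Union>(fst ` Q i))" by fastforce
    also have "\<dots> = F" using Q(2) F_eq by simp
    finally show ?thesis .
  qed
  moreover have "\<forall>(B, g)\<in>?R. N B h v"
    using Q(3) N h by fast
  ultimately show "decomposes (\<lambda>B. N B h v) h v"
    unfolding decomposes_def by blast
qed (use assms in blast)+

end

definition box_regular :: "'a::euclidean_space set \<Rightarrow> real \<Rightarrow> bool" where
  "box_regular E D \<longleftrightarrow> (\<exists>c C. 0 < c \<and> 0 < C \<and> (\<forall>r. 0 < r \<and> r \<le> 1 \<longrightarrow>
     c * r powr (-D) \<le> real (covering_number r E) \<and> real (covering_number r E) \<le> C * r powr (-D)))"

text \<open>
  \<open>B\<close> has dimension \<open>D\<close> at all scales below the \<open>h \<times> v\<close> boxes. Measuring with boxes proportional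
  to \<open>h \<times> v\<close> makes this invariant under the maps of the system.
\<close>

definition scaling :: "real \<Rightarrow> real \<Rightarrow> real \<Rightarrow> real \<Rightarrow> (real \<times> real) set \<Rightarrow> real \<Rightarrow> real \<Rightarrow> bool" where
  "scaling m C c D B h v \<longleftrightarrow> (\<forall>r. 0 < r \<and> r \<le> m \<longrightarrow>
     cov B (r * h) (r * v) (C * r powr (-D)) \<and> pack m B (r * h) (r * v) (c * r powr (-D)))"

lemma scalingI:
  assumes "\<And>r. 0 < r \<Longrightarrow> r \<le> m \<Longrightarrow> cov B (r * h) (r * v) (C * r powr (-D))"
    "\<And>r. 0 < r \<Longrightarrow> r \<le> m \<Longrightarrow> pack m B (r * h) (r * v) (c * r powr (-D))"
  shows "scaling m C c D B h v"
  using assms unfolding scaling_def by blast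

lemma scalingD:
  assumes "scaling m C c D B h v" "0 < r" "r \<le> m"
  shows "cov B (r * h) (r * v) (C * r powr (-D))" "pack m B (r * h) (r * v) (c * r powr (-D))"
  using assms unfolding scaling_def by blast+

lemma scaling_rect_map:
  assumes "unit_rect i" "0 < m" "0 < h" "0 < v" "scaling m C c D B (h / wd i) (v / ht i)"
  shows "scaling m C c D (rect_map i ` B) h v"
proof (rule scalingI)
  fix r assume r: "0 < r" "r \<le> m"
  have i: "0 < wd i" "0 < ht i" using assms(1) by (auto simp: unit_rect_def)
  show "cov (rect_map i ` B) (r * h) (r * v) (C * r powr (-D))"
    using cov_UN[of "{i}" "\<lambda>_. B" "r * h" "r * v" "\<lambda>_. C * r powr (-D)"] scalingD(1)[OF assms(5) r] i by simp
  show "pack m (rect_map i ` B) (r * h) (r * v) (c * r powr (-D))"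
    using pack_UN[of m "r * h" "r * v" "{i}" "\<lambda>_. B" "\<lambda>_. c * r powr (-D)"] scalingD(2)[OF assms(5) r] assms r by simp
qed

context column_system
begin

section \<open>From boxes and tiles to covering numbers\<close>

lemma bounded_F: "bounded F"
proof (rule bounded_subset[OF _ F_unit])
  show "bounded ({0..1::real} \<times> {0..1::real})" by (intro bounded_Times) auto
qed

lemma box_regularI:
  assumes "0 < c" "0 < C" "0 \<le> D"
    and cov: "\<And>r. 0 < r \<Longrightarrow> r \<le> 1 \<Longrightarrow> cov F r r (C * r powr (-D))"
    and pack: "\<And>r. 0 < r \<Longrightarrow> r \<le> 1 \<Longrightarrow> pack m F r r (c * r powr (-D))"
  shows "box_regular F D"
proof -
  obtain k :: nat where k: "2 / m\<^sup>2 \<le> real k" using real_arch_simple by blast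
  let ?K = "real ((2 * k + 1)\<^sup>2)"
  have K: "0 < ?K" by simp
  have "c / ?K * r powr (-D) \<le> real (covering_number r F) \<and>
     real (covering_number r F) \<le> C * 4 powr D * r powr (-D)" if "0 < r" "r \<le> 1" for r
  proof
    have "c * r powr (-D) \<le> ?K * real (covering_number r F)"
      using covering_number_ge_pack[OF pack[OF that] m_pos _ that(1) k bounded_F] m_M by simp
    then show "c / ?K * r powr (-D) \<le> real (covering_number r F)"
      using K by (simp add: pos_divide_le_eq mult.commute)
    have "real (covering_number r F) \<le> C * (r / 4) powr (-D)"
      using cov[of "r / 4"] that by (intro covering_number_le_cov) auto
    then show "real (covering_number r F) \<le> C * 4 powr D * r powr (-D)"
      using that by (simp add: powr_scale mult_ac)
  qed
  then show ?thesis
    unfolding box_regular_def using assms(1,2) K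
    by (intro exI[of _ "c / ?K"] exI[of _ "C * 4 powr D"]) simp
qed

text \<open>From above, a ball of radius \<open>R\<close> meets boundedly many tiles of scale
  \<open>R\<close>; from below, it contains the tile of a slightly smaller scale through its
  centre.\<close>

lemma homogeneousI:
  assumes "0 < c" "0 < C" "0 \<le> D"
    and dec: "\<And>R. 0 < R \<Longrightarrow> R \<le> 1 \<Longrightarrow> decomposes (\<lambda>B. scaling m C c D B R R) R R"
  shows "homogeneous F D"
proof -
  obtain k :: nat where k: "2 / m\<^sup>2 \<le> real k" using real_arch_simple by blast
  define K where "K = real ((2 * k + 1)\<^sup>2)"
  have K: "0 < K" unfolding K_def by simp
  define c' where "c' = min (c * (m / 4) powr D / K) ((m\<^sup>2 / 4) powr D)"
  have c': "0 < c'" using assms(1) m_pos K unfolding c'_def by simp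
  define C' where "C' = K * C * (m / 4) powr (-D)"
  have C': "0 < C'" using assms(2) m_pos K unfolding C'_def by simp
  have upper: "real (covering_number r (cball x R \<inter> F)) \<le> C' * (R / r) powr D"
    if r: "0 < r" "r < R" "R \<le> 1" "x \<in> F" for r R x
  proof -
    have R: "0 < R" using r by linarith
    obtain Q where Q: "tiles m R R Q" "\<Union>(fst ` Q) = F" "\<And>B g. (B, g) \<in> Q \<Longrightarrow> scaling m C c D B R R"
      using dec[OF R r(3)] unfolding decomposes_def by blast
    define Q' where "Q' = {q \<in> Q. \<exists>b\<in>fst q. dist x b \<le> R}"
    have fin: "finite Q'" using Q(1) unfolding tiles_def Q'_def by auto
    have "card Q' \<le> (2 * k + 1)\<^sup>2"
    proof (rule tiles_meeting_card_le[OF tiles_subset[OF Q(1)] m_pos _ R k])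
      show "\<exists>b\<in>B. dist x b \<le> R" if "(B, g) \<in> Q'" for B g using that unfolding Q'_def by auto
    qed (use m_M in \<open>auto simp: Q'_def\<close>)
    then have card: "real (card Q') \<le> K" unfolding K_def by (rule of_nat_mono)
    \<comment> \<open>The relative scale has to be at most \<open>m\<close> for
      \<open>scaling\<close>, and \<open>q * R\<close> at most \<open>r / 4\<close> for boxes inside
      covering sets; both follow from \<open>r < R\<close> and \<open>m < 1\<close>.\<close>
    define q where "q = m * r / (4 * R)"
    have q: "0 < q" "q \<le> m" "q * R = m * r / 4"
      using m_pos r R unfolding q_def by (auto simp: field_simps)
    have cv: "cov (fst p) (q * R) (q * R) (C * q powr (-D))" if "p \<in> Q'" for p
      using scalingD(1)[OF Q(3)[of "fst p" "snd p"] q(1,2)] that unfolding Q'_def by simp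
    have c1: "cov (\<Union>p\<in>Q'. fst p) (q * R) (q * R) (real (card Q') * (C * q powr (-D)))"
      by (rule cov_Union[OF fin cv])
    have c2: "cball x R \<inter> F \<subseteq> (\<Union>p\<in>Q'. fst p)"
    proof
      fix b assume b: "b \<in> cball x R \<inter> F"
      then obtain p where "p \<in> Q" "b \<in> fst p" using Q(2) by blast
      then have "p \<in> Q'" using b unfolding Q'_def by auto
      then show "b \<in> (\<Union>p\<in>Q'. fst p)" using \<open>b \<in> fst p\<close> by blast
    qed
    have c3: "q * R \<le> r / 4" using q(3) m_M m_pos r by simp
    have c4: "real (card Q') * (C * q powr (-D)) \<le> K * (C * q powr (-D))"
      using card assms(2) by (intro mult_right_mono) auto
    have "cov (cball x R \<inter> F) (r / 4) (r / 4) (K * (C * q powr (-D)))"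
      by (rule cov_mono[OF c1 c2 c3 c3 c4])
    then have "real (covering_number r (cball x R \<inter> F)) \<le> K * (C * q powr (-D))"
      using r by (intro covering_number_le_cov)
    also have "q = (m / 4) / (R / r)" using r R unfolding q_def by (simp add: field_simps)
    also have "((m / 4) / (R / r)) powr (-D) = (m / 4) powr (-D) * (R / r) powr D"
      using m_pos r R by (intro powr_scale) auto
    finally show ?thesis unfolding C'_def by (simp add: mult_ac)
  qed
  have lower: "c' * (R / r) powr D \<le> real (covering_number r (cball x R \<inter> F))"
    if r: "0 < r" "r < R" "R \<le> 1" "x \<in> F" for r R x
  proof -
    have R: "0 < R" using r by linarith
    \<comment> \<open>A tile of scale \<open>R'\<close> lies in a box with half-sides
      \<open>R' / m = R / 4\<close>, hence in a ball of radius \<open>R / 2\<close>, and so in every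
      ball of radius \<open>R\<close> about one of its points.\<close>
    define R' where "R' = m * R / 4"
    have R': "0 < R'" "R' \<le> 1" "R' / m = R / 4"
      using m_pos m_M R r mult_le_one[of m R] unfolding R'_def by auto
    obtain Q where Q: "tiles m R' R' Q" "\<Union>(fst ` Q) = F" "\<And>B g. (B, g) \<in> Q \<Longrightarrow> scaling m C c D B R' R'"
      using dec[OF R'(1,2)] unfolding decomposes_def by blast
    obtain B g where B: "(B, g) \<in> Q" "x \<in> B" using Q(2) r(4) by auto
    have "B \<subseteq> near (R' / m) (R' / m) g" by (rule tilesD(2)[OF Q(1) B(1)])
    then have "B \<subseteq> ball g (R / 2)" using near_subset_ball[OF R, of g] R'(3) by auto
    have "B \<subseteq> cball x R"
    proof
      fix b assume "b \<in> B"
      then have "dist g x < R / 2" "dist g b < R / 2"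
        using \<open>B \<subseteq> ball g (R / 2)\<close> B(2) by (auto simp: subset_eq)
      then show "b \<in> cball x R" using dist_triangle_half_r[of g x R b] by simp
    qed
    then have BF: "B \<subseteq> cball x R \<inter> F" using Q(2) B(1) by force
    have bdd: "bounded (cball x R \<inter> F)" by (intro bounded_Int) auto
    show ?thesis
    proof (cases "r \<le> m * R'")
      case True
      define q where "q = r / R'"
      have q: "0 < q" "q \<le> m" "q * R' = r" using True r(1) R' unfolding q_def by (auto simp: pos_divide_le_eq)
      have "pack m B r r (c * q powr (-D))" using scalingD(2)[OF Q(3)[OF B(1)] q(1,2)] q(3) by simp
      then have "c * q powr (-D) \<le> K * real (covering_number r B)"
        unfolding K_def using m_pos m_M r k bounded_subset[OF bdd BF] by (intro covering_number_ge_pack) auto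
      also have "\<dots> \<le> K * real (covering_number r (cball x R \<inter> F))"
        using covering_number_mono[OF BF bdd r(1)] K by simp
      finally have "c * q powr (-D) / K \<le> real (covering_number r (cball x R \<inter> F))"
        using K by (simp add: pos_divide_le_eq mult.commute)
      moreover have "q powr (-D) = (m / 4) powr D * (R / r) powr D"
      proof -
        have "q powr (-D) = (R' / r) powr D"
          using r R' unfolding q_def by (simp add: powr_minus powr_divide)
        also have "R' / r = (m / 4) * (R / r)" unfolding R'_def by simp
        also have "((m / 4) * (R / r)) powr D = (m / 4) powr D * (R / r) powr D"
          by (rule powr_mult)
        finally show ?thesis .
      qed
      moreover have "c' * (R / r) powr D \<le> c * (m / 4) powr D / K * (R / r) powr D"
        unfolding c'_def by (intro mult_right_mono) auto
      ultimately show ?thesis by simp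
    next
      case False
      \<comment> \<open>Here \<open>R / r\<close> is bounded, and the trivial fact that at least one
        covering set is needed suffices.\<close>
      then have "(m\<^sup>2 / 4) * (R / r) \<le> 1"
        using r unfolding R'_def by (simp add: field_simps power2_eq_square)
      then have "((m\<^sup>2 / 4) * (R / r)) powr D \<le> 1"
        using m_pos r R assms(3) by (intro powr_le1) auto
      then have "(m\<^sup>2 / 4) powr D * (R / r) powr D \<le> 1"
        using m_pos r R powr_mult[of "m\<^sup>2 / 4" "R / r" D] by simp
      moreover have "c' * (R / r) powr D \<le> (m\<^sup>2 / 4) powr D * (R / r) powr D"
        unfolding c'_def by (intro mult_right_mono) auto
      moreover have "x \<in> cball x R \<inter> F" using r R by simp
      then have "1 \<le> covering_number r (cball x R \<inter> F)"
        using r(1) bdd by (intro covering_number_pos) blast+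
      ultimately show ?thesis by linarith
    qed
  qed
  show ?thesis
    unfolding homogeneous_def using c' C' upper lower by blast
qed

lemma powr_comparable:
  assumes "0 \<le> s" "0 < r" "m * r \<le> h"
  shows "h powr (-s) \<le> m powr (-s) * r powr (-s)"
    and "h \<le> r / m \<Longrightarrow> m powr s * r powr (-s) \<le> h powr (-s)"
proof -
  have h: "0 < h" using assms m_pos by (intro less_le_trans[of 0 "m * r" h]) auto
  have "h powr (-s) \<le> (m * r) powr (-s)"
    using assms m_pos by (intro powr_mono2') auto
  then show "h powr (-s) \<le> m powr (-s) * r powr (-s)"
    using assms m_pos by (simp add: powr_mult)
  assume "h \<le> r / m"
  then have "(r / m) powr (-s) \<le> h powr (-s)"
    using assms h by (intro powr_mono2') auto
  then show "m powr s * r powr (-s) \<le> h powr (-s)"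
    using assms m_pos by (simp add: powr_scale mult.commute)
qed

text \<open>When the recursion has stopped with \<open>v > 1\<close>, the pieces are strips of width
  comparable to \<open>h\<close>, or \<open>F\<close> itself if also \<open>h > 1\<close>. Relative
  to its strip, a box shrunk by \<open>r\<close> has both sides comparable to \<open>r\<close>, so
  \<open>\<Phi>\<close> and \<open>\<Psi>\<close> reduce to multiples of
  \<open>r powr (-D)\<close>.\<close>

lemma column_base_decomposes:
  assumes cov: "\<And>\<tau> h v. \<tau> \<in> lists J \<Longrightarrow> A h v \<Longrightarrow> 0 < h \<Longrightarrow> h \<le> 1 / m \<Longrightarrow> 0 < v \<Longrightarrow> v \<le> 1 / m \<Longrightarrow>
      cov (Fcol \<tau>) (h * width \<tau>) v (\<Phi> h v)"
    and pack: "\<And>\<tau> h v. \<tau> \<in> lists J \<Longrightarrow> A h v \<Longrightarrow> 0 < h \<Longrightarrow> h \<le> 1 / m \<Longrightarrow> 0 < v \<Longrightarrow> v \<le> 1 / m \<Longrightarrow>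
      pack m (Fcol \<tau>) (h * width \<tau>) v (\<Psi> h v)"
    and A_scale: "\<And>h v r. A h v \<Longrightarrow> 0 < r \<Longrightarrow> A (r * h) (r * v)"
    and A_le: "\<And>h v. h \<le> v \<Longrightarrow> A h v"
    and \<Phi>: "\<And>r h v. 0 < r \<Longrightarrow> m * r \<le> h \<Longrightarrow> h \<le> r / m \<Longrightarrow> m * r \<le> v \<Longrightarrow> v \<le> r / m \<Longrightarrow>
      \<Phi> h v \<le> C * r powr (-D)"
    and \<Psi>: "\<And>r h v. 0 < r \<Longrightarrow> m * r \<le> h \<Longrightarrow> h \<le> r / m \<Longrightarrow> m * r \<le> v \<Longrightarrow> v \<le> r / m \<Longrightarrow>
      c * r powr (-D) \<le> \<Psi> h v"
    and h: "0 < h" "h \<le> 1 / m" and v: "1 < v" "v \<le> 1 / m" and A: "A h v"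
  shows "decomposes (\<lambda>B. scaling m C c D B h v) h v"
proof -
  have scaling: "scaling m C c D (Fcol \<tau>) h v"
    if \<tau>: "\<tau> \<in> lists J" "m * width \<tau> \<le> h" and w: "h \<le> width \<tau> \<or> 1 < h \<and> \<tau> = []" for \<tau>
  proof -
    have w0: "0 < width \<tau>" using width_bounds \<tau>(1) by blast
    have *: "cov (Fcol \<tau>) (r * h) (r * v) (C * r powr (-D)) \<and>
       pack m (Fcol \<tau>) (r * h) (r * v) (c * r powr (-D))" if r: "0 < r" "r \<le> m" for r
    proof -
      \<comment> \<open>The box width relative to the strip, which is the variable of
        \<open>\<Phi>\<close> and \<open>\<Psi>\<close>.\<close>
      define h' where "h' = r * h / width \<tau>"
      have h': "h' * width \<tau> = r * h" "0 < h'" using w0 r h unfolding h'_def by auto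
      have lo: "m * r \<le> h'"
      proof -
        have "r * (m * width \<tau>) \<le> r * h" using \<tau>(2) r by (intro mult_left_mono) auto
        then show ?thesis using w0 unfolding h'_def by (simp add: pos_le_divide_eq mult_ac)
      qed
      have rm: "r \<le> r / m" using r m_pos m_M by (simp add: pos_le_divide_eq)
      have hi: "h' \<le> r / m \<and> A h' (r * v)"
        using w
      proof
        assume "h \<le> width \<tau>"
        then have "h' \<le> r" using w0 r unfolding h'_def by (simp add: pos_divide_le_eq)
        moreover have "r \<le> r * v" using r v by simp
        ultimately show ?thesis using rm A_le by auto
      next
        assume "1 < h \<and> \<tau> = []"
        then show ?thesis using A_scale[OF A r(1)] r h(2) m_pos
          unfolding h'_def by (auto simp: field_simps)
      qed
      have s': "m * r \<le> r * v" "r * v \<le> r / m" "0 < r * v"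
      proof -
        have "m * r \<le> 1 * r" using m_M r by (intro mult_right_mono) auto
        also have "1 * r \<le> r * v" using r v by simp
        finally show "m * r \<le> r * v" .
        have "r * v \<le> r * (1 / m)" using v r by (intro mult_left_mono) auto
        then show "r * v \<le> r / m" by simp
      qed (use r v in auto)
      have "r / m \<le> 1" using r m_pos by simp
      moreover have "1 \<le> 1 / m" using m_pos m_M by simp
      ultimately have "h' \<le> 1 / m" "r * v \<le> 1 / m" using hi s' by linarith+
      then have "cov (Fcol \<tau>) (r * h) (r * v) (\<Phi> h' (r * v))" "pack m (Fcol \<tau>) (r * h) (r * v) (\<Psi> h' (r * v))"
        using cov[OF \<tau>(1) _ h'(2)] pack[OF \<tau>(1) _ h'(2)] hi s'(3) h'(1) by metis+
      then show ?thesis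
        using \<Phi>[OF r(1) lo _ s'(1,2)] \<Psi>[OF r(1) lo _ s'(1,2)] hi
        by (blast intro: cov_le pack_mono)
    qed
    then show ?thesis by (intro scalingI) blast+
  qed
  show ?thesis
  proof (cases "h \<le> 1")
    case True
    show ?thesis
      by (rule decomposes_mono[OF decomposes_columns[OF _ v(2) h(1) True]]) (use v scaling in auto)
  next
    case False
    then have "scaling m C c D F h v" using scaling[of "[]"] m_M by auto
    then show ?thesis using False h v m_M by (intro decomposes_trivial) auto
  qed
qed

end

section \<open>The exact solution of the recursion\<close>

locale column_exponents = column_system +
  fixes s t :: real
  assumes s_nonneg: "0 \<le> s" and t_nonneg: "0 \<le> t"
    and sum_s: "(\<Sum>j\<in>J. wd j powr s) = 1"
    and sum_t: "(\<Sum>i\<in>I. wd i powr s * ht i powr t) = 1"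
begin

lemma cov_base_general:
  assumes u: "0 \<le> u" and *: "0 < h" "h \<le> 1 / m" "1 \<le> v" "v \<le> 1 / m"
  shows "cov F h v (m powr (-s-u) * (h powr (-s) * v powr (-u)))"
proof (rule cov_le[OF cov_F_flat[OF _ s_nonneg *(1-3)]])
  have "m powr (-s) * h powr (-s) = m powr (-s-u) * (h powr (-s) * m powr u)"
    using m_pos by (simp add: powr_diff powr_minus)
  also have "\<dots> \<le> m powr (-s-u) * (h powr (-s) * v powr (-u))"
    using powr_lower[OF u, of v] * by (intro mult_left_mono) auto
  finally show "m powr (-s) * h powr (-s) \<le> m powr (-s-u) * (h powr (-s) * v powr (-u))" .
qed (simp add: sum_s)

lemmas cov_base = cov_base_general[OF t_nonneg]

lemma pack_base:
  assumes "0 < h" "h \<le> 1 / m" "1 \<le> v" "v \<le> 1 / m"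
  shows "pack m F h v (h powr (-s) * v powr (-t))"
proof (rule pack_mono[OF pack_F_flat[OF _ s_nonneg assms] subset_refl])
  have "v powr (-t) \<le> 1"
    using assms(3) t_nonneg by (simp add: powr_minus ge_one_powr_ge_zero field_simps)
  then show "h powr (-s) * v powr (-t) \<le> h powr (-s)" by (simp add: mult_left_le)
qed (simp add: sum_s)

lemma sum_I_scale:
  assumes "0 < h" "0 < v"
  shows "(\<Sum>i\<in>I. (h / wd i) powr (-s) * (v / ht i) powr (-t)) = h powr (-s) * v powr (-t)"
proof -
  have "(\<Sum>i\<in>I. (h / wd i) powr (-s) * (v / ht i) powr (-t)) =
      (\<Sum>i\<in>I. h powr (-s) * v powr (-t) * (wd i powr s * ht i powr t))"
    using assms by (intro sum.cong) (auto simp: powr_scale)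
  also have "\<dots> = h powr (-s) * v powr (-t)"
    by (simp add: sum_distrib_left[symmetric] sum_t)
  finally show ?thesis .
qed

lemma sum_column_scale:
  assumes "0 < v"
  shows "(\<Sum>i\<in>column j. K * (v / ht i) powr (-u)) = K * v powr (-u) * (\<Sum>i\<in>column j. ht i powr u)"
  unfolding sum_distrib_left using assms columnD(1) by (intro sum.cong) (auto simp: powr_scale)

lemma step_comparable:
  assumes "0 < r" "m * r \<le> h" "h \<le> r / m" "m * r \<le> v" "v \<le> r / m"
  shows "h powr (-s) * v powr (-t) \<le> m powr (-s-t) * r powr (-(s + t))"
    and "m powr (s + t) * r powr (-(s + t)) \<le> h powr (-s) * v powr (-t)"
proof -
  have "h powr (-s) * v powr (-t) \<le> (m powr (-s) * r powr (-s)) * (m powr (-t) * r powr (-t))"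
    using powr_comparable(1)[OF s_nonneg assms(1,2)] powr_comparable(1)[OF t_nonneg assms(1,4)]
    by (intro mult_mono) auto
  also have "\<dots> = m powr (-s-t) * r powr (-(s + t))"
  proof -
    have "x powr (-s-t) = x powr (-s) * x powr (-t)" "x powr (-(s + t)) = x powr (-s) * x powr (-t)" for x :: real
      by (simp_all add: powr_add[symmetric])
    then show ?thesis by simp
  qed
  finally show "h powr (-s) * v powr (-t) \<le> m powr (-s-t) * r powr (-(s + t))" .
  have "(m powr s * r powr (-s)) * (m powr t * r powr (-t)) \<le> h powr (-s) * v powr (-t)"
    using powr_comparable(2)[OF s_nonneg assms(1-3)] powr_comparable(2)[OF t_nonneg assms(1,4,5)]
    by (intro mult_mono) auto
  moreover have "(m powr s * r powr (-s)) * (m powr t * r powr (-t)) = m powr (s + t) * r powr (-(s + t))"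
  proof -
    have "m powr (s + t) = m powr s * m powr t" "r powr (-(s + t)) = r powr (-s) * r powr (-t)"
      by (simp_all add: powr_add[symmetric])
    then show ?thesis by simp
  qed
  ultimately show "m powr (s + t) * r powr (-(s + t)) \<le> h powr (-s) * v powr (-t)" by simp
qed

end

locale flat_column_exponents = column_exponents +
  assumes flat: "\<And>i. i \<in> I \<Longrightarrow> ht i \<le> wd i"
begin

text \<open>Rectangles no higher than wide preserve \<open>h \<le> v\<close>. The recursion
  therefore always stops with \<open>v > 1\<close>, where columns alone decide.\<close>

lemma le_step: "i \<in> I \<Longrightarrow> 0 < h \<and> h \<le> v \<Longrightarrow> 0 < h / wd i \<and> h / wd i \<le> v / ht i"
  using flat[of i] by (auto intro: frac_le)

lemma cov_F_le:
  assumes "0 < h" "h \<le> v" "v \<le> 1 / m"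
  shows "cov F h v (m powr (-s-t) * (h powr (-s) * v powr (-t)))"
proof (rule cov_F[where A = "\<lambda>h v. 0 < h \<and> h \<le> v"])
  show "(\<Sum>i\<in>I. m powr (-s-t) * ((h / wd i) powr (-s) * (v / ht i) powr (-t)))
     \<le> m powr (-s-t) * (h powr (-s) * v powr (-t))" if "0 < h" "0 < v" for h v
    using sum_I_scale[OF that] by (simp add: sum_distrib_left[symmetric])
qed (use assms le_step cov_base in auto)

lemma pack_F_le:
  assumes "0 < h" "h \<le> v" "v \<le> 1 / m"
  shows "pack m F h v (h powr (-s) * v powr (-t))"
proof (rule pack_F[where A = "\<lambda>h v. 0 < h \<and> h \<le> v"])
  show "h powr (-s) * v powr (-t) \<le> (\<Sum>i\<in>I. (h / wd i) powr (-s) * (v / ht i) powr (-t))"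
    if "0 < h" "0 < v" for h v
    using sum_I_scale[OF that] by simp
qed (use assms le_step pack_base in auto)

lemma one_le: "1 \<le> 1 / m"
  using m_pos m_M by simp

theorem box_regular_F: "box_regular F (s + t)"
proof (rule box_regularI[where c = 1 and C = "m powr (-s-t)"])
  fix r :: real assume r: "0 < r" "r \<le> 1"
  have "r powr (-s) * r powr (-t) = r powr (-(s + t))"
    by (simp add: powr_add[symmetric])
  then show "cov F r r (m powr (-s-t) * r powr (-(s + t)))" "pack m F r r (1 * r powr (-(s + t)))"
    using cov_F_le[of r r] pack_F_le[of r r] r one_le by auto
qed (use s_nonneg t_nonneg m_pos in auto)

theorem homogeneous_F:
  assumes uniform: "\<And>j. j \<in> J \<Longrightarrow> (\<Sum>i\<in>column j. ht i powr t) = 1"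
  shows "homogeneous F (s + t)"
\<comment> \<open>One factor \<open>m powr (-s-t)\<close> comes from the covering bound, the other
  from replacing \<open>h\<close> and \<open>v\<close> by the comparable \<open>r\<close>.\<close>
proof (rule homogeneousI[where C = "m powr (-s-t) * m powr (-s-t)" and c = "m powr (s + t)"])
  let ?A = "\<lambda>h v :: real. h \<le> v"
  let ?\<Phi> = "\<lambda>h v. m powr (-s-t) * (h powr (-s) * v powr (-t))"
  let ?\<Psi> = "\<lambda>h v. h powr (-s) * v powr (-t)"
  have adm: "h \<le> v / ht i" if "i \<in> I" "0 < v" "h \<le> v" for i h v
  proof -
    have "v \<le> v / ht i" using that less_1[OF that(1)] pos[OF that(1)] by (simp add: pos_le_divide_eq mult_left_le)
    then show ?thesis using that by linarith
  qed
  fix R :: real assume R: "0 < R" "R \<le> 1"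
  show "decomposes (\<lambda>B. scaling m (m powr (-s-t) * m powr (-s-t)) (m powr (s + t)) (s + t) B R R) R R"
  proof (rule decomposes_F[where A = "\<lambda>h v. 0 < h \<and> h \<le> v" and
        N = "scaling m (m powr (-s-t) * m powr (-s-t)) (m powr (s + t)) (s + t)"])
    fix h v :: real
    assume 1: "0 < h \<and> h \<le> v" "h \<le> 1 / m" "0 < v" "v \<le> 1 / m" "1 < h \<or> 1 < v"
    show "decomposes (\<lambda>B. scaling m (m powr (-s-t) * m powr (-s-t)) (m powr (s + t)) (s + t) B h v) h v"
    proof (rule column_base_decomposes[where A = ?A and \<Phi> = ?\<Phi> and \<Psi> = ?\<Psi>])
      fix \<tau> and h v :: real
      assume *: "\<tau> \<in> lists J" "h \<le> v" "0 < h" "h \<le> 1 / m" "0 < v" "v \<le> 1 / m"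
      show "cov (Fcol \<tau>) (h * width \<tau>) v (?\<Phi> h v)"
      proof (rule cov_Fcol[where A = ?A and J' = J])
        show "(\<Sum>i\<in>column j. m powr (-s-t) * (h powr (-s) * (v / ht i) powr (-t)))
            \<le> m powr (-s-t) * (h powr (-s) * v powr (-t))"
          if "j \<in> J" "0 < h" "0 < v" for j h v
          using sum_column_scale[OF that(3), of "m powr (-s-t) * h powr (-s)" t j] uniform[OF that(1)] by (simp add: mult_ac)
      qed (use * adm cov_F_le in auto)
      show "pack m (Fcol \<tau>) (h * width \<tau>) v (?\<Psi> h v)"
      proof (rule pack_Fcol[where A = ?A])
        show "h powr (-s) * v powr (-t) \<le> (\<Sum>i\<in>column j. h powr (-s) * (v / ht i) powr (-t))"
          if "j \<in> J" "0 < h" "0 < v" for j h v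
          using sum_column_scale[OF that(3), of "h powr (-s)" t j] uniform[OF that(1)] by simp
      qed (use * adm pack_F_le in auto)
    next
      fix r h v :: real
      assume *: "0 < r" "m * r \<le> h" "h \<le> r / m" "m * r \<le> v" "v \<le> r / m"
      show "?\<Phi> h v \<le> m powr (-s-t) * m powr (-s-t) * r powr (-(s + t))"
        using mult_left_mono[OF step_comparable(1)[OF *], of "m powr (-s-t)"] by (simp add: mult.assoc)
      show "m powr (s + t) * r powr (-(s + t)) \<le> ?\<Psi> h v"
        by (rule step_comparable(2)[OF *])
    qed (use 1 m_pos in auto)
  next
    fix i B h v
    assume "i \<in> I" "0 < h" "0 < v"
      "scaling m (m powr (-s-t) * m powr (-s-t)) (m powr (s + t)) (s + t) B (h / wd i) (v / ht i)"
    then show "scaling m (m powr (-s-t) * m powr (-s-t)) (m powr (s + t)) (s + t) (rect_map i ` B) h v"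
      using unit m_pos by (intro scaling_rect_map)
  qed (use R one_le le_step in auto)
qed (use s_nonneg t_nonneg m_pos in auto)

end

section \<open>Exchanging the coordinates\<close>

definition swap_rect :: "rect \<Rightarrow> rect" where
  "swap_rect i = (py i, px i, ht i, wd i)"

lemma swap_rect_simps [simp]:
  "px (swap_rect i) = py i" "py (swap_rect i) = px i" "wd (swap_rect i) = ht i" "ht (swap_rect i) = wd i"
  "swap_rect (swap_rect i) = i"
  by (simp_all add: swap_rect_def)

lemma swap_rect_image [simp]: "swap_rect ` swap_rect ` I = I"
  by (simp add: image_image)

lemma swap_image [simp]: "prod.swap ` prod.swap ` A = A"
  by (simp add: image_image)

lemma inj_on_swap_rect [simp]: "inj_on swap_rect A"
  by (rule inj_on_inverseI[where g = swap_rect]) simp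

lemma rect_map_swap_rect: "rect_map (swap_rect i) (prod.swap p) = prod.swap (rect_map i p)"
  by (simp add: rect_map_conv)

lemma near_swap: "prod.swap ` near h v g = near v h (prod.swap g)"
  by (force simp: near_def image_iff)

lemma cov_swapI:
  assumes "cov A h v K"
  shows "cov (prod.swap ` A) v h K"
proof -
  obtain G where G: "finite G" "real (card G) \<le> K" "A \<subseteq> (\<Union>g\<in>G. near h v g)"
    using assms unfolding cov_def by blast
  have "prod.swap ` A \<subseteq> (\<Union>g\<in>G. prod.swap ` near h v g)"
    using G(3) by (metis image_UN image_mono)
  then have "prod.swap ` A \<subseteq> (\<Union>g\<in>prod.swap ` G. near v h g)"
    by (simp add: near_swap)
  moreover have "card (prod.swap ` G) = card G"
    by (intro card_image) simp
  ultimately show ?thesis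
    unfolding cov_def using G(1,2) by (intro exI[of _ "prod.swap ` G"]) simp
qed

lemma cov_swap: "cov (prod.swap ` A) v h K \<longleftrightarrow> cov A h v K"
  using cov_swapI[of A h v K] cov_swapI[of "prod.swap ` A" v h K] by auto

definition swap_tile :: "(real \<times> real) set \<times> (real \<times> real) \<Rightarrow> (real \<times> real) set \<times> (real \<times> real)" where
  "swap_tile q = (prod.swap ` fst q, prod.swap (snd q))"

lemma swap_tile_swap_tile [simp]: "swap_tile (swap_tile q) = q"
  by (simp add: swap_tile_def)

lemma card_swap_tile [simp]: "card (swap_tile ` Q) = card Q"
  by (intro card_image inj_on_inverseI[where g = swap_tile]) simp

lemma tiles_swap:
  assumes "tiles m h v Q"
  shows "tiles m v h (swap_tile ` Q)"
  unfolding tiles_def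
proof (intro conjI ballI impI)
  show "finite (swap_tile ` Q)" using assms unfolding tiles_def by blast
next
  fix p assume "p \<in> swap_tile ` Q"
  then obtain B g where q: "(B, g) \<in> Q" "p = swap_tile (B, g)" by auto
  note T = tilesD[OF assms q(1)]
  have "prod.swap ` B \<subseteq> near (v / m) (h / m) (prod.swap g)"
    using image_mono[OF T(2), of prod.swap] by (simp add: near_swap)
  then show "case p of (B, g) \<Rightarrow> B \<noteq> {} \<and> B \<subseteq> near (v / m) (h / m) g \<and>
     0 \<le> fst g \<and> fst g + m * v \<le> 1 \<and> 0 \<le> snd g \<and> snd g + m * h \<le> 1"
    using q(2) T by (simp add: swap_tile_def)
next
  fix p q assume "p \<in> swap_tile ` Q" "q \<in> swap_tile ` Q" "p \<noteq> q"
  then obtain p' q' where p': "p' \<in> Q" "p = swap_tile p'" "q' \<in> Q" "q = swap_tile q'" "p' \<noteq> q'" by blast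
  then have "m * h \<le> \<bar>fst (snd p') - fst (snd q')\<bar> \<or> m * v \<le> \<bar>snd (snd p') - snd (snd q')\<bar>"
    using assms unfolding tiles_def by blast
  then show "m * v \<le> \<bar>fst (snd p) - fst (snd q)\<bar> \<or> m * h \<le> \<bar>snd (snd p) - snd (snd q)\<bar>"
    using p' by (auto simp: swap_tile_def)
qed

lemma pack_swapI:
  assumes "pack m A h v K"
  shows "pack m (prod.swap ` A) v h K"
proof -
  obtain Q where Q: "tiles m h v Q" "\<forall>(B, g)\<in>Q. B \<subseteq> A" "K \<le> real (card Q)"
    using assms unfolding pack_def by blast
  have "\<forall>(B, g)\<in>swap_tile ` Q. B \<subseteq> prod.swap ` A"
    using Q(2) unfolding swap_tile_def by (auto simp: case_prod_beta)
  then show ?thesis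
    unfolding pack_def using tiles_swap[OF Q(1)] Q(3) by (intro exI[of _ "swap_tile ` Q"]) simp
qed

lemma pack_swap: "pack m (prod.swap ` A) v h K \<longleftrightarrow> pack m A h v K"
  using pack_swapI[of m A h v K] pack_swapI[of m "prod.swap ` A" v h K] by auto

lemma scaling_swap: "scaling m C c D (prod.swap ` B) v h \<longleftrightarrow> scaling m C c D B h v"
  unfolding scaling_def cov_swap pack_swap ..

lemma dist_swap: "dist (prod.swap p) (prod.swap q) = dist p q" for p q :: "real \<times> real"
  by (simp add: dist_prod_def add.commute)

lemma covering_number_swap_le:
  fixes E :: "(real \<times> real) set"
  assumes "bounded E" "0 < r"
  shows "covering_number r (prod.swap ` E) \<le> covering_number r E"
proof -
  obtain \<U> where \<U>: "open_cover r E \<U>" "card \<U> = covering_number r E"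
    using covering_number_attained[OF assms] .
  have "open (prod.swap ` U) \<and> bounded (prod.swap ` U) \<and> diameter (prod.swap ` U) \<le> r"
    if U: "U \<in> \<U>" for U
  proof (intro conjI)
    have o: "open U" "bounded U" "diameter U \<le> r" using \<U>(1) U unfolding open_cover_def by auto
    show "open (prod.swap ` U)"
    proof -
      have "prod.swap ` U = prod.swap -` U" by force
      moreover have "open (prod.swap -` U)"
        using o(1) by (intro open_vimage continuous_on_swap)
      ultimately show ?thesis by simp
    qed
    have d: "dist a b \<le> diameter U" if ab: "a \<in> prod.swap ` U" "b \<in> prod.swap ` U" for a b
    proof -
      obtain a' b' where "a' \<in> U" "b' \<in> U" "a = prod.swap a'" "b = prod.swap b'" using ab by blast
      then show ?thesis using diameter_bounded_bound[OF o(2)] by (simp add: dist_swap del: swap_simp)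
    qed
    show "bounded (prod.swap ` U)"
    proof (cases "U = {}")
      case False
      then obtain u where "u \<in> U" by blast
      then have "prod.swap ` U \<subseteq> cball (prod.swap u) (diameter U)"
        unfolding subset_eq mem_cball using d by blast
      then show ?thesis using bounded_cball bounded_subset by blast
    qed simp
    show "diameter (prod.swap ` U) \<le> r"
    proof -
      have "diameter (prod.swap ` U) \<le> diameter U"
        using diameter_ge_0[OF o(2)] d[unfolded dist_norm] by (intro diameter_le) blast+
      then show ?thesis using o(3) by linarith
    qed
  qed
  moreover have "finite \<U>" "E \<subseteq> \<Union>\<U>" using \<U>(1) unfolding open_cover_def by auto
  moreover from this have "prod.swap ` E \<subseteq> \<Union>((`) prod.swap ` \<U>)" by blast
  ultimately have "open_cover r (prod.swap ` E) ((`) prod.swap ` \<U>)"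
    unfolding open_cover_def by simp
  then have "covering_number r (prod.swap ` E) \<le> card ((`) prod.swap ` \<U>)"
    by (rule covering_number_le_card)
  also have "\<dots> \<le> card \<U>" using \<U>(1) unfolding open_cover_def by (intro card_image_le) auto
  finally show ?thesis using \<U>(2) by simp
qed

lemma bounded_swap:
  fixes E :: "(real \<times> real) set"
  assumes "bounded E"
  shows "bounded (prod.swap ` E)"
proof -
  obtain x e where "\<forall>y\<in>E. dist x y \<le> e" using assms unfolding bounded_def by blast
  then show ?thesis unfolding bounded_def by (intro exI[of _ "prod.swap x"] exI[of _ e]) (auto simp: dist_swap)
qed

lemma covering_number_swap:
  fixes E :: "(real \<times> real) set"
  assumes "bounded E" "0 < r"
  shows "covering_number r (prod.swap ` E) = covering_number r E"
  using covering_number_swap_le[OF assms] covering_number_swap_le[OF bounded_swap[OF assms(1)] assms(2)] by simp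

lemma cball_swap: "cball (prod.swap x) R \<inter> prod.swap ` E = prod.swap ` (cball x R \<inter> E)" for x :: "real \<times> real"
proof -
  have "prod.swap y \<in> cball (prod.swap x) R \<longleftrightarrow> y \<in> cball x R" for y
    unfolding mem_cball dist_swap ..
  then show ?thesis by blast
qed

lemma covering_number_cball_swap:
  fixes E :: "(real \<times> real) set"
  assumes "0 < r"
  shows "covering_number r (cball (prod.swap x) R \<inter> prod.swap ` E) = covering_number r (cball x R \<inter> E)"
  unfolding cball_swap using assms by (intro covering_number_swap bounded_Int) auto

lemma homogeneous_swap:
  fixes E :: "(real \<times> real) set"
  shows "homogeneous (prod.swap ` E) D \<longleftrightarrow> homogeneous E D"
proof -
  have *: "(\<forall>r R x. 0 < r \<and> r < R \<and> R \<le> 1 \<and> x \<in> A \<longrightarrow> Q r R x) \<longleftrightarrow>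
      (\<forall>r R. 0 < r \<longrightarrow> r < R \<and> R \<le> 1 \<longrightarrow> (\<forall>x\<in>A. Q r R x))" for A :: "(real \<times> real) set" and Q
    by blast
  show ?thesis
    unfolding homogeneous_def * ball_simps(9)
    by (simp add: covering_number_cball_swap del: swap_simp cong: imp_cong)
qed

lemma lower_dim_swap:
  fixes E :: "(real \<times> real) set"
  shows "lower_dim (prod.swap ` E) = lower_dim E"
proof -
  have "(\<forall>x\<in>prod.swap ` E. real (covering_number r (cball x R \<inter> prod.swap ` E)) \<ge> K) \<longleftrightarrow>
     (\<forall>x\<in>E. real (covering_number r (cball x R \<inter> E)) \<ge> K)" if "0 < r" for r R K
    using covering_number_cball_swap[OF that] by (simp del: swap_simp)
  then show ?thesis
    unfolding lower_dim_def by (intro arg_cong[where f = Sup] Collect_cong ex_cong1 conj_cong all_cong1 imp_cong) auto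
qed

lemma box_regular_swap:
  fixes E :: "(real \<times> real) set"
  assumes "bounded E"
  shows "box_regular (prod.swap ` E) D \<longleftrightarrow> box_regular E D"
  unfolding box_regular_def using covering_number_swap[OF assms] by (simp cong: conj_cong imp_cong)

section \<open>Grids\<close>

locale grid_exponents =
  X: column_exponents I F m M s t + Y: column_exponents "swap_rect ` I" "prod.swap ` F" m M s' t'
  for I F m M s t s' t'
begin

lemma grid_exponents_swap: "grid_exponents (swap_rect ` I) (prod.swap ` F) m M s' t' s t"
  unfolding grid_exponents_def using X.column_exponents_axioms Y.column_exponents_axioms by simp

abbreviation row :: "rect \<Rightarrow> rect" where "row i \<equiv> col (swap_rect i)"

lemma eq_of_col_row: "col i = col j \<Longrightarrow> row i = row j \<Longrightarrow> i = j"
  by (cases i; cases j) (auto simp: col_def swap_rect_def)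

text \<open>In a grid the rectangles of one column lie in distinct rows, so this is part of the sum
  over all rows, which is 1.\<close>

lemma sum_column_le: "(\<Sum>i\<in>X.column j. ht i powr s') \<le> 1"
proof -
  have "(\<Sum>i\<in>X.column j. ht i powr s') = (\<Sum>i\<in>X.column j. wd (row i) powr s')" by simp
  also have "\<dots> = (\<Sum>k\<in>row ` X.column j. wd k powr s')"
  proof (rule sum.reindex_cong[OF _ refl refl, symmetric])
    show "inj_on row (X.column j)"
    proof (rule inj_onI)
      fix i i' assume "i \<in> X.column j" "i' \<in> X.column j" "row i = row i'"
      then show "i = i'" using eq_of_col_row[of i i'] unfolding X.column_def by simp
    qed
  qed
  also have "\<dots> \<le> (\<Sum>k\<in>Y.J. wd k powr s')"
    using Y.finite_I by (intro sum_mono2) (auto simp: X.column_def)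
  finally show ?thesis using Y.sum_s by simp
qed

text \<open>
  The resulting inequality \<open>t \<le> s'\<close> keeps the lower bound \<open>h powr (-s) * v powr (-t)\<close> valid where
  the recursion stops because the boxes have become too wide.
\<close>

lemma sum_grid_le: "(\<Sum>i\<in>I. wd i powr s * ht i powr s') \<le> 1"
proof -
  have "(\<Sum>i\<in>I. wd i powr s * ht i powr s') = (\<Sum>j\<in>X.J. \<Sum>i\<in>X.column j. wd i powr s * ht i powr s')"
    by (rule X.sum_columns)
  also have "\<dots> = (\<Sum>j\<in>X.J. wd j powr s * (\<Sum>i\<in>X.column j. ht i powr s'))"
    unfolding sum_distrib_left using X.columnD(2) by (intro sum.cong) auto
  also have "\<dots> \<le> (\<Sum>j\<in>X.J. wd j powr s * 1)"
    using sum_column_le by (intro sum_mono mult_left_mono) auto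
  finally show ?thesis using X.sum_s by simp
qed

lemma t_le: "t \<le> s'"
proof (rule ccontr)
  assume "\<not> t \<le> s'"
  then have "(\<Sum>i\<in>I. wd i powr s * ht i powr t) < (\<Sum>i\<in>I. wd i powr s * ht i powr s')"
  proof (intro sum_strict_mono X.finite_I X.I_ne)
    fix i assume i: "i \<in> I"
    have "ht i powr t < ht i powr s'"
      using X.pos[OF i] X.less_1[OF i] \<open>\<not> t \<le> s'\<close> by (intro powr_less_mono') auto
    then show "wd i powr s * ht i powr t < wd i powr s * ht i powr s'"
      using X.pos[OF i] by (intro mult_strict_left_mono) auto
  qed
  then show False using sum_grid_le X.sum_t by simp
qed

lemma sum_swap_t: "(\<Sum>i\<in>I. ht i powr s' * wd i powr t') = 1"
  using Y.sum_t by (simp add: sum.reindex)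

section \<open>Counting boxes in a grid\<close>

lemma cov_row_base:
  assumes "1 \<le> h" "h \<le> 1 / m" "0 < v" "v \<le> 1 / m"
  shows "cov F h v (m powr (-s'-t') * (v powr (-s') * h powr (-t')))"
  using Y.cov_base[OF assms(3,4,1,2)] cov_swap by blast

text \<open>When the recursion stops with \<open>h \<ge> 1\<close>, the true count is of order
  \<open>v powr (-s')\<close>. For \<open>v \<le> 1\<close> it dominates \<open>v powr (-t)\<close>
  by \<open>t \<le> s'\<close>; for \<open>1 < v \<le> 1 / m\<close> the factor
  \<open>m powr s'\<close> covers the difference.\<close>

lemma pack_row_base:
  assumes "1 \<le> h" "h \<le> 1 / m" "0 < v" "v \<le> 1 / m"
  shows "pack m F h v (m powr s' * (h powr (-s) * v powr (-t)))"
proof -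
  have "pack m (prod.swap ` F) v h (v powr (-s'))"
    by (rule Y.pack_F_flat) (use Y.sum_s Y.s_nonneg assms in auto)
  then have "pack m F h v (v powr (-s'))" by (simp add: pack_swap)
  moreover have "m powr s' * (h powr (-s) * v powr (-t)) \<le> v powr (-s')"
  proof -
    have 1: "h powr (-s) \<le> 1"
      using assms(1) X.s_nonneg by (simp add: powr_minus ge_one_powr_ge_zero field_simps)
    have "m powr s' * (h powr (-s) * v powr (-t)) \<le> m powr s' * (1 * v powr (-t))"
      using 1 by (intro mult_left_mono mult_right_mono) auto
    also have "\<dots> \<le> v powr (-s')"
    proof (cases "v \<le> 1")
      case True
      then have "v powr (-t) \<le> v powr (-s')" using t_le assms(3) by (intro powr_mono') auto
      moreover have "m powr s' \<le> 1" using X.m_pos X.m_M Y.s_nonneg by (intro powr_le1) auto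
      ultimately show ?thesis by (auto intro: order_trans[OF mult_left_le_one_le])
    next
      case False
      then have "v powr (-t) \<le> 1"
        using X.t_nonneg by (simp add: powr_minus ge_one_powr_ge_zero field_simps)
      then have "m powr s' * (1 * v powr (-t)) \<le> m powr s'" by (simp add: mult_left_le)
      also have "\<dots> \<le> v powr (-s')" by (rule X.powr_lower[OF Y.s_nonneg assms(3,4)])
      finally show ?thesis .
    qed
    finally show ?thesis .
  qed
  ultimately show ?thesis by (rule pack_mono[OF _ subset_refl])
qed

definition C\<^sub>0 :: real where "C\<^sub>0 = m powr (-s-t) + m powr (-s'-t')"

lemma C\<^sub>0_ge: "m powr (-s-t) \<le> C\<^sub>0" "m powr (-s'-t') \<le> C\<^sub>0" "0 < C\<^sub>0"
  using X.m_pos unfolding C\<^sub>0_def by (auto intro: add_pos_pos)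

text \<open>Each summand solves the recursion. The first dominates the count when the recursion
  stops with \<open>v > 1\<close>, the second when it stops with \<open>h > 1\<close>.\<close>

abbreviation \<Phi> :: "real \<Rightarrow> real \<Rightarrow> real" where
  "\<Phi> h v \<equiv> C\<^sub>0 * (h powr (-s) * v powr (-t)) + C\<^sub>0 * (v powr (-s') * h powr (-t'))"

abbreviation \<Psi> :: "real \<Rightarrow> real \<Rightarrow> real" where
  "\<Psi> h v \<equiv> m powr s' * (h powr (-s) * v powr (-t))"

lemma cov_grid:
  assumes "0 < h" "h \<le> 1 / m" "0 < v" "v \<le> 1 / m"
  shows "cov F h v (\<Phi> h v)"
proof (rule X.cov_F[where A = "\<lambda>_ _. True" and \<Phi> = \<Phi>])
  fix h v :: real
  assume *: "0 < h" "h \<le> 1 / m" "0 < v" "v \<le> 1 / m" "1 < h \<or> 1 < v"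
  have nn: "0 \<le> h powr (-s) * v powr (-t)" "0 \<le> v powr (-s') * h powr (-t')" by auto
  from *(5) show "cov F h v (\<Phi> h v)"
  proof
    assume "1 < h"
    then have "cov F h v (m powr (-s'-t') * (v powr (-s') * h powr (-t')))"
      using cov_row_base * by simp
    moreover have "m powr (-s'-t') * (v powr (-s') * h powr (-t')) \<le> C\<^sub>0 * (v powr (-s') * h powr (-t'))"
      by (rule mult_right_mono[OF C\<^sub>0_ge(2) nn(2)])
    ultimately show ?thesis
      using mult_nonneg_nonneg[OF less_imp_le[OF C\<^sub>0_ge(3)] nn(1)] by (elim X.cov_le) linarith
  next
    assume "1 < v"
    then have "cov F h v (m powr (-s-t) * (h powr (-s) * v powr (-t)))"
      using X.cov_base * by simp
    moreover have "m powr (-s-t) * (h powr (-s) * v powr (-t)) \<le> C\<^sub>0 * (h powr (-s) * v powr (-t))"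
      by (rule mult_right_mono[OF C\<^sub>0_ge(1) nn(1)])
    ultimately show ?thesis
      using mult_nonneg_nonneg[OF less_imp_le[OF C\<^sub>0_ge(3)] nn(2)] by (elim X.cov_le) linarith
  qed
next
  fix h v :: real assume *: "0 < h" "0 < v"
  have "(\<Sum>i\<in>I. (v / ht i) powr (-s') * (h / wd i) powr (-t')) = v powr (-s') * h powr (-t')"
    using Y.sum_I_scale[OF *(2,1)] by (simp add: sum.reindex)
  then show "(\<Sum>i\<in>I. \<Phi> (h / wd i) (v / ht i)) \<le> \<Phi> h v"
    using X.sum_I_scale[OF *] by (simp add: sum.distrib sum_distrib_left[symmetric])
qed (use assms in auto)

lemma pack_grid:
  assumes "0 < h" "h \<le> 1 / m" "0 < v" "v \<le> 1 / m"
  shows "pack m F h v (\<Psi> h v)"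
proof (rule X.pack_F[where A = "\<lambda>_ _. True" and \<Psi> = \<Psi>])
  fix h v :: real
  assume *: "0 < h" "h \<le> 1 / m" "0 < v" "v \<le> 1 / m" "1 < h \<or> 1 < v"
  from *(5) show "pack m F h v (\<Psi> h v)"
  proof
    assume "1 < v"
    then have "pack m F h v (h powr (-s) * v powr (-t))" using X.pack_base * by simp
    moreover have "m powr s' \<le> 1" using X.m_pos X.m_M Y.s_nonneg by (intro powr_le1) auto
    then have "\<Psi> h v \<le> h powr (-s) * v powr (-t)" by (intro mult_left_le_one_le) auto
    ultimately show ?thesis by (rule pack_mono[OF _ subset_refl])
  qed (use pack_row_base * in simp)
next
  fix h v :: real assume *: "0 < h" "0 < v"
  show "\<Psi> h v \<le> (\<Sum>i\<in>I. \<Psi> (h / wd i) (v / ht i))"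
    using X.sum_I_scale[OF *] by (simp add: sum_distrib_left[symmetric])
qed (use assms in auto)

text \<open>Both summands have the order \<open>r powr (-D)\<close> because the two exponent sums
  agree. One factor \<open>C\<^sub>0\<close> belongs to \<open>\<Phi>\<close>, the other to the
  comparison.\<close>

lemma \<Phi>_comparable:
  assumes "0 < r" "m * r \<le> h" "h \<le> r / m" "m * r \<le> v" "v \<le> r / m" "s + t = D" "s' + t' = D"
  shows "\<Phi> h v \<le> C\<^sub>0 * C\<^sub>0 * r powr (-D)"
proof -
  have "\<Phi> h v \<le> C\<^sub>0 * (m powr (-s-t) * r powr (-D)) + C\<^sub>0 * (m powr (-s'-t') * r powr (-D))"
    using X.step_comparable(1)[OF assms(1-5)] Y.step_comparable(1)[OF assms(1,4,5,2,3)] assms(6,7) C\<^sub>0_ge(3)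
    by (intro add_mono mult_left_mono) auto
  also have "\<dots> = C\<^sub>0 * C\<^sub>0 * r powr (-D)" unfolding C\<^sub>0_def by (simp add: algebra_simps)
  finally show ?thesis .
qed

lemma column_decomposes:
  assumes uniform: "\<And>j. j \<in> X.J \<Longrightarrow> (\<Sum>i\<in>X.column j. ht i powr t) = 1"
    and D: "s + t = D" "s' + t' = D"
    and h: "0 < h" "h \<le> 1 / m" and v: "1 < v" "v \<le> 1 / m"
    and c: "c \<le> m powr s' * m powr (s + t)"
  shows "X.decomposes (\<lambda>B. scaling m (C\<^sub>0 * C\<^sub>0) c D B h v) h v"
proof (rule X.column_base_decomposes[where A = "\<lambda>_ _. True" and \<Phi> = \<Phi> and \<Psi> = \<Psi>])
  fix \<tau> and h v :: real
  assume *: "\<tau> \<in> lists X.J" "0 < h" "h \<le> 1 / m" "0 < v" "v \<le> 1 / m"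
  show "cov (X.Fcol \<tau>) (h * X.width \<tau>) v (\<Phi> h v)"
  proof (rule X.cov_Fcol[where A = "\<lambda>_ _. True" and J' = X.J and \<Phi> = \<Phi>])
    fix j and h v :: real assume j: "j \<in> X.J" and pos: "0 < h" "0 < v"
    have 1: "(\<Sum>i\<in>X.column j. C\<^sub>0 * h powr (-s) * (v / ht i) powr (-t)) = C\<^sub>0 * h powr (-s) * v powr (-t)"
      using X.sum_column_scale[OF pos(2), of "C\<^sub>0 * h powr (-s)" t j] uniform[OF j] by simp
    \<comment> \<open>Along a column only the first summand is reproduced exactly; for the second
      the grid inequality gives the direction that an upper bound requires.\<close>
    have "C\<^sub>0 * h powr (-t') * v powr (-s') * (\<Sum>i\<in>X.column j. ht i powr s') \<le> C\<^sub>0 * h powr (-t') * v powr (-s') * 1"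
      using sum_column_le C\<^sub>0_ge(3) by (intro mult_left_mono) auto
    then have 2: "(\<Sum>i\<in>X.column j. C\<^sub>0 * h powr (-t') * (v / ht i) powr (-s')) \<le> C\<^sub>0 * h powr (-t') * v powr (-s')"
      using X.sum_column_scale[OF pos(2), of "C\<^sub>0 * h powr (-t')" s' j] by simp
    show "(\<Sum>i\<in>X.column j. \<Phi> h (v / ht i)) \<le> \<Phi> h v"
      using 1 2 by (simp add: sum.distrib mult_ac)
  qed (use * cov_grid in auto)
  show "pack m (X.Fcol \<tau>) (h * X.width \<tau>) v (\<Psi> h v)"
  proof (rule X.pack_Fcol[where A = "\<lambda>_ _. True" and \<Psi> = \<Psi>])
    fix j and h v :: real assume j: "j \<in> X.J" and pos: "0 < h" "0 < v"
    show "\<Psi> h v \<le> (\<Sum>i\<in>X.column j. \<Psi> h (v / ht i))"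
      using X.sum_column_scale[OF pos(2), of "m powr s' * h powr (-s)" t j] uniform[OF j] by (simp add: mult.assoc)
  qed (use * pack_grid in auto)
next
  fix r h v :: real
  assume *: "0 < r" "m * r \<le> h" "h \<le> r / m" "m * r \<le> v" "v \<le> r / m"
  show "\<Phi> h v \<le> C\<^sub>0 * C\<^sub>0 * r powr (-D)"
    by (rule \<Phi>_comparable[OF * D])
  have "c * r powr (-D) \<le> m powr s' * m powr (s + t) * r powr (-D)"
    using c by (intro mult_right_mono) auto
  also have "\<dots> \<le> \<Psi> h v"
    using mult_left_mono[OF X.step_comparable(2)[OF *], of "m powr s'"] D by (simp add: mult.assoc)
  finally show "c * r powr (-D) \<le> \<Psi> h v" .
qed (use h v X.m_pos in auto)

lemma decomposes_swap:
  assumes "Y.decomposes N v h"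
  shows "X.decomposes (\<lambda>B. N (prod.swap ` B)) h v"
proof -
  obtain Q where Q: "tiles m v h Q" "\<Union>(fst ` Q) = prod.swap ` F" "\<forall>(B, g)\<in>Q. N B"
    using assms unfolding Y.decomposes_def by blast
  have "\<Union>(fst ` swap_tile ` Q) = prod.swap ` \<Union>(fst ` Q)"
    unfolding swap_tile_def by (simp add: image_image image_Union)
  then have "\<Union>(fst ` swap_tile ` Q) = F" using Q(2) by simp
  moreover have "\<forall>(B, g)\<in>swap_tile ` Q. N (prod.swap ` B)"
    using Q(3) unfolding swap_tile_def by auto
  ultimately show ?thesis
    unfolding X.decomposes_def using tiles_swap[OF Q(1)] by blast
qed

theorem homogeneous_grid:
  assumes col_uniform: "\<And>j. j \<in> X.J \<Longrightarrow> (\<Sum>i\<in>X.column j. ht i powr t) = 1"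
    and row_uniform: "\<And>k. k \<in> Y.J \<Longrightarrow> (\<Sum>i\<in>Y.column k. ht i powr t') = 1"
    and D: "s + t = D" "s' + t' = D"
  shows "homogeneous F D"
proof -
  interpret sw: grid_exponents "swap_rect ` I" "prod.swap ` F" m M s' t' s t
    by (rule grid_exponents_swap)
  \<comment> \<open>The minimum serves both orientations, since the recursion may stop in either of
    them.\<close>
  define c where "c = min (m powr s' * m powr (s + t)) (m powr s * m powr (s' + t'))"
  have C0: "sw.C\<^sub>0 = C\<^sub>0" unfolding sw.C\<^sub>0_def C\<^sub>0_def by simp
  show ?thesis
  proof (rule X.homogeneousI[where C = "C\<^sub>0 * C\<^sub>0" and c = c])
    fix R :: real assume R: "0 < R" "R \<le> 1"
    show "X.decomposes (\<lambda>B. scaling m (C\<^sub>0 * C\<^sub>0) c D B R R) R R"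
    proof (rule X.decomposes_F[where A = "\<lambda>_ _. True" and N = "scaling m (C\<^sub>0 * C\<^sub>0) c D"])
      fix h v :: real
      assume *: "0 < h" "h \<le> 1 / m" "0 < v" "v \<le> 1 / m" "1 < h \<or> 1 < v"
      from *(5) show "X.decomposes (\<lambda>B. scaling m (C\<^sub>0 * C\<^sub>0) c D B h v) h v"
      proof
        assume "1 < v"
        then show ?thesis
          using column_decomposes[OF col_uniform D *(1,2) _ *(4)] unfolding c_def by simp
      next
        assume "1 < h"
        then have "Y.decomposes (\<lambda>B. scaling m (C\<^sub>0 * C\<^sub>0) c D B v h) v h"
          using sw.column_decomposes[OF row_uniform D(2,1) *(3,4) _ *(2), of c] unfolding c_def C0 by simp
        from decomposes_swap[OF this] show ?thesis by (simp add: scaling_swap)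
      qed
    next
      fix i B h v
      assume "i \<in> I" "0 < h" "0 < v" "scaling m (C\<^sub>0 * C\<^sub>0) c D B (h / wd i) (v / ht i)"
      then show "scaling m (C\<^sub>0 * C\<^sub>0) c D (rect_map i ` B) h v"
        using X.unit X.m_pos by (intro scaling_rect_map)
    qed (use R X.m_pos X.m_M in \<open>auto intro: order_trans[of _ 1]\<close>)
  qed (use X.s_nonneg X.t_nonneg X.m_pos C\<^sub>0_ge D in \<open>auto simp: c_def\<close>)
qed

text \<open>From above, a sum of two powers is at most twice the larger; from below, each
  orientation contributes its own power, and the larger one is selected.\<close>

theorem box_regular_grid: "box_regular F (max (s + t) (s' + t'))"
proof -
  interpret sw: grid_exponents "swap_rect ` I" "prod.swap ` F" m M s' t' s t
    by (rule grid_exponents_swap)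
  let ?D = "max (s + t) (s' + t')"
  define c where "c = min (m powr s') (m powr s)"
  have one: "1 \<le> 1 / m" using X.m_pos X.m_M by simp
  show ?thesis
  proof (rule X.box_regularI[where C = "2 * C\<^sub>0" and c = c])
    fix r :: real assume r: "0 < r" "r \<le> 1"
    have r': "r \<le> 1 / m" using r one by linarith
    have split: "r powr (-a) * r powr (-b) = r powr (-(a + b))" for a b by (simp add: powr_add[symmetric])
    have "r powr (-(s + t)) \<le> r powr (-?D)" "r powr (-(s' + t')) \<le> r powr (-?D)"
      using r by (auto intro!: powr_mono')
    then have "C\<^sub>0 * r powr (-(s + t)) + C\<^sub>0 * r powr (-(s' + t')) \<le> C\<^sub>0 * r powr (-?D) + C\<^sub>0 * r powr (-?D)"
      using C\<^sub>0_ge(3) by (intro add_mono mult_left_mono) auto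
    then have "\<Phi> r r \<le> 2 * C\<^sub>0 * r powr (-?D)" unfolding split by simp
    with cov_grid[OF r(1) r' r(1) r'] show "cov F r r (2 * C\<^sub>0 * r powr (-?D))" by (rule X.cov_le)
    have p1: "pack m F r r (m powr s' * r powr (-(s + t)))"
      using pack_grid[OF r(1) r' r(1) r'] unfolding split .
    have p2: "pack m F r r (m powr s * r powr (-(s' + t')))"
      using sw.pack_grid[OF r(1) r' r(1) r'] unfolding split pack_swap .
    show "pack m F r r (c * r powr (-?D))"
    proof (cases "s + t \<le> s' + t'")
      case True
      then have "c * r powr (-?D) \<le> m powr s * r powr (-(s' + t'))"
        unfolding c_def by (auto simp: max_def intro: mult_right_mono)
      with p2 show ?thesis by (rule pack_mono[OF _ subset_refl])
    next
      case False
      then have "c * r powr (-?D) \<le> m powr s' * r powr (-(s + t))"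
        unfolding c_def by (auto simp: max_def intro: mult_right_mono)
      with p1 show ?thesis by (rule pack_mono[OF _ subset_refl])
    qed
  qed (use X.s_nonneg X.t_nonneg X.m_pos C\<^sub>0_ge in \<open>auto simp: c_def max_def\<close>)
qed

end

section \<open>A thin approximate square\<close>

primrec word_map :: "rect list \<Rightarrow> real \<times> real \<Rightarrow> real \<times> real" where
  "word_map [] p = p"
| "word_map (i # w) p = rect_map i (word_map w p)"

lemma word_map_append: "word_map (v @ w) p = word_map v (word_map w p)"
  by (induction v) auto

definition height :: "rect list \<Rightarrow> real" where
  "height w = prod_list (map ht w)"

lemma height_simps [simp]: "height [] = 1" "height (i # w) = ht i * height w"
  by (simp_all add: height_def)

definition inner_square :: "real \<Rightarrow> (real \<times> real) set" where
  "inner_square \<epsilon> = {\<epsilon>..1 - \<epsilon>} \<times> {\<epsilon>..1 - \<epsilon>}"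

lemma affine_margin:
  fixes w p x e :: real
  assumes "0 < w" "0 \<le> p" "p + w \<le> 1" "e \<le> x" "x \<le> 1 - e"
  shows "p + w * e \<le> w * x + p" "w * x + p \<le> p + w - w * e" "w * e \<le> w * x + p" "w * x + p \<le> 1 - w * e"
proof -
  have "w * e \<le> w * x" "w * x \<le> w * (1 - e)" using assms by (auto intro: mult_left_mono)
  then show "p + w * e \<le> w * x + p" "w * x + p \<le> p + w - w * e" "w * e \<le> w * x + p" "w * x + p \<le> 1 - w * e"
    using assms right_diff_distrib[of w 1 e] by linarith+
qed

lemma affine_interior:
  fixes w p x e q :: real
  assumes "0 < w" "0 \<le> p" "p + w \<le> 1" "e \<le> x" "x \<le> 1 - e" "\<bar>q - (w * x + p)\<bar> < w * e"
  shows "p < q" "q < p + w"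
  using affine_margin(1,2)[OF assms(1-5)] assms(6) by linarith+

context column_system
begin

section \<open>Points that stay away from the edges of their pieces\<close>

lemma width_pos: "\<forall>i\<in>set w. unit_rect i \<Longrightarrow> 0 < width w"
  by (induction w) (auto simp: unit_rect_def)

lemma height_pos: "\<forall>i\<in>set w. unit_rect i \<Longrightarrow> 0 < height w"
  by (induction w) (auto simp: unit_rect_def)

lemma word_map_margin:
  assumes "\<forall>i\<in>set w. unit_rect i" "p \<in> inner_square \<epsilon>"
  shows "\<epsilon> * width w \<le> fst (word_map w p) \<and> fst (word_map w p) \<le> 1 - \<epsilon> * width w \<and>
     \<epsilon> * height w \<le> snd (word_map w p) \<and> snd (word_map w p) \<le> 1 - \<epsilon> * height w"
  using assms(1)
proof (induction w)
  case Nil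
  then show ?case using assms(2) by (auto simp: inner_square_def)
next
  case (Cons i w)
  then have i: "unit_rect i" by simp
  show ?case
    using Cons i affine_margin(3,4)[of "wd i" "px i" "\<epsilon> * width w" "fst (word_map w p)"]
      affine_margin(3,4)[of "ht i" "py i" "\<epsilon> * height w" "snd (word_map w p)"]
    by (auto simp: unit_rect_def mult_ac)
qed

lemma rect_map_bounds:
  assumes "i \<in> I" "q \<in> F"
  shows "px i \<le> fst (rect_map i q)" "fst (rect_map i q) \<le> px i + wd i"
    "py i \<le> snd (rect_map i q)" "snd (rect_map i q) \<le> py i + ht i"
proof -
  have "0 \<le> fst q" "fst q \<le> 1" "0 \<le> snd q" "snd q \<le> 1" using F_unit assms(2) by auto
  then show "px i \<le> fst (rect_map i q)" "fst (rect_map i q) \<le> px i + wd i"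
    "py i \<le> snd (rect_map i q)" "snd (rect_map i q) \<le> py i + ht i"
    using pos[OF assms(1)] by (auto simp: mult_left_le)
qed

lemma diff_affine_less:
  fixes w x y e :: real
  assumes "\<bar>w * x + p - (w * y + p)\<bar> < e * (w * z)" "0 < w"
  shows "\<bar>x - y\<bar> < e * z"
proof -
  have "w * x + p - (w * y + p) = w * (x - y)" by algebra
  then have "w * \<bar>x - y\<bar> < w * (e * z)" using assms by (simp add: abs_mult mult_ac)
  then show ?thesis using assms(2) by simp
qed

text \<open>
  Points of \<open>F\<close> close to the image of the inner square cannot come from a neighbouring rectangle,
  so a small ball around such a point sees only one approximate square.
\<close>

lemma near_word_map:
  assumes "w \<in> lists I" "p \<in> inner_square \<epsilon>" "q \<in> F"
    and "\<bar>fst q - fst (word_map w p)\<bar> < \<epsilon> * width w" "\<bar>snd q - snd (word_map w p)\<bar> < \<epsilon> * height w"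
  shows "q \<in> word_map w ` F"
  using assms(1,3-)
proof (induction w arbitrary: q rule: list.induct)
  case Nil
  then show ?case by simp
next
  case (Cons i w)
  let ?P = "word_map w p"
  have i: "i \<in> I" and w: "w \<in> lists I" using Cons.prems by auto
  have "\<forall>i\<in>set w. unit_rect i" using w unit by auto
  note P = word_map_margin[OF this assms(2)]
  have x: "px i < fst q" "fst q < px i + wd i"
    using affine_interior[of "wd i" "px i" "\<epsilon> * width w" "fst ?P" "fst q"] P unit[OF i] Cons.prems(3)
    by (auto simp: unit_rect_def mult_ac)
  have y: "py i < snd q" "snd q < py i + ht i"
    using affine_interior[of "ht i" "py i" "\<epsilon> * height w" "snd ?P" "snd q"] P unit[OF i] Cons.prems(4)
    by (auto simp: unit_rect_def mult_ac)
  obtain i' q' where q': "i' \<in> I" "q' \<in> F" "q = rect_map i' q'" using Cons.prems(2) F_eq by blast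
  have "i' = i"
  proof (rule ccontr)
    assume "i' \<noteq> i"
    then have "apart i' i" using apart_I q'(1) i by blast
    then show False using rect_map_bounds[OF q'(1,2)] x y unfolding q'(3) apart_def by linarith
  qed
  then have "\<bar>fst q' - fst ?P\<bar> < \<epsilon> * width w" "\<bar>snd q' - snd ?P\<bar> < \<epsilon> * height w"
    using Cons.prems(3,4) pos[OF i] q'(3) by (auto intro: diff_affine_less)
  then have "q' \<in> word_map w ` F" using Cons.IH w q'(2) by blast
  then show ?case using q'(3) \<open>i' = i\<close> by auto
qed

text \<open>Columns are told apart by the first coordinate, so a horizontal margin alone determines
  every letter of \<open>\<tau>\<close>.\<close>

lemma near_Fcol:
  assumes "\<tau> \<in> lists J" "p \<in> inner_square \<epsilon>" "q \<in> F"
    and "\<bar>fst q - fst (word_map \<tau> p)\<bar> < \<epsilon> * width \<tau>"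
  shows "q \<in> Fcol \<tau>"
  using assms(1,3-)
proof (induction \<tau> arbitrary: q rule: list.induct)
  case Nil
  then show ?case by simp
next
  case (Cons j \<tau>)
  let ?P = "word_map \<tau> p"
  have j: "j \<in> J" and \<tau>: "\<tau> \<in> lists J" using Cons.prems by auto
  have "\<forall>i\<in>set \<tau>. unit_rect i" using \<tau> unit_J by auto
  note P = word_map_margin[OF this assms(2)]
  have x: "px j < fst q" "fst q < px j + wd j"
    using affine_interior[of "wd j" "px j" "\<epsilon> * width \<tau>" "fst ?P" "fst q"] P unit_J[OF j] Cons.prems(3)
    by (auto simp: unit_rect_def mult_ac)
  obtain i q' where q': "i \<in> I" "q' \<in> F" "q = rect_map i q'" using Cons.prems(2) F_eq by blast
  obtain i0 where i0: "i0 \<in> I" "j = col i0" using j by blast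
  have "px i = px i0 \<and> wd i = wd i0"
    using columns[OF q'(1) i0(1)] rect_map_bounds(1,2)[OF q'(1,2)] x unfolding q'(3) i0(2) by auto
  then have i: "i \<in> column j" using q'(1) i0(2) by (simp add: column_def col_def)
  then have "\<bar>fst q' - fst ?P\<bar> < \<epsilon> * width \<tau>"
    using Cons.prems(3) columnD[OF i] pos(1)[OF q'(1)] q'(3) by (auto intro: diff_affine_less)
  then have "q' \<in> Fcol \<tau>" using Cons.IH \<tau> q'(2) by blast
  then show ?case using q'(3) i by auto
qed

lemma fst_word_map_col: "fst (word_map (map col w) p) = fst (word_map w p)"
  by (induction w) auto

lemma width_append: "width (v @ w) = width v * width w"
  by (simp add: width_def)

lemma width_map_col [simp]: "width (map col w) = width w"
  by (induction w) auto

lemma width_replicate: "width (replicate k i) = wd i ^ k"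
  by (induction k) auto

lemma height_replicate: "height (replicate k i) = ht i ^ k"
  by (induction k) auto

lemma word_map_F: "w \<in> lists I \<Longrightarrow> q \<in> F \<Longrightarrow> word_map w q \<in> F"
proof (induction w rule: list.induct)
  case (Cons i w)
  then show ?case using rect_map_F[of i] by auto
qed simp

lemma fst_word_map_diff: "fst (word_map w a) - fst (word_map w b) = width w * (fst a - fst b)"
proof (induction w)
  case (Cons i w)
  have "fst (word_map (i # w) a) - fst (word_map (i # w) b) = wd i * (fst (word_map w a) - fst (word_map w b))"
    by (simp add: right_diff_distrib)
  then show ?case using Cons by simp
qed simp

text \<open>The letter \<open>i1\<close> keeps the image off the left edge, \<open>i2\<close> off
  the right, \<open>i3\<close> off the bottom and \<open>i4\<close> off the top. The vertical margin
  \<open>e\<close> gained by the two inner letters is then shrunk by the heights of the two outer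
  ones.\<close>

lemma inner_word_exists:
  assumes "i1 \<in> I" "px i1 \<noteq> 0" "i2 \<in> I" "px i2 + wd i2 \<noteq> 1"
    and "i3 \<in> I" "py i3 \<noteq> 0" "i4 \<in> I" "py i4 + ht i4 \<noteq> 1"
  obtains u \<epsilon> where "u \<in> lists I" "0 < \<epsilon>" "\<And>p. p \<in> F \<Longrightarrow> word_map u p \<in> inner_square \<epsilon>"
proof -
  note U = unit[unfolded unit_rect_def]
  define a where "a = px i1"
  define b where "b = wd i1 * (1 - (px i2 + wd i2))"
  define e where "e = min (py i3) (ht i3 * (1 - (py i4 + ht i4)))"
  define \<epsilon> where "\<epsilon> = min (min a b) (ht i1 * (ht i2 * e))"
  have "0 < a" "0 < b" "0 < e"
    using assms U[OF assms(1)] U[OF assms(3)] U[OF assms(5)] U[OF assms(7)] unfolding a_def b_def e_def by auto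
  then have \<epsilon>: "0 < \<epsilon>" using pos(2)[OF assms(1)] pos(2)[OF assms(3)] unfolding \<epsilon>_def by simp
  show ?thesis
  proof (rule that[of "[i1, i2, i3, i4]" \<epsilon>])
    show "[i1, i2, i3, i4] \<in> lists I" using assms by simp
    fix p assume p: "p \<in> F"
    have F4: "rect_map i4 p \<in> F" using rect_map_F[OF assms(7)] p by blast
    have F3: "rect_map i3 (rect_map i4 p) \<in> F" using rect_map_F[OF assms(5)] F4 by blast
    have F2: "rect_map i2 (rect_map i3 (rect_map i4 p)) \<in> F" using rect_map_F[OF assms(3)] F3 by blast
    let ?X = "fst (rect_map i2 (rect_map i3 (rect_map i4 p)))"
    let ?Z = "rect_map i1 (rect_map i2 (rect_map i3 (rect_map i4 p)))"
    have "?X \<le> px i2 + wd i2" by (rule rect_map_bounds(2)[OF assms(3) F3])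
    then have "wd i1 * ?X \<le> wd i1 * (px i2 + wd i2)"
      using pos(1)[OF assms(1)] by (intro mult_left_mono) auto
    moreover have "fst ?Z = wd i1 * ?X + px i1" by (rule fst_rect_map)
    ultimately have "fst ?Z \<le> 1 - b"
      using U[OF assms(1)] unfolding b_def right_diff_distrib by linarith
    moreover have "a \<le> fst ?Z" unfolding a_def by (rule rect_map_bounds(1)[OF assms(1) F2])
    moreover have y3: "e \<le> snd (rect_map i3 (rect_map i4 p))" "snd (rect_map i3 (rect_map i4 p)) \<le> 1 - e"
    proof -
      show "e \<le> snd (rect_map i3 (rect_map i4 p))"
        using rect_map_bounds(3)[OF assms(5) F4] unfolding e_def by linarith
      have "ht i3 * snd (rect_map i4 p) \<le> ht i3 * (py i4 + ht i4)"
        using pos(2)[OF assms(5)] rect_map_bounds(4)[OF assms(7) p] by (intro mult_left_mono) auto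
      moreover have "snd (rect_map i3 (rect_map i4 p)) = ht i3 * snd (rect_map i4 p) + py i3" by (rule snd_rect_map)
      moreover have "e \<le> ht i3 - ht i3 * (py i4 + ht i4)" unfolding e_def by (simp add: right_diff_distrib)
      moreover have "py i3 + ht i3 \<le> 1" using U[OF assms(5)] by blast
      ultimately show "snd (rect_map i3 (rect_map i4 p)) \<le> 1 - e" by linarith
    qed
    have y2: "ht i2 * e \<le> snd (rect_map i2 (rect_map i3 (rect_map i4 p)))"
      "snd (rect_map i2 (rect_map i3 (rect_map i4 p))) \<le> 1 - ht i2 * e"
      unfolding snd_rect_map[of i2] using affine_margin(3,4)[OF _ _ _ y3] U[OF assms(3)] by auto
    have "ht i1 * (ht i2 * e) \<le> snd ?Z" "snd ?Z \<le> 1 - ht i1 * (ht i2 * e)"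
      unfolding snd_rect_map[of i1] using affine_margin(3,4)[OF _ _ _ y2] U[OF assms(1)] by auto
    ultimately show "word_map [i1, i2, i3, i4] p \<in> inner_square \<epsilon>"
      unfolding inner_square_def \<epsilon>_def mem_Times_iff atLeastAtMost_iff word_map.simps by (intro conjI; linarith)
  qed (rule \<epsilon>)
qed

section \<open>Coverings of a thin approximate square\<close>

lemma cov_word_map:
  assumes "\<forall>i\<in>set w. unit_rect i" "cov A h v K"
  shows "cov (word_map w ` A) (h * width w) (v * height w) K"
  using assms(1)
proof (induction w)
  case Nil
  then show ?case using assms(2) by simp
next
  case (Cons i w)
  then have i: "0 < wd i" "0 < ht i" by (auto simp: unit_rect_def)
  have "cov (\<Union>i\<in>{i}. rect_map i ` word_map w ` A) (h * width (i # w)) (v * height (i # w)) (\<Sum>i\<in>{i}. K)"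
    using Cons i by (intro cov_UN) auto
  then show ?case by (simp add: image_image)
qed

text \<open>A crude bound, a factor \<open>card I\<close> for each letter. It is harmless because
  \<open>u\<close> stays fixed while the number of copies of the deficient column grows.\<close>

lemma cov_Fcol_append:
  assumes "u \<in> lists I" "cov (Fcol \<tau>) h v K" "0 < v" "0 \<le> K"
  shows "cov (Fcol (map col u @ \<tau>)) (h * width u) v (real (card I) ^ length u * K)"
  using assms(1)
proof (induction u rule: list.induct)
  case Nil
  then show ?case using assms(2) by simp
next
  case (Cons i u)
  then have i: "i \<in> I" and IH: "cov (Fcol (map col u @ \<tau>)) (h * width u) v (real (card I) ^ length u * K)"
    by auto
  let ?K = "real (card I) ^ length u * K"
  have "cov (\<Union>i'\<in>column (col i). rect_map i' ` Fcol (map col u @ \<tau>)) (h * width (i # u)) v (\<Sum>i'\<in>column (col i). ?K)"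
  proof (rule cov_UN)
    fix i' assume "i' \<in> column (col i)"
    then have i': "i' \<in> I" "wd i' = wd i" using columnD[of i' "col i"] by auto
    show "0 < wd i' \<and> 0 < ht i'" using pos[OF i'(1)] by blast
    have "v \<le> v / ht i'" using pos(2)[OF i'(1)] less_1(2)[OF i'(1)] assms(3) by (simp add: pos_le_divide_eq mult_left_le)
    moreover have "h * width (i # u) / wd i' = h * width u" using i' pos(1)[OF i'(1)] by simp
    ultimately show "cov (Fcol (map col u @ \<tau>)) (h * width (i # u) / wd i') (v / ht i') ?K"
      using cov_mono[OF IH subset_refl order_refl _ order_refl] by simp
  qed simp
  moreover have "(\<Sum>i'\<in>column (col i). ?K) \<le> real (card I) ^ length (i # u) * K"
  proof -
    have "real (card (column (col i))) \<le> real (card I)"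
      unfolding column_def using finite_I by (intro of_nat_mono card_mono) auto
    then have "real (card (column (col i))) * ?K \<le> real (card I) * ?K"
      using assms(4) by (intro mult_right_mono) auto
    then show ?thesis by (simp add: mult_ac)
  qed
  ultimately show ?case by (auto intro: cov_le)
qed

end

context column_exponents
begin

text \<open>Each of the \<open>k\<close> letters divides \<open>v\<close> by at most
  \<open>M\<close>, so \<open>M ^ k \<le> v\<close> ensures that the boxes reach height 1 before the
  word is exhausted. Up to that point only the column \<open>j\<close> is seen, and its exponent
  \<open>u\<close> takes the place of \<open>t\<close>.\<close>

lemma cov_column_power:
  assumes j: "j \<in> J" and u: "0 \<le> u" "(\<Sum>i\<in>column j. ht i powr u) \<le> 1"
    and h: "0 < h" "h \<le> 1 / m" and "M ^ k \<le> v" "v \<le> 1 / m"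
  shows "cov (Fcol (replicate k j)) (h * width (replicate k j)) v (m powr (-s-u) * (h powr (-s) * v powr (-u)))"
  using assms(6-)
proof (induction k arbitrary: v)
  case 0
  then show ?case using cov_base_general[OF u(1) h] by simp
next
  case (Suc k)
  have v: "0 < v" using Suc.prems(1) m_M by (intro less_le_trans[of 0 "M ^ Suc k" v]) auto
  show ?case
  proof (cases "1 \<le> v")
    case True
    then show ?thesis
      using cov_base_general[OF u(1) h True Suc.prems(2)] j by (intro cov_Fcol_flat) auto
  next
    case False
    let ?K = "\<lambda>v. m powr (-s-u) * (h powr (-s) * v powr (-u))"
    have "cov (\<Union>i\<in>column j. rect_map i ` Fcol (replicate k j)) (h * width (replicate (Suc k) j)) v
      (\<Sum>i\<in>column j. ?K (v / ht i))"
    proof (rule cov_UN)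
      fix i assume "i \<in> column j"
      note i = columnD(1,2)[OF this]
      show "0 < wd i \<and> 0 < ht i" using pos[OF i(1)] by blast
      have "M ^ k \<le> v / M" using Suc.prems(1) m_M(3) by (simp add: pos_le_divide_eq mult.commute)
      also have "\<dots> \<le> v / ht i" using size[OF i(1)] pos[OF i(1)] v by (intro frac_le) auto
      finally have "M ^ k \<le> v / ht i" .
      moreover have "v / ht i \<le> 1 / m" using size[OF i(1)] m_pos False v by (intro frac_le) auto
      ultimately have "cov (Fcol (replicate k j)) (h * width (replicate k j)) (v / ht i) (?K (v / ht i))"
        by (rule Suc.IH)
      then show "cov (Fcol (replicate k j)) (h * width (replicate (Suc k) j) / wd i) (v / ht i) (?K (v / ht i))"
        using i pos(1)[OF i(1)] by simp
    qed simp
    moreover have "(\<Sum>i\<in>column j. ?K (v / ht i)) \<le> ?K v"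
      using sum_column_scale[OF v, of "m powr (-s-u) * h powr (-s)" u j]
        mult_left_mono[OF u(2), of "m powr (-s-u) * h powr (-s) * v powr (-u)"]
      by (simp add: mult_ac)
    ultimately show ?thesis by (auto intro: cov_le)
  qed
qed

text \<open>The radii of covering sets and ball have ratio of order \<open>M ^ k\<close>, and all
  scales in between lie within the \<open>k\<close> copies of the column \<open>j\<close>. The count
  therefore follows the exponents \<open>s\<close> and \<open>e\<close> of this column.\<close>

lemma thin_square:
  assumes i0: "i0 \<in> I" "ht i0 < wd i0" and j: "j \<in> J"
    and e: "0 \<le> e" "(\<Sum>i\<in>column j. ht i powr e) \<le> 1"
    and u: "u \<in> lists I" "0 < \<epsilon>" "\<And>p. p \<in> F \<Longrightarrow> word_map u p \<in> inner_square \<epsilon>"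
    and k: "M ^ k * wd i0 / ht i0 \<le> 1"
  obtains x R where "x \<in> F" "0 < R" "R \<le> M ^ k"
    "real (covering_number (8 * R * (M ^ k * wd i0 / ht i0) / \<epsilon>) (cball x R \<inter> F)) \<le>
       real (card I) ^ length u * (m powr (-s-e) * ((M ^ k * wd i0 / ht i0) powr (-s) * (M ^ k) powr (-e)))"
proof -
  define q where "q = ht i0 / wd i0"
  have q: "0 < q" "q < 1" using i0 pos[OF i0(1)] unfolding q_def by auto
  obtain i\<^sub>j where ij: "i\<^sub>j \<in> I" "col i\<^sub>j = j" using j by blast
  obtain z where z: "z \<in> F" using F_ne by blast
  \<comment> \<open>The approximate square: \<open>n\<close> copies of \<open>i0\<close>, then the columns of \<open>u\<close>, then \<open>k\<close> times \<open>j\<close>,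
    with \<open>n\<close> chosen below to make height and width comparable.\<close>
  define \<tau> where "\<tau> = map col u @ replicate k j"
  \<comment> \<open>The word \<open>u\<close> occurs twice: innermost, in \<open>p\<close>, to stay
    away from the edges of the strip \<open>\<tau>\<close>, and in front of the copies of
    \<open>j\<close>, to stay away from the edges of the rectangle of the wide word.\<close>
  define p where "p = word_map u z"
  define x' where "x' = word_map (u @ replicate k i\<^sub>j) p"
  have p: "p \<in> F" "p \<in> inner_square \<epsilon>" using word_map_F u z unfolding p_def by auto
  have x'u: "x' = word_map u (word_map (replicate k i\<^sub>j) p)" unfolding x'_def by (rule word_map_append)
  have rF: "word_map (replicate k i\<^sub>j) p \<in> F" using ij p by (intro word_map_F) auto
  have x': "x' \<in> F" "x' \<in> inner_square \<epsilon>" unfolding x'u using rF u word_map_F by auto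
  have \<epsilon>1: "\<epsilon> \<le> 1" using x'(2) u(2) unfolding inner_square_def by auto
  have \<tau>: "\<tau> \<in> lists J" using u j unfolding \<tau>_def by auto
  have "map col (u @ replicate k i\<^sub>j) = \<tau>" unfolding \<tau>_def using ij by simp
  then have fst_x': "fst x' = fst (word_map \<tau> p)"
    unfolding x'_def using fst_word_map_col[of "u @ replicate k i\<^sub>j" p] by simp
  define W where "W = width \<tau>"
  have W: "0 < W" "W \<le> 1" using width_bounds[OF \<tau>] unfolding W_def by auto
  have "\<exists>n. q ^ Suc n < W"
  proof -
    obtain n where "q ^ n < W" using real_arch_pow_inv[OF W(1) q(2)] by blast
    moreover have "q ^ Suc n \<le> q ^ n" using q by (intro power_decreasing) auto
    ultimately show ?thesis by (intro exI[of _ n]) linarith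
  qed
  \<comment> \<open>The least such \<open>n\<close> also satisfies \<open>W \<le> q ^ n\<close>: the
    flattening by \<open>n\<close> wide rectangles matches the strip width \<open>W\<close> up to
    the factor \<open>q\<close>.\<close>
  then obtain n where n: "q ^ Suc n < W" "\<And>l. l < n \<Longrightarrow> \<not> q ^ Suc l < W"
    using exists_least_iff[of "\<lambda>n. q ^ Suc n < W"] by blast
  have Wn: "W \<le> q ^ n"
  proof (cases n)
    case 0
    then show ?thesis using W by simp
  next
    case (Suc l)
    then show ?thesis using n(2)[of l] by simp
  qed
  define w where "w = replicate n i0"
  have w: "w \<in> lists I" "\<forall>i\<in>set w. unit_rect i" using i0 unit unfolding w_def by auto
  have ww: "width w = wd i0 ^ n" "height w = wd i0 ^ n * q ^ n"
    using pos(1)[OF i0(1)] unfolding w_def width_replicate height_replicate q_def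
    by (simp_all add: power_divide)
  define S where "S = width w * W"
  have S: "0 < S" "S \<le> height w" "q * height w < S"
  proof -
    have w0: "0 < wd i0 ^ n" using pos(1)[OF i0(1)] by simp
    show "0 < S" using w0 W ww unfolding S_def by simp
    show "S \<le> height w" using Wn w0 ww unfolding S_def by simp
    show "q * height w < S" using n(1) w0 ww unfolding S_def by simp
  qed
  define R where "R = \<epsilon> * S / 2"
  define x where "x = word_map w x'"
  have R: "0 < R" "R < \<epsilon> * S" using u(2) S(1) unfolding R_def by auto
  have x: "x \<in> F" unfolding x_def by (rule word_map_F[OF w(1) x'(1)])
  have sub: "cball x R \<inter> F \<subseteq> word_map w ` Fcol \<tau>"
  proof
    fix y assume y: "y \<in> cball x R \<inter> F"
    then have d: "\<bar>fst y - fst x\<bar> < \<epsilon> * S" "\<bar>snd y - snd x\<bar> < \<epsilon> * S"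
      using abs_le_dist[of y x] R by (auto simp: dist_commute)
    have Sw: "\<epsilon> * S \<le> \<epsilon> * width w" "\<epsilon> * S \<le> \<epsilon> * height w"
      using S(2) W(2) u(2) width_pos[OF w(2)] unfolding S_def by (auto intro!: mult_left_mono simp: mult_left_le)
    have "y \<in> word_map w ` F"
      using d Sw y unfolding x_def by (intro near_word_map[OF w(1) x'(2)]) auto
    then obtain y' where y': "y' \<in> F" "y = word_map w y'" by blast
    note aff = fst_word_map_diff[of w]
    have "width w * \<bar>fst y' - fst x'\<bar> < width w * (\<epsilon> * W)"
      using d(1) width_pos[OF w(2)] unfolding y'(2) x_def aff S_def by (simp add: abs_mult mult_ac)
    then have "\<bar>fst y' - fst x'\<bar> < \<epsilon> * W" using width_pos[OF w(2)] by simp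
    then have "y' \<in> Fcol \<tau>"
      unfolding fst_x' W_def by (rule near_Fcol[OF \<tau> p(2) y'(1)])
    then show "y \<in> word_map w ` Fcol \<tau>" using y'(2) by blast
  qed
  \<comment> \<open>The relative side of the boxes is \<open>M ^ k / q\<close>. The piece may be
    higher than wide by the factor \<open>1 / q\<close>, and this choice keeps the relative height
    \<open>v\<close> of the boxes at least \<open>M ^ k\<close>.\<close>
  define \<delta> where "\<delta> = M ^ k * wd i0 / ht i0"
  have Mk: "0 < M ^ k" using m_M by simp
  have \<delta>: "0 < \<delta>" "\<delta> \<le> 1" "q * \<delta> = M ^ k"
    using k Mk pos[OF i0(1)] unfolding \<delta>_def q_def by auto
  define v where "v = \<delta> * S / height w"
  have h0: "0 < height w" by (rule height_pos[OF w(2)])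
  have v: "M ^ k \<le> v" "v \<le> 1" "v * height w = \<delta> * S"
  proof -
    have "q * \<delta> * height w \<le> \<delta> * S" using S(3) \<delta>(1) by (simp add: mult_ac)
    then show "M ^ k \<le> v" unfolding v_def \<delta>(3)[symmetric] using h0 by (simp add: pos_le_divide_eq)
    have "\<delta> * S \<le> 1 * height w" using \<delta> S h0 by (intro mult_mono) auto
    then show "v \<le> 1" unfolding v_def using h0 by simp
    show "v * height w = \<delta> * S" unfolding v_def using h0 by simp
  qed
  have one: "1 \<le> 1 / m" using m_pos m_M by simp
  let ?K = "m powr (-s-e) * (\<delta> powr (-s) * (M ^ k) powr (-e))"
  have "cov (Fcol (replicate k j)) (\<delta> * width (replicate k j)) v (m powr (-s-e) * (\<delta> powr (-s) * v powr (-e)))"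
    using cov_column_power[OF j e \<delta>(1) _ v(1)] \<delta>(2) v(2) one by simp
  moreover have "v powr (-e) \<le> (M ^ k) powr (-e)"
    using v(1) Mk e(1) by (intro powr_mono2') auto
  then have "m powr (-s-e) * (\<delta> powr (-s) * v powr (-e)) \<le> ?K"
    by (intro mult_left_mono) auto
  ultimately have "cov (Fcol (replicate k j)) (\<delta> * width (replicate k j)) v ?K" by (rule cov_le)
  then have "cov (Fcol \<tau>) (\<delta> * width (replicate k j) * width u) v (real (card I) ^ length u * ?K)"
    unfolding \<tau>_def using v(1) Mk by (intro cov_Fcol_append u(1)) auto
  then have "cov (Fcol \<tau>) (\<delta> * W) v (real (card I) ^ length u * ?K)"
    unfolding W_def \<tau>_def width_append by (simp add: mult_ac)
  then have "cov (word_map w ` Fcol \<tau>) (\<delta> * W * width w) (v * height w) (real (card I) ^ length u * ?K)"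
    by (rule cov_word_map[OF w(2)])
  then have "cov (word_map w ` Fcol \<tau>) (\<delta> * S) (\<delta> * S) (real (card I) ^ length u * ?K)"
    unfolding v(3) S_def by (simp add: mult_ac)
  then have "cov (cball x R \<inter> F) (4 * (\<delta> * S) / 4) (4 * (\<delta> * S) / 4) (real (card I) ^ length u * ?K)"
    using sub by (intro cov_mono[OF _ sub]) auto
  then have "real (covering_number (4 * (\<delta> * S)) (cball x R \<inter> F)) \<le> real (card I) ^ length u * ?K"
    using \<delta>(1) S(1) by (intro covering_number_le_cov) auto
  moreover have "4 * (\<delta> * S) = 8 * R * \<delta> / \<epsilon>" using u(2) unfolding R_def by simp
  ultimately have fin: "real (covering_number (8 * R * \<delta> / \<epsilon>) (cball x R \<inter> F)) \<le> real (card I) ^ length u * ?K"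
    by simp
  \<comment> \<open>The strip contains \<open>k\<close> columns of width at most \<open>M\<close>.
    Thus the radii tend to 0 and fall below any threshold \<open>\<rho>\<close> in the definition of
    the lower dimension.\<close>
  have "R \<le> M ^ k"
  proof -
    have "map col u \<in> lists J" using u(1) by (auto simp: in_lists_conv_set)
    then have "width u \<le> 1" using width_bounds(2)[of "map col u"] by simp
    then have "W \<le> 1 * wd j ^ k"
      unfolding W_def \<tau>_def width_append width_replicate width_map_col
      using size_J[OF j] by (intro mult_right_mono) auto
    also have "\<dots> \<le> M ^ k" using size_J[OF j] by (simp add: power_mono)
    finally have "W \<le> M ^ k" .
    moreover have "S \<le> W"
    proof -
      have "width w \<le> 1" using less_1(1)[OF i0(1)] pos(1)[OF i0(1)] ww by (simp add: power_le_one)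
      then show ?thesis unfolding S_def using W by (simp add: mult_left_le_one_le width_pos[OF w(2), THEN less_imp_le])
    qed
    moreover have "\<epsilon> * S \<le> S" using \<epsilon>1 u(2) S(1) by (simp add: mult_left_le_one_le)
    ultimately show ?thesis unfolding R_def using S(1) by linarith
  qed
  then show ?thesis using that[OF x R(1)] fin unfolding \<delta>_def by blast
qed

text \<open>By continuity some \<open>e < \<delta>\<close> still has column sum below 1. The thin
  squares bound the count at ratio \<open>R / r\<close> by a constant times
  \<open>(R / r) powr (s + e)\<close> for a sequence of ratios tending to infinity, so no exponent
  above \<open>s + e\<close> is admissible.\<close>

theorem lower_dim_less:
  assumes i0: "i0 \<in> I" "ht i0 < wd i0" and j: "j \<in> J" and \<delta>: "(\<Sum>i\<in>column j. ht i powr \<delta>) < 1"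
    and x: "i1 \<in> I" "px i1 \<noteq> 0" "i2 \<in> I" "px i2 + wd i2 \<noteq> 1"
    and y: "i3 \<in> I" "py i3 \<noteq> 0" "i4 \<in> I" "py i4 + ht i4 \<noteq> 1"
  shows "lower_dim F < s + \<delta>"
proof -
  \<comment> \<open>For a non-positive exponent every summand, and so the column sum, would be at
    least 1.\<close>
  have "0 < \<delta>"
  proof (rule ccontr)
    assume "\<not> 0 < \<delta>"
    obtain i where i: "i \<in> column j" using column_ne[OF j] by blast
    have "1 \<le> ht i powr \<delta>"
      using \<open>\<not> 0 < \<delta>\<close> pos(2)[OF columnD(1)[OF i]] less_1(2)[OF columnD(1)[OF i]]
        powr_mono'[of \<delta> 0 "ht i"] by simp
    also have "\<dots> \<le> (\<Sum>i\<in>column j. ht i powr \<delta>)" using i by (intro member_le_sum) auto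
    finally show False using \<delta> by simp
  qed
  have "((\<lambda>e. \<Sum>i\<in>column j. ht i powr e) \<longlongrightarrow> (\<Sum>i\<in>column j. ht i powr \<delta>)) (at_left \<delta>)"
    using pos(2)[OF columnD(1)] by (intro tendsto_sum tendsto_powr tendsto_const tendsto_ident_at) fastforce+
  then have "\<forall>\<^sub>F e in at_left \<delta>. (\<Sum>i\<in>column j. ht i powr e) < 1"
    using \<delta> by (rule order_tendstoD)
  moreover have "\<forall>\<^sub>F e in at_left \<delta>. 0 < e \<and> e < \<delta>"
    using \<open>0 < \<delta>\<close> by (auto simp: eventually_at_left_field intro!: exI[of _ 0])
  ultimately have "\<forall>\<^sub>F e in at_left \<delta>. (\<Sum>i\<in>column j. ht i powr e) < 1 \<and> 0 < e \<and> e < \<delta>"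
    by eventually_elim auto
  then obtain e where e: "(\<Sum>i\<in>column j. ht i powr e) < 1" "0 < e" "e < \<delta>"
    using eventually_happens[of _ "at_left \<delta>"] by auto
  obtain u \<epsilon> where u: "u \<in> lists I" "0 < \<epsilon>" "\<And>p. p \<in> F \<Longrightarrow> word_map u p \<in> inner_square \<epsilon>"
    using inner_word_exists[OF x y] by blast
  have "lower_dim F \<le> s + e"
    unfolding lower_dim_def
  proof (rule cSup_least)
    \<comment> \<open>The exponent 0 is always admissible, so the supremum is over a non-empty
      set.\<close>
    have "1 * (R / r) powr 0 \<le> real (covering_number r (cball x R \<inter> F))"
      if "0 < r \<and> r < R \<and> R \<le> 1" "x \<in> F" for r R x
    proof -
      have "x \<in> cball x R \<inter> F" using that by auto
      moreover have "bounded (cball x R \<inter> F)" by (intro bounded_Int) auto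
      ultimately have "1 \<le> covering_number r (cball x R \<inter> F)"
        using that(1) by (intro covering_number_pos) blast+
      then show ?thesis using that(1) by simp
    qed
    then show "{\<alpha>. \<exists>C h. C > 0 \<and> h > 0 \<and> (\<forall>r R. 0 < r \<and> r < R \<and> R \<le> h \<longrightarrow>
        (\<forall>x\<in>F. real (covering_number r (cball x R \<inter> F)) \<ge> C * (R / r) powr \<alpha>))} \<noteq> {}"
      by (intro ex_in_conv[THEN iffD1] exI[of _ 0] CollectI exI[of _ 1]) auto
  next
    fix \<alpha>
    assume "\<alpha> \<in> {\<alpha>. \<exists>C h. C > 0 \<and> h > 0 \<and> (\<forall>r R. 0 < r \<and> r < R \<and> R \<le> h \<longrightarrow>
        (\<forall>x\<in>F. real (covering_number r (cball x R \<inter> F)) \<ge> C * (R / r) powr \<alpha>))}"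
    then obtain C h where C: "C > 0" "h > 0"
      and low: "\<And>r R x. 0 < r \<Longrightarrow> r < R \<Longrightarrow> R \<le> h \<Longrightarrow> x \<in> F \<Longrightarrow>
        C * (R / r) powr \<alpha> \<le> real (covering_number r (cball x R \<inter> F))"
      by blast
    define a where "a = wd i0 / ht i0"
    have a: "0 < a" using pos[OF i0(1)] unfolding a_def by simp
    \<comment> \<open>The ratio \<open>R / r\<close> of the \<open>k\<close>-th thin square;
      \<open>K\<close> collects the factors that remain when \<open>M ^ k\<close> is expressed
      through \<open>X k\<close>.\<close>
    define X where "X k = \<epsilon> / (8 * (M ^ k * a))" for k :: nat
    define K where "K = real (card I) ^ length u * (m powr (-s-e) * ((\<epsilon> / 8) powr (-s) * (\<epsilon> / (8 * a)) powr (-e)))"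
    have Mk: "0 < M ^ k" for k using m_M by simp
    have lim: "(\<lambda>k. M ^ k) \<longlonglongrightarrow> 0" using m_M M_less_1 by (intro LIMSEQ_power_zero) auto
    have X: "filterlim X at_top sequentially"
    proof -
      have "filterlim (\<lambda>k. inverse (M ^ k)) at_top sequentially"
        using Mk by (intro filterlim_inverse_at_top[OF lim]) auto
      moreover have "0 < \<epsilon> / (8 * a)" using u(2) a by simp
      ultimately have "filterlim (\<lambda>k. \<epsilon> / (8 * a) * inverse (M ^ k)) at_top sequentially"
        by (intro filterlim_tendsto_pos_mult_at_top[OF tendsto_const])
      moreover have "X = (\<lambda>k. \<epsilon> / (8 * a) * inverse (M ^ k))"
        unfolding X_def by (simp add: field_simps)
      ultimately show ?thesis by simp
    qed
    have "\<forall>\<^sub>F k in sequentially. M ^ k < h" "\<forall>\<^sub>F k in sequentially. M ^ k < 1 / a"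
      using order_tendstoD(2)[OF lim] C a by auto
    moreover have "\<forall>\<^sub>F k in sequentially. 1 < X k"
      using X unfolding filterlim_at_top_dense by blast
    ultimately have "\<forall>\<^sub>F k in sequentially. C * X k powr \<alpha> \<le> K * X k powr (s + e)"
    proof eventually_elim
      case (elim k)
      have "M ^ k * a \<le> 1" using elim(2) a by (simp add: pos_less_divide_eq)
      then have "M ^ k * wd i0 / ht i0 \<le> 1" unfolding a_def by simp
      then obtain x R where R: "x \<in> F" "0 < R" "R \<le> M ^ k"
        "real (covering_number (8 * R * (M ^ k * wd i0 / ht i0) / \<epsilon>) (cball x R \<inter> F)) \<le>
         real (card I) ^ length u * (m powr (-s-e) * ((M ^ k * wd i0 / ht i0) powr (-s) * (M ^ k) powr (-e)))"
        using thin_square[OF i0 j less_imp_le[OF e(2)] less_imp_le[OF e(1)] u] by blast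
      have Ma: "M ^ k * wd i0 / ht i0 = M ^ k * a" unfolding a_def by simp
      have r: "8 * R * (M ^ k * a) / \<epsilon> = R / X k" unfolding X_def by simp
      have "C * (R / (R / X k)) powr \<alpha> \<le> real (covering_number (R / X k) (cball x R \<inter> F))"
        using R elim by (intro low) (auto simp: field_simps)
      also have "\<dots> \<le> real (card I) ^ length u * (m powr (-s-e) * ((M ^ k * a) powr (-s) * (M ^ k) powr (-e)))"
        using R(4) unfolding Ma r .
      also have "M ^ k * a = \<epsilon> / 8 / X k" using u(2) Mk[of k] a unfolding X_def by simp
      also have "M ^ k = \<epsilon> / (8 * a) / X k" using u(2) Mk[of k] a unfolding X_def by simp
      also have "(\<epsilon> / 8 / X k) powr (-s) = (\<epsilon> / 8) powr (-s) * X k powr s"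
        using u(2) elim(3) by (intro powr_scale) auto
      also have "(\<epsilon> / (8 * a) / X k) powr (-e) = (\<epsilon> / (8 * a)) powr (-e) * X k powr e"
        using u(2) a elim(3) by (intro powr_scale) auto
      also have "R / (R / X k) = X k" using R(2) by simp
      finally show ?case unfolding K_def by (simp add: powr_add mult_ac)
    qed
    then show "\<alpha> \<le> s + e" by (rule powr_exponent_le[OF C(1) X])
  qed
  then show ?thesis using e(3) by linarith
qed

end

section \<open>The dichotomy\<close>

lemma exponent_exists:
  fixes v w :: "'a \<Rightarrow> real"
  assumes "finite A" "0 < M" "M < 1" "\<And>a. a \<in> A \<Longrightarrow> 0 \<le> v a \<and> 0 < w a \<and> w a \<le> M" "1 \<le> (\<Sum>a\<in>A. v a)"
  obtains t where "0 \<le> t" "(\<Sum>a\<in>A. v a * w a powr t) = 1"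
proof -
  let ?f = "\<lambda>t. \<Sum>a\<in>A. v a * w a powr t"
  let ?V = "\<Sum>a\<in>A. v a"
  \<comment> \<open>Chosen with \<open>M powr T = 1 / (\<Sum>a\<in>A. v a)\<close>. As
    \<open>w a \<le> M\<close>, the sum has dropped to at most 1 at \<open>T\<close>, and at 0 it is
    at least 1.\<close>
  define T where "T = ln ?V / - ln M"
  have T: "0 \<le> T" using assms(2,3,5) unfolding T_def by (intro divide_nonneg_nonneg) auto
  have "M powr T = 1 / ?V"
  proof -
    have "M powr T = exp (T * ln M)" using assms(2) by (simp add: powr_def)
    also have "T * ln M = - ln ?V" using assms(2,3) unfolding T_def by simp
    finally show ?thesis using assms(5) by (simp add: exp_minus inverse_eq_divide)
  qed
  have "?f T \<le> (\<Sum>a\<in>A. v a * M powr T)"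
    using assms(4) T by (intro sum_mono mult_left_mono powr_mono2) (auto simp: less_imp_le)
  also have "\<dots> = ?V * M powr T" by (simp add: sum_distrib_right)
  also have "\<dots> = 1" using \<open>M powr T = 1 / ?V\<close> assms(5) by simp
  finally have "?f T \<le> 1" .
  moreover have "?f 0 = ?V" using assms(4) by (intro sum.cong) force+
  then have "1 \<le> ?f 0" using assms(5) by simp
  moreover have "\<forall>x. 0 \<le> x \<and> x \<le> T \<longrightarrow> isCont ?f x"
    using assms(4) by (intro allI impI continuous_intros) force
  ultimately have "\<exists>x\<ge>0. x \<le> T \<and> ?f x = 1" using T by (intro IVT2)
  then show ?thesis using that by blast
qed

lemma (in column_system) exponents_exist:
  obtains s t where "column_exponents I F m M s t"
proof -
  have "1 \<le> card J" using I_ne finite_I by (simp add: Suc_le_eq card_gt_0_iff)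
  then have 0: "1 \<le> (\<Sum>j\<in>J. 1 :: real)" by simp
  obtain s where s: "0 \<le> s" "(\<Sum>j\<in>J. 1 * wd j powr s) = 1"
    by (rule exponent_exists[of J M "\<lambda>_. 1" "\<lambda>j. wd j"]) (use finite_I m_M M_less_1 size_J 0 in auto)
  \<comment> \<open>Every column contains a rectangle, so the sum over all rectangles is at least 1,
    which makes room for an exponent \<open>t \<ge> 0\<close>.\<close>
  have "wd j powr s \<le> (\<Sum>i\<in>column j. wd i powr s)" if j: "j \<in> J" for j
  proof -
    obtain i where i: "i \<in> column j" using column_ne[OF j] by blast
    have "wd i powr s \<le> (\<Sum>i\<in>column j. wd i powr s)" using i by (intro member_le_sum) auto
    then show ?thesis using columnD(2)[OF i] by simp
  qed
  then have "(\<Sum>j\<in>J. wd j powr s) \<le> (\<Sum>i\<in>I. wd i powr s)"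
    unfolding sum_columns by (rule sum_mono)
  then have 1: "1 \<le> (\<Sum>i\<in>I. wd i powr s)" using s(2) by simp
  have 2: "0 \<le> wd i powr s \<and> 0 < ht i \<and> ht i \<le> M" if "i \<in> I" for i
    using pos(2)[OF that] size[OF that] by simp
  obtain t where t: "0 \<le> t" "(\<Sum>i\<in>I. wd i powr s * ht i powr t) = 1"
    by (rule exponent_exists[OF finite_I m_M(3) M_less_1 2 1])
  have "column_exponents I F m M s t"
    by unfold_locales (use s t in auto)
  then show ?thesis by (rule that)
qed

context column_exponents
begin

text \<open>The weights \<open>wd j powr s\<close> add up to 1, so the equation for \<open>t\<close>
  says that the weighted mean of the column sums at \<open>t\<close> is 1. At
  \<open>\<delta> \<ge> t\<close> this mean is at least 1 although it is strictly decreasing, hence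
  \<open>\<delta> = t\<close>; and a mean 1 of numbers at least 1 forces all of them to be
  1.\<close>

lemma columns_uniform:
  assumes ge: "\<And>j. j \<in> J \<Longrightarrow> 1 \<le> (\<Sum>i\<in>column j. ht i powr \<delta>)" and "t \<le> \<delta>"
  shows "\<delta> = t" "\<And>j. j \<in> J \<Longrightarrow> (\<Sum>i\<in>column j. ht i powr t) = 1"
proof -
  have split: "(\<Sum>i\<in>I. wd i powr s * ht i powr u) = (\<Sum>j\<in>J. wd j powr s * (\<Sum>i\<in>column j. ht i powr u))" for u
    unfolding sum_columns sum_distrib_left using columnD(2) by (intro sum.cong) auto
  have "(\<Sum>j\<in>J. wd j powr s * 1) \<le> (\<Sum>j\<in>J. wd j powr s * (\<Sum>i\<in>column j. ht i powr \<delta>))"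
    using ge by (intro sum_mono mult_left_mono) auto
  then have le: "1 \<le> (\<Sum>i\<in>I. wd i powr s * ht i powr \<delta>)"
    using sum_s split by simp
  show \<delta>: "\<delta> = t"
  proof (rule ccontr)
    assume "\<delta> \<noteq> t"
    have "(\<Sum>i\<in>I. wd i powr s * ht i powr \<delta>) < (\<Sum>i\<in>I. wd i powr s * ht i powr t)"
    proof (intro sum_strict_mono finite_I I_ne)
      fix i assume i: "i \<in> I"
      have "ht i powr \<delta> < ht i powr t"
        using pos[OF i] less_1[OF i] \<open>\<delta> \<noteq> t\<close> \<open>t \<le> \<delta>\<close> by (intro powr_less_mono') auto
      then show "wd i powr s * ht i powr \<delta> < wd i powr s * ht i powr t"
        using pos[OF i] by (intro mult_strict_left_mono) auto
    qed
    then show False using le sum_t by simp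
  qed
  have "(\<Sum>j\<in>J. wd j powr s * ((\<Sum>i\<in>column j. ht i powr t) - 1)) = 0"
    using split[of t] sum_t sum_s by (simp add: right_diff_distrib sum_subtractf)
  moreover have "0 \<le> wd j powr s * ((\<Sum>i\<in>column j. ht i powr t) - 1)" if "j \<in> J" for j
    using ge[OF that] \<delta> by (intro mult_nonneg_nonneg) auto
  ultimately have "\<forall>j\<in>J. wd j powr s * ((\<Sum>i\<in>column j. ht i powr t) - 1) = 0"
    using finite_I by (subst (asm) sum_nonneg_eq_0_iff) auto
  then show "(\<Sum>i\<in>column j. ht i powr t) = 1" if "j \<in> J" for j
    using size_J[OF that] that by force
qed

lemma one_le_column_sum_0: "j \<in> J \<Longrightarrow> 1 \<le> (\<Sum>i\<in>column j. ht i powr 0)"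
proof -
  assume "j \<in> J"
  have "(\<Sum>i\<in>column j. ht i powr 0) = (\<Sum>i\<in>column j. 1)"
    using pos(2) columnD(1) by (intro sum.cong) fastforce+
  moreover have "0 < card (column j)" using column_ne[OF \<open>j \<in> J\<close>] by (simp add: card_gt_0_iff)
  ultimately show ?thesis by simp
qed

section \<open>Carpets contained in an edge of the square\<close>

lemma single_column:
  assumes "(\<forall>i\<in>I. px i = 0) \<or> (\<forall>i\<in>I. px i + wd i = 1)" "i \<in> I" "j \<in> I"
  shows "col i = col j"
  using assms(1)
proof
  assume "\<forall>i\<in>I. px i = 0"
  then have "px i = 0" "px j = 0" using assms(2,3) by auto
  then show ?thesis using columns[OF assms(2,3)] pos[OF assms(2)] pos[OF assms(3)] by (auto simp: col_def)
next
  assume "\<forall>i\<in>I. px i + wd i = 1"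
  then have "px i + wd i = 1" "px j + wd j = 1" using assms(2,3) by auto
  then show ?thesis using columns[OF assms(2,3)] pos[OF assms(2)] pos[OF assms(3)] by (auto simp: col_def)
qed

lemma single_column_exponent:
  assumes single: "\<And>i j. i \<in> I \<Longrightarrow> j \<in> I \<Longrightarrow> col i = col j"
  shows "s = 0" and "\<And>j. j \<in> J \<Longrightarrow> column j = I"
proof -
  show c: "column j = I" if "j \<in> J" for j
    using single that unfolding column_def by blast
  obtain i where i: "i \<in> I" using I_ne by blast
  have "J = {col i}" using single i by blast
  then have "wd i powr s = 1" using sum_s by simp
  then show "s = 0"
    using powr_less_mono'[of "wd i" 0 s] pos(1)[OF i] less_1(1)[OF i] s_nonneg by (cases "s = 0") auto
qed

text \<open>Two rectangles of one column that both touch the bottom, or both the top, would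
  overlap.\<close>

lemma inj_col:
  assumes "(\<forall>i\<in>I. py i = 0) \<or> (\<forall>i\<in>I. py i + ht i = 1)"
  shows "inj_on col I"
proof (rule inj_onI, rule ccontr)
  fix i j assume ij: "i \<in> I" "j \<in> I" "col i = col j" "i \<noteq> j"
  then have "px i = px j" by (simp add: col_def)
  then have "py i + ht i \<le> py j \<or> py j + ht j \<le> py i" by (rule column_apart[OF ij(1,2,4)])
  moreover have "py i = py j \<or> py i + ht i = py j + ht j" using assms ij(1,2) by auto
  ultimately show False using pos(2)[OF ij(1)] pos(2)[OF ij(2)] by linarith
qed

lemma inj_col_exponent:
  assumes "inj_on col I"
  shows "t = 0" and "(\<Sum>i\<in>I. wd i powr s) = 1"
proof -
  show 1: "(\<Sum>i\<in>I. wd i powr s) = 1"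
    using sum_s by (simp add: sum.reindex[OF assms])
  show "t = 0"
  proof (rule ccontr)
    assume "t \<noteq> 0"
    have "(\<Sum>i\<in>I. wd i powr s * ht i powr t) < (\<Sum>i\<in>I. wd i powr s * 1)"
    proof (intro sum_strict_mono finite_I I_ne)
      fix i assume i: "i \<in> I"
      have "ht i powr t < ht i powr 0"
        using pos[OF i] less_1[OF i] \<open>t \<noteq> 0\<close> t_nonneg by (intro powr_less_mono') auto
      then show "wd i powr s * ht i powr t < wd i powr s * 1"
        using pos[OF i] by (intro mult_strict_left_mono) auto
    qed
    then show False using 1 sum_t by simp
  qed
qed

lemma lower_dim_less_nondegenerate:
  assumes "i0 \<in> I" "ht i0 < wd i0" "j \<in> J" "(\<Sum>i\<in>column j. ht i powr \<delta>) < 1"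
    and "\<not> ((\<forall>i\<in>I. px i = 0) \<or> (\<forall>i\<in>I. px i + wd i = 1))"
    and "\<not> ((\<forall>i\<in>I. py i = 0) \<or> (\<forall>i\<in>I. py i + ht i = 1))"
  shows "lower_dim F < s + \<delta>"
  using lower_dim_less[OF assms(1-4)] assms(5,6) by blast

end

text \<open>A deficient column rules out the degenerate cases: with a single column
  \<open>s = 0\<close>, and its sum is 1 by the equation for \<open>t\<close>; with one rectangle in
  each column \<open>t = 0\<close>, and every column sum is at least 1.\<close>

lemma (in flat_column_exponents) dichotomy:
  assumes "i0 \<in> I" "ht i0 < wd i0"
  shows "lower_dim F < s + t \<or> homogeneous F (s + t)"
proof (cases "\<exists>j\<in>J. (\<Sum>i\<in>column j. ht i powr t) < 1")
  case True
  then obtain j where j: "j \<in> J" "(\<Sum>i\<in>column j. ht i powr t) < 1" by blast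
  have "\<not> ((\<forall>i\<in>I. px i = 0) \<or> (\<forall>i\<in>I. px i + wd i = 1))"
  proof
    assume "(\<forall>i\<in>I. px i = 0) \<or> (\<forall>i\<in>I. px i + wd i = 1)"
    note single = single_column_exponent[OF single_column[OF this]]
    have "(\<Sum>i\<in>I. wd i powr s * ht i powr t) = (\<Sum>i\<in>I. ht i powr t)"
      using single(1) pos(1) by (intro sum.cong) fastforce+
    then show False using j single(2) sum_t by simp
  qed
  moreover have "\<not> ((\<forall>i\<in>I. py i = 0) \<or> (\<forall>i\<in>I. py i + ht i = 1))"
    using inj_col_exponent(1)[OF inj_col] one_le_column_sum_0[OF j(1)] j(2) by force
  ultimately show ?thesis using lower_dim_less_nondegenerate[OF assms j] by blast
next
  case False
  then have "\<And>j. j \<in> J \<Longrightarrow> 1 \<le> (\<Sum>i\<in>column j. ht i powr t)" by force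
  from columns_uniform(2)[OF this order_refl] show ?thesis using homogeneous_F by blast
qed

context grid_exponents
begin

text \<open>The degenerate cases have to be excluded at \<open>D - s\<close>, which may exceed
  \<open>t\<close>. In a single column \<open>s = t' = 0\<close> and \<open>D\<close> is
  \<open>t\<close> or \<open>s'\<close>, both with column sum 1. If all rectangles touch the bottom
  or the top, \<open>t = s' = 0\<close> and \<open>t' \<le> s\<close>, so \<open>D - s = 0\<close>,
  where column sums are at least 1.\<close>

lemma lower_dim_less_grid:
  assumes i0: "i0 \<in> I" "ht i0 < wd i0" and D: "D = max (s + t) (s' + t')"
    and j: "j \<in> X.J" "(\<Sum>i\<in>X.column j. ht i powr (D - s)) < 1"
  shows "lower_dim F < D"
proof -
  have "\<not> ((\<forall>i\<in>I. px i = 0) \<or> (\<forall>i\<in>I. px i + wd i = 1))"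
  proof
    assume "(\<forall>i\<in>I. px i = 0) \<or> (\<forall>i\<in>I. px i + wd i = 1)"
    note cols = X.single_column[OF this]
    note single = X.single_column_exponent[OF cols]
    have "inj_on col (swap_rect ` I)"
    proof (rule inj_onI)
      fix a b assume "a \<in> swap_rect ` I" "b \<in> swap_rect ` I" "col a = col b"
      then show "a = b" using cols eq_of_col_row by blast
    qed
    note inj = Y.inj_col_exponent[OF this]
    have "(\<Sum>i\<in>I. wd i powr s * ht i powr t) = (\<Sum>i\<in>I. ht i powr t)"
      using single(1) X.pos(1) by (intro sum.cong) fastforce+
    then have "(\<Sum>i\<in>I. ht i powr t) = 1" using X.sum_t by simp
    moreover have "(\<Sum>i\<in>I. ht i powr s') = 1" using inj(2) by (simp add: sum.reindex)
    moreover have "D = t \<or> D = s'" using D single(1) inj(1) by (auto simp: max_def)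
    ultimately show False using j single by auto
  qed
  moreover have "\<not> ((\<forall>i\<in>I. py i = 0) \<or> (\<forall>i\<in>I. py i + ht i = 1))"
  proof
    assume deg: "(\<forall>i\<in>I. py i = 0) \<or> (\<forall>i\<in>I. py i + ht i = 1)"
    note inj = X.inj_col_exponent[OF X.inj_col[OF deg]]
    have "(\<forall>i\<in>swap_rect ` I. px i = 0) \<or> (\<forall>i\<in>swap_rect ` I. px i + wd i = 1)" using deg by simp
    note single = Y.single_column_exponent(1)[OF Y.single_column[OF this]]
    have "(\<Sum>i\<in>I. ht i powr s' * wd i powr t') = (\<Sum>i\<in>I. wd i powr t')"
      using single X.pos(2) by (intro sum.cong) fastforce+
    then have 1: "(\<Sum>i\<in>I. wd i powr t') = 1" using sum_swap_t by simp
    have "t' \<le> s"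
    proof (rule ccontr)
      assume "\<not> t' \<le> s"
      then have "(\<Sum>i\<in>I. wd i powr t') < (\<Sum>i\<in>I. wd i powr s)"
        using X.pos(1) X.less_1(1) by (intro sum_strict_mono X.finite_I X.I_ne powr_less_mono') force+
      then show False using 1 inj(2) by simp
    qed
    then have "D - s = 0" using D inj(1) single by simp
    then show False using j X.one_le_column_sum_0[OF j(1)] by simp
  qed
  ultimately show ?thesis using X.lower_dim_less_nondegenerate[OF i0 j] by auto
qed

text \<open>A thin square from a deficient column needs a wide rectangle, one from a deficient row a
  high rectangle. Without deficiency \<open>D - s \<ge> t\<close> and \<open>D - s' \<ge> t'\<close>
  must both be equalities, which also shows \<open>s + t = s' + t'\<close>.\<close>

lemma dichotomy:
  assumes i0: "i0 \<in> I" "ht i0 < wd i0" and i1: "i1 \<in> I" "wd i1 < ht i1"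
    and D: "D = max (s + t) (s' + t')"
  shows "lower_dim F < D \<or> homogeneous F D"
proof -
  interpret sw: grid_exponents "swap_rect ` I" "prod.swap ` F" m M s' t' s t
    by (rule grid_exponents_swap)
  consider (col) j where "j \<in> X.J" "(\<Sum>i\<in>X.column j. ht i powr (D - s)) < 1"
    | (row) k where "k \<in> Y.J" "(\<Sum>i\<in>Y.column k. ht i powr (D - s')) < 1"
    | (uniform) "\<And>j. j \<in> X.J \<Longrightarrow> 1 \<le> (\<Sum>i\<in>X.column j. ht i powr (D - s))"
        "\<And>k. k \<in> Y.J \<Longrightarrow> 1 \<le> (\<Sum>i\<in>Y.column k. ht i powr (D - s'))"
    by (meson not_le)
  then show ?thesis
  proof cases
    case col
    then show ?thesis using lower_dim_less_grid[OF i0 D] by blast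
  next
    case row
    have "swap_rect i1 \<in> swap_rect ` I" "ht (swap_rect i1) < wd (swap_rect i1)" using i1 by auto
    moreover have "D = max (s' + t') (s + t)" using D by (simp add: max.commute)
    ultimately have "lower_dim (prod.swap ` F) < D"
      using sw.lower_dim_less_grid row by blast
    then show ?thesis by (simp add: lower_dim_swap)
  next
    case uniform
    have "t \<le> D - s" "t' \<le> D - s'" using D by (auto simp: max_def)
    then have "D - s = t" "D - s' = t'"
      "\<And>j. j \<in> X.J \<Longrightarrow> (\<Sum>i\<in>X.column j. ht i powr t) = 1"
      "\<And>k. k \<in> Y.J \<Longrightarrow> (\<Sum>i\<in>Y.column k. ht i powr t') = 1"
      using X.columns_uniform[OF uniform(1)] Y.columns_uniform[OF uniform(2)] by blast+
    then have "homogeneous F D" by (intro homogeneous_grid) auto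
    then show ?thesis ..
  qed
qed

end

section \<open>Self-affine carpets\<close>

lemma subdivisionD:
  assumes "subdivision xs"
  shows "\<And>i j. i < j \<Longrightarrow> j < length xs \<Longrightarrow> xs ! i < xs ! j" "\<And>j. j < length xs \<Longrightarrow> 0 \<le> xs ! j \<and> xs ! j \<le> 1"
proof -
  have xs: "sorted_wrt (<) xs" "xs \<noteq> []" "hd xs = 0" "last xs = 1"
    using assms unfolding subdivision_def by auto
  show mono: "xs ! i < xs ! j" if "i < j" "j < length xs" for i j
    using sorted_wrt_nth_less[OF xs(1)] that by blast
  have ends: "xs ! 0 = 0" "xs ! (length xs - 1) = 1"
    using xs by (simp_all add: hd_conv_nth last_conv_nth)
  show "0 \<le> xs ! j \<and> xs ! j \<le> 1" if j: "j < length xs" for j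
  proof
    show "0 \<le> xs ! j" using mono[of 0 j] j ends by (cases "j = 0") auto
    show "xs ! j \<le> 1"
    proof (cases "j = length xs - 1")
      case False
      then have "j < length xs - 1" "length xs - 1 < length xs" using j by linarith+
      then show ?thesis using mono ends(2) by fastforce
    qed (use ends in simp)
  qed
qed

lemma subdivision_mono:
  assumes "subdivision xs" "i \<le> j" "j < length xs"
  shows "xs ! i \<le> xs ! j"
  using subdivisionD(1)[OF assms(1), of i j] assms(2,3) by (cases "i = j") auto

lemma subdivision_gap_less_1:
  assumes "subdivision xs" "3 \<le> length xs" "Suc j < length xs"
  shows "xs ! Suc j - xs ! j < 1"
proof (cases j)
  case 0
  then have "xs ! Suc j < xs ! 2" using subdivisionD(1)[OF assms(1), of 1 2] assms(2) by simp
  moreover have "xs ! 2 \<le> 1" "0 \<le> xs ! j" using subdivisionD(2)[OF assms(1)] assms(2,3) by auto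
  ultimately show ?thesis by linarith
next
  case (Suc i)
  then have "xs ! 0 < xs ! j" using subdivisionD(1)[OF assms(1), of 0 j] assms(3) by simp
  moreover have "0 < length xs" using assms(3) by linarith
  then have "xs ! Suc j \<le> 1" "0 \<le> xs ! 0"
    using subdivisionD(2)[OF assms(1)] assms(3) by blast+
  ultimately show ?thesis by linarith
qed

lemma rects_ofE:
  assumes "i \<in> rects_of xs ys"
  obtains j k where "Suc j < length xs" "Suc k < length (ys j)"
    "px i = xs ! j" "wd i = xs ! Suc j - xs ! j" "py i = ys j ! k" "ht i = ys j ! Suc k - ys j ! k"
  using assms unfolding rects_of_def by auto

text \<open>An attractor is not confined to the unit square by definition. A point with the greatest
  first coordinate is the image of some point of \<open>F\<close>, which bounds this coordinate by
  \<open>wd i\<close> times itself plus \<open>1 - wd i\<close>, hence by 1; dually for the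
  least.\<close>

lemma attractor_fst_bounds:
  fixes F :: "(real \<times> real) set"
  assumes "compact F" "F \<noteq> {}" "F = (\<Union>i\<in>I. rect_map i ` F)"
    and "\<And>i. i \<in> I \<Longrightarrow> unit_rect i \<and> wd i < 1"
  shows "fst ` F \<subseteq> {0..1}"
proof -
  have c: "compact (fst ` F)" "fst ` F \<noteq> {}"
    using compact_continuous_image[OF continuous_on_fst[OF continuous_on_id] assms(1)] assms(2) by simp_all
  obtain p where p: "p \<in> F" "\<And>q. q \<in> F \<Longrightarrow> fst q \<le> fst p"
    using compact_attains_sup[OF c] by auto
  obtain p' where p': "p' \<in> F" "\<And>q. q \<in> F \<Longrightarrow> fst p' \<le> fst q"
    using compact_attains_inf[OF c] by auto
  have "fst p \<le> 1"
  proof -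
    obtain i q where i: "i \<in> I" "q \<in> F" "p = rect_map i q" using p(1) assms(3) by blast
    have "wd i * fst q \<le> wd i * fst p" using p(2)[OF i(2)] assms(4)[OF i(1)] by (intro mult_left_mono) (auto simp: unit_rect_def)
    then have "fst p * (1 - wd i) \<le> 1 - wd i"
      using assms(4)[OF i(1)] i(3) by (simp add: unit_rect_def algebra_simps)
    then show ?thesis using assms(4)[OF i(1)] by (simp add: mult_le_cancel_right1)
  qed
  moreover have "0 \<le> fst p'"
  proof -
    obtain i q where i: "i \<in> I" "q \<in> F" "p' = rect_map i q" using p'(1) assms(3) by blast
    have "wd i * fst p' \<le> wd i * fst q" using p'(2)[OF i(2)] assms(4)[OF i(1)] by (intro mult_left_mono) (auto simp: unit_rect_def)
    then have "0 \<le> fst p' * (1 - wd i)"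
      using assms(4)[OF i(1)] i(3) by (simp add: unit_rect_def algebra_simps)
    then show ?thesis using assms(4)[OF i(1)] by (simp add: zero_le_mult_iff)
  qed
  ultimately show ?thesis using p(2) p'(2) by force
qed

lemma swap_eq_UN:
  assumes "F = (\<Union>i\<in>I. rect_map i ` F)"
  shows "prod.swap ` F = (\<Union>i\<in>swap_rect ` I. rect_map i ` prod.swap ` F)"
proof -
  have "prod.swap ` F = (\<Union>i\<in>I. prod.swap ` rect_map i ` F)"
    by (subst assms) (simp only: image_UN)
  also have "\<dots> = (\<Union>i\<in>I. rect_map (swap_rect i) ` prod.swap ` F)"
    by (simp only: image_image rect_map_swap_rect)
  finally show ?thesis by simp
qed

lemma unit_rect_swap: "unit_rect (swap_rect i) \<longleftrightarrow> unit_rect i"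
  by (auto simp: unit_rect_def)

lemma attractor_unit:
  fixes F :: "(real \<times> real) set"
  assumes "compact F" "F \<noteq> {}" "F = (\<Union>i\<in>I. rect_map i ` F)"
    and "\<And>i. i \<in> I \<Longrightarrow> unit_rect i \<and> wd i < 1 \<and> ht i < 1"
  shows "F \<subseteq> {0..1} \<times> {0..1}"
proof -
  have "fst ` F \<subseteq> {0..1}" using attractor_fst_bounds[OF assms(1-3)] assms(4) by blast
  moreover have "compact (prod.swap ` F)"
    using assms(1) by (intro compact_continuous_image continuous_on_swap)
  then have "fst ` prod.swap ` F \<subseteq> {0..1}"
    using assms(2,4) by (intro attractor_fst_bounds[OF _ _ swap_eq_UN[OF assms(3)]]) (auto simp: unit_rect_swap)
  then have "snd ` F \<subseteq> {0..1}" by (simp add: image_image)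
  ultimately show ?thesis by (force simp: subset_iff)
qed

lemma unit_rect_rects_of:
  assumes "subdivision xs" "\<And>j. Suc j < length xs \<Longrightarrow> subdivision (ys j)" "i \<in> rects_of xs ys"
  shows "unit_rect i"
proof -
  obtain j k where jk: "Suc j < length xs" "Suc k < length (ys j)"
    "px i = xs ! j" "wd i = xs ! Suc j - xs ! j" "py i = ys j ! k" "ht i = ys j ! Suc k - ys j ! k"
    using rects_ofE[OF assms(3)] .
  have "xs ! j < xs ! Suc j" "0 \<le> xs ! j" "xs ! Suc j \<le> 1"
    using subdivisionD[OF assms(1)] jk(1) by auto
  moreover have "ys j ! k < ys j ! Suc k" "0 \<le> ys j ! k" "ys j ! Suc k \<le> 1"
    using subdivisionD[OF assms(2)[OF jk(1)]] jk(2) by auto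
  ultimately show ?thesis unfolding unit_rect_def jk(3-6) by auto
qed

lemma column_systemI:
  fixes F :: "(real \<times> real) set"
  assumes "finite I" "I \<noteq> {}" "0 < m" "M < 1"
    and size: "\<And>i. i \<in> I \<Longrightarrow> m \<le> wd i \<and> wd i \<le> M \<and> m \<le> ht i \<and> ht i \<le> M"
    and sub: "subdivision xs" "\<And>j. Suc j < length xs \<Longrightarrow> subdivision (ys j)" "I \<subseteq> rects_of xs ys"
    and F: "F \<noteq> {}" "F \<subseteq> {0..1} \<times> {0..1}" "F = (\<Union>i\<in>I. rect_map i ` F)"
  shows "column_system I F m M"
proof
  show "unit_rect i" if "i \<in> I" for i
    using unit_rect_rects_of[of xs ys i] sub that by blast
next
  fix i i' assume i: "i \<in> I" "i' \<in> I"
  obtain j k where j: "Suc j < length xs" "Suc k < length (ys j)"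
    "px i = xs ! j" "wd i = xs ! Suc j - xs ! j" "py i = ys j ! k" "ht i = ys j ! Suc k - ys j ! k"
    using rects_ofE sub(3) i(1) by blast
  obtain j' k' where j': "Suc j' < length xs" "Suc k' < length (ys j')"
    "px i' = xs ! j'" "wd i' = xs ! Suc j' - xs ! j'" "py i' = ys j' ! k'" "ht i' = ys j' ! Suc k' - ys j' ! k'"
    using rects_ofE sub(3) i(2) by blast
  show "px i = px i' \<and> wd i = wd i' \<or> px i + wd i \<le> px i' \<or> px i' + wd i' \<le> px i"
    using subdivision_mono[OF sub(1), of "Suc j" j'] subdivision_mono[OF sub(1), of "Suc j'" j] j j'
    by (cases j j' rule: linorder_cases) auto
  assume "i \<noteq> i'" "px i = px i'"
  have jj: "j = j'"
    using \<open>px i = px i'\<close> subdivisionD(1)[OF sub(1), of j j'] subdivisionD(1)[OF sub(1), of j' j] j j'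
    by (cases j j' rule: linorder_cases) auto
  have "k \<noteq> k'"
  proof
    assume "k = k'"
    then have "i = i'" using j j' jj by (intro prod_eqI) auto
    then show False using \<open>i \<noteq> i'\<close> by simp
  qed
  then show "py i + ht i \<le> py i' \<or> py i' + ht i' \<le> py i"
    using subdivision_mono[OF sub(2)[OF j(1)], of "Suc k" k'] subdivision_mono[OF sub(2)[OF j(1)], of "Suc k'" k] j j' jj
    by (cases k k' rule: linorder_cases) auto
qed (use assms in auto)

lemma swap_rects_of:
  assumes "I \<subseteq> rects_of xs (\<lambda>_. ys)"
  shows "swap_rect ` I \<subseteq> rects_of ys (\<lambda>_. xs)"
  using assms unfolding rects_of_def swap_rect_def by fastforce

lemma size_bounds_exist:
  assumes "finite I" "I \<noteq> {}" "\<And>i. i \<in> I \<Longrightarrow> 0 < wd i \<and> wd i < 1 \<and> 0 < ht i \<and> ht i < (1::real)"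
  obtains m M where "0 < m" "M < 1" "\<And>i. i \<in> I \<Longrightarrow> m \<le> wd i \<and> wd i \<le> M \<and> m \<le> ht i \<and> ht i \<le> M"
proof -
  let ?A = "wd ` I \<union> ht ` I"
  have A: "finite ?A" "?A \<noteq> {}" using assms(1,2) by auto
  show ?thesis
  proof (rule that[of "Min ?A" "Max ?A"])
    show "0 < Min ?A" "Max ?A < 1" using A assms(3) by auto
    show "Min ?A \<le> wd i \<and> wd i \<le> Max ?A \<and> Min ?A \<le> ht i \<and> ht i \<le> Max ?A" if "i \<in> I" for i
      using A that by (intro conjI Min_le Max_ge) auto
  qed
qed

definition carpet_dims :: "(real \<times> real) set \<Rightarrow> real \<Rightarrow> bool" where
  "carpet_dims F D \<longleftrightarrow> 0 \<le> D \<and> box_regular F D \<and> (lower_dim F < D \<or> homogeneous F D)"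

lemma carpet_dims_swap:
  assumes "bounded F"
  shows "carpet_dims (prod.swap ` F) D \<longleftrightarrow> carpet_dims F D"
  unfolding carpet_dims_def box_regular_swap[OF assms] lower_dim_swap homogeneous_swap ..

lemma carpet_dims_flat:
  assumes "column_system I F m M" "\<And>i. i \<in> I \<Longrightarrow> ht i \<le> wd i" "i0 \<in> I" "ht i0 < wd i0"
  shows "\<exists>D. carpet_dims F D"
proof -
  obtain s t where "column_exponents I F m M s t"
    using column_system.exponents_exist[OF assms(1)] .
  then interpret flat_column_exponents I F m M s t
    using assms(2) by (simp add: flat_column_exponents_def flat_column_exponents_axioms_def)
  show ?thesis
    unfolding carpet_dims_def using box_regular_F dichotomy[OF assms(3,4)] s_nonneg t_nonneg
    by (intro exI[of _ "s + t"]) auto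
qed

lemma carpet_dims_grid:
  assumes "column_system I F m M" "column_system (swap_rect ` I) (prod.swap ` F) m M"
    and "i0 \<in> I" "ht i0 < wd i0" "i1 \<in> I" "wd i1 < ht i1"
  shows "\<exists>D. carpet_dims F D"
proof -
  obtain s t where 1: "column_exponents I F m M s t"
    using column_system.exponents_exist[OF assms(1)] .
  obtain s' t' where 2: "column_exponents (swap_rect ` I) (prod.swap ` F) m M s' t'"
    using column_system.exponents_exist[OF assms(2)] .
  interpret grid_exponents I F m M s t s' t'
    using 1 2 by (rule grid_exponents.intro)
  show ?thesis
    unfolding carpet_dims_def
    using box_regular_grid dichotomy[OF assms(3-6) refl] X.s_nonneg X.t_nonneg
    by (intro exI[of _ "max (s + t) (s' + t')"]) (auto simp: max_def)
qed

lemma self_affine_carpet_dims: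
  assumes "self_affine_carpet F"
  shows "compact F \<and> F \<noteq> {} \<and> (\<exists>D. carpet_dims F D)"
proof -
  obtain I where I: "extended_lalley_gatzouras I \<or> baranski I" "2 \<le> card I"
    "\<exists>(a, b, c, d)\<in>I. c \<noteq> d" "is_attractor (rect_map ` I) F"
    using assms unfolding self_affine_carpet_def by blast
  obtain i0 where i0: "i0 \<in> I" "wd i0 \<noteq> ht i0" using I(3) by auto
  have fin: "finite I" "I \<noteq> {}" using I(2) by (auto intro: card_ge_0_finite)
  have F: "compact F" "F \<noteq> {}" "F = (\<Union>i\<in>I. rect_map i ` F)"
    using I(4) unfolding is_attractor_def by auto
  have "\<exists>D. carpet_dims F D"
    using I(1)
  proof
    assume "extended_lalley_gatzouras I"
    then obtain xs ys where sub: "subdivision xs" "3 \<le> length xs"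
      "\<And>j. Suc j < length xs \<Longrightarrow> subdivision (ys j)" "I \<subseteq> rects_of xs ys"
      "\<forall>(a, b, c, d)\<in>I. c \<ge> d"
      unfolding extended_lalley_gatzouras_def by blast
    have flat: "ht i \<le> wd i" if "i \<in> I" for i using sub(5) that by auto
    have unit: "unit_rect i" if "i \<in> I" for i
      using unit_rect_rects_of[of xs ys i] sub(1,3,4) that by blast
    have less: "wd i < 1" if "i \<in> I" for i
      using rects_ofE[of i xs ys] subdivision_gap_less_1[OF sub(1,2)] sub(4) that by (metis subsetD)
    \<comment> \<open>A column may be left uncut horizontally; the height of a selected rectangle is
      still below 1 because it is at most the base length.\<close>
    have bd: "0 < wd i \<and> wd i < 1 \<and> 0 < ht i \<and> ht i < 1" if "i \<in> I" for i
      using unit[OF that] less[OF that] flat[OF that] by (auto simp: unit_rect_def)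
    obtain m M where m: "0 < m" "M < 1" "\<And>i. i \<in> I \<Longrightarrow> m \<le> wd i \<and> wd i \<le> M \<and> m \<le> ht i \<and> ht i \<le> M"
      using size_bounds_exist[OF fin bd] by blast
    have "F \<subseteq> {0..1} \<times> {0..1}" using attractor_unit[OF F] unit bd by blast
    then have "column_system I F m M"
      using column_systemI[OF fin m sub(1,3,4) F(2) _ F(3)] by blast
    then show ?thesis using carpet_dims_flat flat i0 by (metis less_le)
  next
    assume "baranski I"
    then obtain xs ys where sub: "subdivision xs" "3 \<le> length xs" "subdivision ys" "3 \<le> length ys"
      "I \<subseteq> rects_of xs (\<lambda>_. ys)"
      unfolding baranski_def by blast
    have unit: "unit_rect i" if "i \<in> I" for i
      using unit_rect_rects_of[of xs "\<lambda>_. ys" i] sub(1,3,5) that by blast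
    have less: "wd i < 1" "ht i < 1" if "i \<in> I" for i
      using rects_ofE[of i xs "\<lambda>_. ys"] subdivision_gap_less_1[OF sub(1,2)] subdivision_gap_less_1[OF sub(3,4)]
        sub(5) that by (metis subsetD)+
    have bd: "0 < wd i \<and> wd i < 1 \<and> 0 < ht i \<and> ht i < 1" if "i \<in> I" for i
      using unit[OF that] less[OF that] by (auto simp: unit_rect_def)
    obtain m M where m: "0 < m" "M < 1" "\<And>i. i \<in> I \<Longrightarrow> m \<le> wd i \<and> wd i \<le> M \<and> m \<le> ht i \<and> ht i \<le> M"
      using size_bounds_exist[OF fin bd] by blast
    have Fu: "F \<subseteq> {0..1} \<times> {0..1}" using attractor_unit[OF F] unit bd by blast
    then have X: "column_system I F m M"
      using column_systemI[OF fin m sub(1) _ sub(5) F(2) _ F(3)] sub(3) by blast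
    have Y: "column_system (swap_rect ` I) (prod.swap ` F) m M"
    proof (rule column_systemI[OF _ _ m(1,2) _ sub(3) _ swap_rects_of[OF sub(5)]])
      show "prod.swap ` F = (\<Union>i\<in>swap_rect ` I. rect_map i ` prod.swap ` F)" by (rule swap_eq_UN[OF F(3)])
      show "prod.swap ` F \<subseteq> {0..1} \<times> {0..1}" using Fu by auto
    qed (use fin m(3) F(2) sub(1) in auto)
    \<comment> \<open>A grid whose rectangles all lean the same way belongs to the flat case, after
      an exchange of the axes if they are high.\<close>
    consider "\<forall>i\<in>I. ht i \<le> wd i" | "\<forall>i\<in>I. wd i \<le> ht i"
      | a b where "a \<in> I" "ht a < wd a" "b \<in> I" "wd b < ht b"
      by (meson not_le)
    then show ?thesis
    proof cases
      case 1
      then show ?thesis using carpet_dims_flat[OF X] i0 by (metis less_le)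
    next
      case 2
      have "\<exists>D. carpet_dims (prod.swap ` F) D"
      proof (rule carpet_dims_flat[OF Y])
        show "swap_rect i0 \<in> swap_rect ` I" "ht (swap_rect i0) < wd (swap_rect i0)" using i0 2 by force+
      qed (use 2 in auto)
      then show ?thesis using carpet_dims_swap[OF compact_imp_bounded[OF F(1)]] by simp
    next
      case 3
      then show ?thesis using carpet_dims_grid[OF X Y] by blast
    qed
  qed
  then show ?thesis using F by blast
qed

theorem corollary2p15:
  fixes F :: "(real \<times> real) set"
  assumes "self_affine_carpet F"
  shows "has_box_dim F (box_dim F) \<and>
    (lower_dim F < box_dim F \<or>
     (lower_dim F = hausdorff_dim F \<and> hausdorff_dim F = box_dim F \<and> box_dim F = assouad_dim F))"
proof -
  obtain D where F: "compact F" "F \<noteq> {}" and D: "0 \<le> D" "box_regular F D" "lower_dim F < D \<or> homogeneous F D"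
    using self_affine_carpet_dims[OF assms] unfolding carpet_dims_def by blast
  obtain c C where c: "0 < c" "0 < C" "\<And>r. 0 < r \<Longrightarrow> r \<le> 1 \<Longrightarrow>
      c * r powr (-D) \<le> real (covering_number r F) \<and> real (covering_number r F) \<le> C * r powr (-D)"
    using D(2) unfolding box_regular_def by blast
  have box: "has_box_dim F D" by (rule has_box_dimI[OF c(1,2) zero_less_one c(3)])
  moreover have "box_dim F = D" by (rule has_box_dim_unique[OF box])
  moreover have "hausdorff_dim F = D" if "homogeneous F D"
    using hausdorff_dim_eqI[OF that F D(1), of C] c(3) by blast
  ultimately show ?thesis
    using D(3) homogeneous_dims[OF _ F(2)] by auto
qed

end
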